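(* Let $\mathbf{a}=(a_1,\ldots,a_n)$ be a weak composition and let $k\le n$ be a positive integer. Then $$\kappa_{\mathbf{a}}\cdot s_{(1)}(x_1,\ldots,x_k)=\sum_{\substack{c\ k\text{-addable column for }\mathbf{a}\\ \varnothing\neq R\subseteq \mathrm{Row}^{c}_{\mathbf{a},k}}}(-1)^{\#R-1}\,\kappa_{\mathbf{drop}^{(c,R)}_{\mathbf{a}}+\mathbf{e}_{\min(R)}} .$$ Moreover, the terms on the right-hand side are pairwise distinct.
   Context: Fix a positive integer $n$. A weak composition is a sequence $\mathbf{a}=(a_1,\ldots,a_n)$ of nonnegative integers; $\mathbf{e}_k$ is the weak composition with a single nonzero part, equal to $1$, in position $k$; addition is coordinatewise. $s_{(1)}(x_1,\ldots,x_k)=x_1+\cdots+x_k$. A diagram is a finite set of unit cells in the first quadrant; the cell in column $c$ and row $r$ ($c,r\ge 1$, columns numbered left to right, rows bottom to top) is denoted $(c,r)$. The key diagram of $\mathbf{a}$ has cells $(c,r)$ with $1\le c\le a_r$. A Kohnert move on a diagram selects the rightmost cell of some row and moves it down within its column to the first unoccupied position below (in a row $\geq 1$), if one exists, jumping over other cells as needed. $\mathrm{KD}(\mathbf{a})$ is the set of diagrams obtainable from the key diagram of $\mathbf{a}$ by a (possibly empty) sequence of Kohnert moves. For a diagram $T$, $\mathbf{wt}(T)_i$ is the number of cells in row $i$. The key polynomial is $\kappa_{\mathbf{a}}=\sum_{T\in\mathrm{KD}(\mathbf{a})}x_1^{\mathbf{wt}(T)_1}\cdots x_n^{\mathbf{wt}(T)_n}$.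 Addable cells: $(c,r)$ is addable for $\mathbf{a}$ if $a_r<c$ and there is $s\ge r$ with $a_s=c-1$. For $(c,r)$ addable, the maximal support composition is $\mathbf{supp}^{(c,r)}_{\mathbf{a}}=t_{r_0,r_1}t_{r_1,r_2}\cdots t_{r_{q-1},r_q}\cdot\mathbf{a}$, where $t_{i,j}$ interchanges the parts in positions $i$ and $j$ (rightmost factor applied first), and $r=r_0<r_1<\cdots<r_q$ is defined by: $r_i$ is the smallest index $s>r_{i-1}$ with $a_{r_{i-1}}<a_s\le c-1$, stopping when no such index exists (then $a_{r_q}=c-1$). $k$-addable cells: $(c,r)$ with $r\le k$ is $k$-addable for $\mathbf{a}$ if (1) $a_r<c$, and if $a_r<c-1$ then there is some $l>k$ with $a_l=c-1$; and (2) for all $r<i\le k$, either $a_i<a_r$ or $a_i\ge c$. Put $\mathrm{Row}^{c}_{\mathbf{a},k}=\{r\le k\mid (c,r)\text{ is }k\text{-addable for }\mathbf{a}\}$; the column $c$ is $k$-addable for $\mathbf{a}$ if this set is nonempty. For nonempty $R=\{r_{-p}<\cdots<r_{-1}<r_0\}\subseteq\mathrm{Row}^c_{\mathbf{a},k}$, set $\mathbf{drop}^{(c,R)}_{\mathbf{a}}=t_{r_{-p},r_{-p+1}}\cdots t_{r_{-1},r_0}\cdot\mathbf{supp}^{(c,r_0)}_{\mathbf{a}}$. *)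

theory Defs
  imports "HOL-Library.Poly_Mapping" "HOL-Combinatorics.Transposition"
begin

(* Polynomials in the variables x_1, x_2, ... over the integers: finitely supported maps
   from exponent vectors to coefficients, multiplied by convolution. *)
type_synonym mpoly = "(nat \<Rightarrow>\<^sub>0 nat) \<Rightarrow>\<^sub>0 int"

definition xvar :: "nat \<Rightarrow> mpoly" where
  "xvar i = Poly_Mapping.single (Poly_Mapping.single i 1) 1"

(* A weak composition (a_1, ..., a_n) is a function on nat, extended by 0 outside {1..n}. *)
definition weak_composition :: "nat \<Rightarrow> (nat \<Rightarrow> nat) \<Rightarrow> bool" where
  "weak_composition n a \<longleftrightarrow> (\<forall>i. i \<notin> {1..n} \<longrightarrow> a i = 0)"

definition unit_composition :: "nat \<Rightarrow> nat \<Rightarrow> nat" where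
  "unit_composition k = (\<lambda>i. if i = k then 1 else 0)"

definition add_composition :: "(nat \<Rightarrow> nat) \<Rightarrow> (nat \<Rightarrow> nat) \<Rightarrow> nat \<Rightarrow> nat" where
  "add_composition a b = (\<lambda>i. a i + b i)"

(* s_(1)(x_1, ..., x_k) *)
definition schur1 :: "nat \<Rightarrow> mpoly" where
  "schur1 k = (\<Sum>i=1..k. xvar i)"


(* A cell is a pair (column, row), both counted from 1; rows are numbered bottom to top. *)
type_synonym diagram = "(nat \<times> nat) set"

definition key_diagram :: "nat \<Rightarrow> (nat \<Rightarrow> nat) \<Rightarrow> diagram" where
  "key_diagram n a = {(c, r). 1 \<le> r \<and> r \<le> n \<and> 1 \<le> c \<and> c \<le> a r}"

definition kohnert_move :: "diagram \<Rightarrow> diagram \<Rightarrow> bool" where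
  "kohnert_move T T' \<longleftrightarrow>
     (\<exists>c r r'. (c, r) \<in> T \<and> (\<forall>c'. (c', r) \<in> T \<longrightarrow> c' \<le> c) \<and>
        1 \<le> r' \<and> r' < r \<and> (c, r') \<notin> T \<and> (\<forall>s. r' < s \<and> s < r \<longrightarrow> (c, s) \<in> T) \<and>
        T' = insert (c, r') (T - {(c, r)}))"

definition KD :: "nat \<Rightarrow> (nat \<Rightarrow> nat) \<Rightarrow> diagram set" where
  "KD n a = {T. kohnert_move\<^sup>*\<^sup>* (key_diagram n a) T}"

definition wt :: "diagram \<Rightarrow> nat \<Rightarrow> nat" where
  "wt T i = card {c. (c, i) \<in> T}"

definition key_poly :: "nat \<Rightarrow> (nat \<Rightarrow> nat) \<Rightarrow> mpoly" where
  "key_poly n a = (\<Sum>T\<in>KD n a. \<Prod>i=1..n. xvar i ^ wt T i)"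

lemma finite_KD: "finite (KD n a)"
proof -
  define B where "B = (\<Union>r\<in>{1..n}. {1..a r}) \<times> {1..n}"
  have "T \<subseteq> B" if "kohnert_move\<^sup>*\<^sup>* (key_diagram n a) T" for T
    using that
  proof (induction rule: rtranclp_induct)
    case base
    show ?case by (auto simp: key_diagram_def B_def)
  next
    case (step T T')
    from step.hyps(2) obtain c r r' where *: "(c, r) \<in> T" "1 \<le> r'" "r' < r"
      "T' = insert (c, r') (T - {(c, r)})"
      unfolding kohnert_move_def by blast
    have "(c, r) \<in> B" using step.IH *(1) by blast
    hence "(c, r') \<in> B" using *(2,3) by (auto simp: B_def)
    thus ?case using step.IH *(4) by blast
  qed
  hence "KD n a \<subseteq> Pow B" by (auto simp: KD_def)
  moreover have "finite B" by (simp add: B_def)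
  ultimately show ?thesis by (meson finite_Pow_iff finite_subset)
qed


definition swap_parts :: "nat \<Rightarrow> nat \<Rightarrow> (nat \<Rightarrow> nat) \<Rightarrow> nat \<Rightarrow> nat" where
  "swap_parts i j a = a \<circ> Transposition.transpose i j"

(* swap_chain [r_0, ..., r_q] a = t_{r_0,r_1} t_{r_1,r_2} ... t_{r_{q-1},r_q} . a,
   with the rightmost factor applied first *)
fun swap_chain :: "nat list \<Rightarrow> (nat \<Rightarrow> nat) \<Rightarrow> nat \<Rightarrow> nat" where
  "swap_chain (i # j # rs) a = swap_parts i j (swap_chain (j # rs) a)"
| "swap_chain [i] a = a"
| "swap_chain [] a = a"

(* The list r = r_0 < r_1 < ... < r_q of rows defining the maximal support composition *)
function supp_rows :: "nat \<Rightarrow> (nat \<Rightarrow> nat) \<Rightarrow> nat \<Rightarrow> nat \<Rightarrow> nat list" where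
  "supp_rows n a c r =
     (if \<exists>s. r < s \<and> s \<le> n \<and> a r < a s \<and> a s \<le> c - 1
      then r # supp_rows n a c (LEAST s. r < s \<and> s \<le> n \<and> a r < a s \<and> a s \<le> c - 1)
      else [r])"
  by auto
termination
proof (relation "measure (\<lambda>(n, a, c, r). n - r)", goal_cases)
  case 1
  show ?case by simp
next
  case (2 n a c r)
  then have "r < (LEAST s. r < s \<and> s \<le> n \<and> a r < a s \<and> a s \<le> c - 1) \<and>
    (LEAST s. r < s \<and> s \<le> n \<and> a r < a s \<and> a s \<le> c - 1) \<le> n"
    by (metis (mono_tags, lifting) LeastI)
  then show ?case by auto
qed

declare supp_rows.simps [simp del]

definition supp :: "nat \<Rightarrow> (nat \<Rightarrow> nat) \<Rightarrow> nat \<Rightarrow> nat \<Rightarrow> nat \<Rightarrow> nat" where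
  "supp n a c r = swap_chain (supp_rows n a c r) a"

(* The condition a r < c forces c to be positive, so c - 1 is not truncated. *)
definition k_addable :: "nat \<Rightarrow> (nat \<Rightarrow> nat) \<Rightarrow> nat \<Rightarrow> nat \<Rightarrow> nat \<Rightarrow> bool" where
  "k_addable n a k c r \<longleftrightarrow>
     1 \<le> r \<and> r \<le> k \<and> a r < c \<and>
     (a r < c - 1 \<longrightarrow> (\<exists>l. k < l \<and> l \<le> n \<and> a l = c - 1)) \<and>
     (\<forall>i. r < i \<and> i \<le> k \<longrightarrow> a i < a r \<or> a i \<ge> c)"

definition Row :: "nat \<Rightarrow> (nat \<Rightarrow> nat) \<Rightarrow> nat \<Rightarrow> nat \<Rightarrow> nat set" where
  "Row n a k c = {r. k_addable n a k c r}"

definition k_addable_column :: "nat \<Rightarrow> (nat \<Rightarrow> nat) \<Rightarrow> nat \<Rightarrow> nat \<Rightarrow> bool" where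
  "k_addable_column n a k c \<longleftrightarrow> Row n a k c \<noteq> {}"

(* For R = {r_{-p} < ... < r_0}, the increasing enumeration of R gives the factors
   t_{r_{-p},r_{-p+1}} ... t_{r_{-1},r_0}, and r_0 = Max R. *)
definition drop_composition :: "nat \<Rightarrow> (nat \<Rightarrow> nat) \<Rightarrow> nat \<Rightarrow> nat set \<Rightarrow> nat \<Rightarrow> nat" where
  "drop_composition n a c R = swap_chain (sorted_list_of_set R) (supp n a c (Max R))"

(* The pairs (c, R) of a k-addable column c and a nonempty subset R of its k-addable rows *)
definition pieri_index :: "nat \<Rightarrow> (nat \<Rightarrow> nat) \<Rightarrow> nat \<Rightarrow> (nat \<times> nat set) set" where
  "pieri_index n a k =
     {(c, R). k_addable_column n a k c \<and> R \<noteq> {} \<and> R \<subseteq> Row n a k c}"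

lemma finite_pieri_index: "finite (pieri_index n a k)"
proof -
  have "c \<in> Suc ` a ` ({1..k} \<union> {..n})" if "k_addable n a k c r" for c r
  proof (cases "a r < c - 1")
    case True
    with that obtain l where "l \<le> n" "a l = c - 1" by (auto simp: k_addable_def)
    moreover have "c = Suc (c - 1)" using True by simp
    ultimately show ?thesis by (metis UnI2 atMost_iff imageI)
  next
    case False
    with that have "c = Suc (a r)" "r \<in> {1..k}" by (auto simp: k_addable_def)
    then show ?thesis by blast
  qed
  then have "pieri_index n a k \<subseteq> (Suc ` a ` ({1..k} \<union> {..n})) \<times> Pow {1..k}"
    unfolding pieri_index_def k_addable_column_def Row_def
    by (auto simp: k_addable_def)
  then show ?thesis by (rule finite_subset) auto
qed

end

theory Submission
  imports Defs
begin

text \<open>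
  Every Kohnert diagram has a key, computed by greedily matching the rows of each column with the key
  of the columns to its right, and \<open>KD(a)\<close> consists of the diagrams whose key is at most \<open>a\<close> in
  Bruhat order. Grouping diagrams by key gives \<open>\<kappa>\<^sub>a = \<Sum>\<^sub>d\<^sub>\<le>\<^sub>a A\<^sub>d\<close> with Demazure atoms \<open>A\<^sub>d\<close>, and
  the recursion over columns shows how the Demazure operators \<open>\<pi>\<^sub>i\<close> act on atoms.

  With \<open>N\<^sub>d(m,t) = #{i \<ge> t. d\<^sub>i \<ge> m}\<close>, Bruhat order is pointwise comparison of \<open>N\<close>. By induction
  along \<open>\<pi>\<^sub>i\<close>, the product \<open>\<kappa>\<^sub>a \<cdot> s\<^sub>1(x\<^sub>1, \<dots>, x\<^sub>k)\<close> is the sum of the atoms \<open>A\<^sub>d\<close> for which some column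
  \<open>c\<close> satisfies \<open>N\<^sub>d(m,t) \<le> N\<^sub>a(m,t) + [m = c, t \<le> k]\<close>, with equality at \<open>t = 1\<close>. At the step \<open>i = k\<close>
  one uses \<open>\<pi>\<^sub>k(x\<^sub>k f) = x\<^sub>k f + x\<^sub>k\<^sub>+\<^sub>1 \<pi>\<^sub>k f\<close>. For fixed \<open>c\<close> this set of \<open>d\<close> is the union of the Bruhat
  intervals below \<open>supp\<^sup>(\<^sup>c\<^sup>,\<^sup>r\<^sup>) + e\<^sub>r\<close>, \<open>r\<close> a \<open>k\<close>-addable row, and the intersection of the intervals of
  the rows in \<open>R\<close> is the interval below \<open>drop\<^sup>(\<^sup>c\<^sup>,\<^sup>R\<^sup>) + e\<^sub>m\<^sub>i\<^sub>n\<^sub>R\<close>. Inclusion-exclusion finishes the proof.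
\<close>

section \<open>Demazure operators\<close>

text \<open>The product is first written as a positive, multiplicity-free sum of atoms; signs enter
  only when a union of Bruhat intervals is counted. Tail counts are the right coordinates because
  exchanging rows \<open>i\<close> and \<open>i + 1\<close> changes the count at
  \<open>t = i + 1\<close> only, so every Demazure step reduces to a comparison at a single row. The
  obstacle is the step \<open>i = k\<close>: there s_1(x_1, ..., x_k) is not symmetric in x_k and
  x_(k+1). The formula for \<open>k\<close> is then obtained from the one for \<open>k + 1\<close>,
  to which the operator applies, by removing x_(k+1) \<kappa>_a, and the atoms of that product must
  be identified separately. Hence the induction carries all \<open>k\<close> at once. Distinctness
  rests on another property: a key polynomial has nonnegative coefficients and contains the monomial
  of its own key diagram, which dominates all its monomials in the tail sums of exponents. So it
  determines its composition even up to sign, and the compositions themselves are told apart by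
  their tail counts.\<close>

definition swap_vars :: "nat \<Rightarrow> mpoly \<Rightarrow> mpoly" where
  "swap_vars i = Poly_Mapping.map_key (Poly_Mapping.map_key (transpose i (Suc i)))"

lemma map_key_transpose_involutory [simp]:
  "Poly_Mapping.map_key (transpose i j) (Poly_Mapping.map_key (transpose i j) p) = p"
  by (simp add: Poly_Mapping.map_key_compose Poly_Mapping.map_key_id id_def)

lemma inj_map_key_transpose: "inj (Poly_Mapping.map_key (transpose i j))"
  by (metis injI map_key_transpose_involutory)

lemma swap_vars_add: "swap_vars i (f + g) = swap_vars i f + swap_vars i g"
  by (simp add: swap_vars_def Poly_Mapping.map_key_plus inj_map_key_transpose)

lemma swap_vars_0 [simp]: "swap_vars i 0 = 0"
  by (simp add: swap_vars_def inj_map_key_transpose)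

lemma swap_vars_single:
  "swap_vars i (Poly_Mapping.single p c) = Poly_Mapping.single (Poly_Mapping.map_key (transpose i (Suc i)) p) c"
  using Poly_Mapping.map_key_single[OF inj_map_key_transpose, of i "Suc i" "Poly_Mapping.map_key (transpose i (Suc i)) p" c]
  by (simp add: swap_vars_def)

lemma swap_vars_1 [simp]: "swap_vars i 1 = 1"
  using swap_vars_single[of i 0 1] by simp

lemma swap_vars_swap_vars [simp]: "swap_vars i (swap_vars i f) = f"
  by (simp add: swap_vars_def Poly_Mapping.map_key_compose inj_map_key_transpose
      Poly_Mapping.map_key_id o_def)

text \<open>Builds a polynomial by adding one monomial at a time. The step does not ask
  \<open>k\<close> to be absent from \<open>p\<close>, so it combines directly with
  additivity.\<close>

lemma poly_mapping_add_induct [case_names zero add]: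
  assumes "P 0" and "\<And>k c p. P p \<Longrightarrow> P (Poly_Mapping.single k c + p)"
  shows "P (p :: 'a \<Rightarrow>\<^sub>0 'b::comm_monoid_add)"
proof (induction p rule: Poly_Mapping.update_induct)
  case const
  then show ?case using assms(1) by simp
next
  case (update p k c)
  have "Poly_Mapping.update k c p = Poly_Mapping.single k c + p"
    using update.hyps
    by (intro poly_mapping_eqI) (auto simp: lookup_update lookup_add lookup_single in_keys_iff when_def)
  then show ?case using assms(2) update.IH by simp
qed

lemma swap_vars_mult: "swap_vars i (f * g) = swap_vars i f * swap_vars i g"
proof (induction f rule: poly_mapping_add_induct)
  case zero
  show ?case by simp
next
  case (add k c f)
  have "swap_vars i (Poly_Mapping.single k c * g) = swap_vars i (Poly_Mapping.single k c) * swap_vars i g"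
  proof (induction g rule: poly_mapping_add_induct)
    case zero
    show ?case by simp
  next
    case (add k' c' g)
    then show ?case
      by (simp add: distrib_left swap_vars_add swap_vars_single mult_single
          Poly_Mapping.map_key_plus)
  qed
  then show ?case by (simp add: distrib_right swap_vars_add add.IH)
qed

lemma swap_vars_uminus: "swap_vars i (- f) = - swap_vars i f"
  by (metis add.right_inverse add_eq_0_iff swap_vars_0 swap_vars_add)

lemma swap_vars_diff: "swap_vars i (f - g) = swap_vars i f - swap_vars i g"
  using swap_vars_add[of i f "- g"] by (simp add: swap_vars_uminus)

lemma swap_vars_sum: "swap_vars i (sum f A) = (\<Sum>x\<in>A. swap_vars i (f x))"
  by (induction A rule: infinite_finite_induct) (auto simp: swap_vars_add)

lemma swap_vars_prod: "swap_vars i (prod f A) = (\<Prod>x\<in>A. swap_vars i (f x))"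
  by (induction A rule: infinite_finite_induct) (auto simp: swap_vars_mult)

lemma swap_vars_xvar [simp]: "swap_vars i (xvar j) = xvar (transpose i (Suc i) j)"
proof -
  have "Poly_Mapping.map_key (transpose i (Suc i)) (Poly_Mapping.single j (1::nat)) =
    Poly_Mapping.single (transpose i (Suc i) j) 1"
    using Poly_Mapping.map_key_single[of "transpose i (Suc i)" "transpose i (Suc i) j" "1::nat"]
    by simp
  then show ?thesis by (simp add: xvar_def swap_vars_single)
qed

lemma xvar_eq_iff [simp]: "xvar i = xvar j \<longleftrightarrow> i = j"
proof
  assume "xvar i = xvar j"
  then have "Poly_Mapping.keys (xvar i) = Poly_Mapping.keys (xvar j)" by simp
  then have "Poly_Mapping.single i (1::nat) = Poly_Mapping.single j 1" by (simp add: xvar_def)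
  then have "Poly_Mapping.keys (Poly_Mapping.single i (1::nat)) = Poly_Mapping.keys (Poly_Mapping.single j (1::nat))" by simp
  then show "i = j" by simp
qed simp

text \<open>\<open>demazure i f g\<close> says \<open>g = \<pi>\<^sub>i f\<close> for the Demazure operator
  \<open>\<pi>\<^sub>i f = (x\<^sub>i f - x\<^sub>i\<^sub>+\<^sub>1 s\<^sub>i f) / (x\<^sub>i - x\<^sub>i\<^sub>+\<^sub>1)\<close>; as a relation it needs no division.\<close>

definition demazure :: "nat \<Rightarrow> mpoly \<Rightarrow> mpoly \<Rightarrow> bool" where
  "demazure i f g \<longleftrightarrow> (xvar i - xvar (Suc i)) * g = xvar i * f - xvar (Suc i) * swap_vars i f"

text \<open>These polynomials have no zero divisors, so the nonzero factor
  \<open>xvar i - xvar (Suc i)\<close> cancels. Computing one image in two ways is how new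
  identities are obtained later.\<close>

lemma demazure_unique: "demazure i f g \<Longrightarrow> demazure i f g' \<Longrightarrow> g = g'"
  by (metis demazure_def mult_cancel_left n_not_Suc_n right_minus_eq xvar_eq_iff)

lemma demazure_0: "demazure i 0 0"
  by (simp add: demazure_def)

lemma demazure_add: "demazure i f g \<Longrightarrow> demazure i f' g' \<Longrightarrow> demazure i (f + f') (g + g')"
  unfolding demazure_def swap_vars_add distrib_left by simp

lemma demazure_diff: "demazure i f g \<Longrightarrow> demazure i f' g' \<Longrightarrow> demazure i (f - f') (g - g')"
  unfolding demazure_def swap_vars_diff right_diff_distrib by simp

lemma demazure_sum:
  "(\<And>x. x \<in> A \<Longrightarrow> demazure i (f x) (g x)) \<Longrightarrow> demazure i (sum f A) (sum g A)"
  by (induction A rule: infinite_finite_induct) (auto simp: demazure_0 demazure_add)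

lemma demazure_mult: "swap_vars i h = h \<Longrightarrow> demazure i f g \<Longrightarrow> demazure i (h * f) (h * g)"
  unfolding demazure_def swap_vars_mult
  by (metis (no_types, lifting) mult.left_commute right_diff_distrib)

text \<open>Both the right-hand side of the defining equation and the factor x_i - x_(i+1) are
  antisymmetric, so their quotient \<open>g\<close> is symmetric.\<close>

lemma demazure_symmetric: "demazure i f g \<Longrightarrow> swap_vars i g = g"
proof -
  assume d: "demazure i f g"
  have "swap_vars i ((xvar i - xvar (Suc i)) * g) = swap_vars i (xvar i * f - xvar (Suc i) * swap_vars i f)"
    using d by (simp add: demazure_def)
  then have "(xvar (Suc i) - xvar i) * swap_vars i g = - (xvar i * f - xvar (Suc i) * swap_vars i f)"
    by (simp add: swap_vars_mult swap_vars_diff algebra_simps)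
  also have "\<dots> = (xvar (Suc i) - xvar i) * g"
    using d by (simp add: demazure_def algebra_simps)
  finally show ?thesis by simp
qed

lemma demazure_of_symmetric: "swap_vars i g = g \<Longrightarrow> demazure i g g"
  by (simp add: demazure_def algebra_simps)

text \<open>The twisted Leibniz rule. It handles the factors that are not symmetric in x_i and
  x_(i+1): a first column meeting row \<open>i\<close> but not row \<open>i + 1\<close>, and the
  variable x_k of the product.\<close>

lemma demazure_xvar_mult:
  "demazure i f g \<Longrightarrow> demazure i (xvar i * f) (xvar i * f + xvar (Suc i) * g)"
proof -
  assume d: "demazure i f g"
  have "(xvar i - xvar (Suc i)) * (xvar i * f + xvar (Suc i) * g)
    = (xvar i - xvar (Suc i)) * xvar i * f + xvar (Suc i) * ((xvar i - xvar (Suc i)) * g)"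
    by (simp add: algebra_simps)
  also have "\<dots> = xvar i * (xvar i * f) - xvar (Suc i) * swap_vars i (xvar i * f)"
    unfolding d[unfolded demazure_def] by (simp add: swap_vars_mult algebra_simps)
  finally show ?thesis by (simp add: demazure_def)
qed

lemma swap_vars_schur1: "k \<noteq> i \<Longrightarrow> i \<ge> 1 \<Longrightarrow> swap_vars i (schur1 k) = schur1 k"
proof -
  assume "k \<noteq> i" "i \<ge> 1"
  then have "bij_betw (transpose i (Suc i)) {1..k} {1..k}"
    by (intro bij_betw_byWitness[where f' = "transpose i (Suc i)"]) (auto simp: transpose_def)
  then show ?thesis
    by (simp add: schur1_def swap_vars_sum sum.reindex_bij_betw[where g = xvar])
qed

section \<open>Bruhat order on compositions\<close>

definition tail_count :: "nat \<Rightarrow> (nat \<Rightarrow> nat) \<Rightarrow> nat \<Rightarrow> nat \<Rightarrow> int" where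
  "tail_count n d m t = (\<Sum>i=t..n. of_bool (m \<le> d i))"

lemma tail_count_split:
  "t \<le> n \<Longrightarrow> tail_count n d m t = of_bool (m \<le> d t) + tail_count n d m (Suc t)"
  unfolding tail_count_def by (subst sum.atLeast_Suc_atMost) auto

lemma tail_count_empty [simp]: "n < t \<Longrightarrow> tail_count n d m t = 0"
  by (simp add: tail_count_def)

lemma tail_count_interval:
  "s \<le> t \<Longrightarrow> t \<le> Suc n \<Longrightarrow>
    tail_count n d m s = (\<Sum>i=s..<t. of_bool (m \<le> d i)) + tail_count n d m t"
proof (induction rule: dec_induct)
  case (step u)
  then show ?case by (simp add: tail_count_split[of u])
qed simp

lemma tail_count_nonneg [simp]: "0 \<le> tail_count n d m t"
  by (simp add: tail_count_def sum_nonneg)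

text \<open>The difference of the counts at \<open>i\<close> and \<open>Suc i\<close> is the
  indicator of \<open>m \<le> d i\<close>; over all \<open>m\<close> these indicators determine
  \<open>d i\<close>.\<close>

lemma tail_count_eq_imp_eq:
  assumes "weak_composition n d" "weak_composition n x"
    and eq: "\<And>m t. 1 \<le> m \<Longrightarrow> 1 \<le> t \<Longrightarrow> tail_count n d m t = tail_count n x m t"
  shows "d = x"
proof
  fix i
  show "d i = x i"
  proof (cases "i \<in> {1..n}")
    case True
    have "m \<le> d i \<longleftrightarrow> m \<le> x i" if "1 \<le> m" for m
    proof -
      have "(of_bool (m \<le> d i) :: int) = of_bool (m \<le> x i)"
        using eq[OF that, of i] eq[OF that, of "Suc i"] True
          tail_count_split[of i n d m] tail_count_split[of i n x m] by simp
      then show ?thesis by (metis (full_types) of_bool_eq_iff)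
    qed
    then show ?thesis
      by (metis One_nat_def Suc_leI le_antisym le_refl not_gr_zero le0)
  next
    case False
    then show ?thesis using assms(1,2) by (auto simp: weak_composition_def)
  qed
qed

text \<open>The tableau criterion for Bruhat order: the columns of the two key diagrams are compared entrywise.\<close>

definition bruhat_le :: "nat \<Rightarrow> (nat \<Rightarrow> nat) \<Rightarrow> (nat \<Rightarrow> nat) \<Rightarrow> bool" where
  "bruhat_le n d x \<longleftrightarrow> weak_composition n d \<and>
    (\<forall>m\<ge>1. tail_count n d m 1 = tail_count n x m 1) \<and>
    (\<forall>m\<ge>1. \<forall>t\<ge>1. tail_count n d m t \<le> tail_count n x m t)"

lemma bruhat_le_refl: "weak_composition n d \<Longrightarrow> bruhat_le n d d"
  by (simp add: bruhat_le_def)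

lemma bruhat_le_trans: "bruhat_le n d x \<Longrightarrow> bruhat_le n x y \<Longrightarrow> bruhat_le n d y"
  unfolding bruhat_le_def by (metis order_trans)

lemma bruhat_le_antisym:
  "bruhat_le n d x \<Longrightarrow> bruhat_le n x d \<Longrightarrow> d = x"
  by (rule tail_count_eq_imp_eq[of n]) (auto simp: bruhat_le_def intro: order_antisym)

definition compositions :: "nat \<Rightarrow> nat \<Rightarrow> (nat \<Rightarrow> nat) set" where
  "compositions n w = {d. weak_composition n d \<and> (\<forall>i. d i \<le> w)}"

lemma finite_compositions: "finite (compositions n w)"
proof -
  have "compositions n w \<subseteq> {d. \<forall>i. (i \<in> {1..n} \<longrightarrow> d i \<in> {0..w}) \<and> (i \<notin> {1..n} \<longrightarrow> d i = 0)}"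
    by (auto simp: compositions_def weak_composition_def)
  then show ?thesis
    by (rule finite_subset) (rule finite_set_of_finite_funs; simp)
qed

lemma le_bound_iff_tail_count:
  assumes "weak_composition n d" "1 \<le> m"
  shows "(\<exists>i. m \<le> d i) \<longleftrightarrow> 1 \<le> tail_count n d m 1"
proof
  assume "\<exists>i. m \<le> d i"
  then obtain i where i: "m \<le> d i" by blast
  then have "i \<in> {1..n}" using assms unfolding weak_composition_def by fastforce
  then have "(\<Sum>j\<in>{i}. of_bool (m \<le> d j)) \<le> tail_count n d m 1"
    unfolding tail_count_def by (intro sum_mono2) auto
  then show "1 \<le> tail_count n d m 1" using i by simp
next
  assume "1 \<le> tail_count n d m 1"
  then have "tail_count n d m 1 \<noteq> 0" by simp
  then show "\<exists>i. m \<le> d i" unfolding tail_count_def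
    by (metis (no_types, lifting) of_bool_eq_0_iff sum.not_neutral_contains_not_neutral)
qed

lemma compositions_tail_count_eq:
  assumes "weak_composition n d" "x \<in> compositions n w"
    and "\<And>m. 1 \<le> m \<Longrightarrow> tail_count n d m 1 = tail_count n x m 1"
  shows "d \<in> compositions n w"
proof -
  have "d i \<le> w" for i
  proof (rule ccontr)
    assume "\<not> d i \<le> w"
    then have "\<exists>i. Suc w \<le> d i" by (auto simp: not_le Suc_le_eq)
    then have "\<exists>i. Suc w \<le> x i"
      using le_bound_iff_tail_count[of n d "Suc w"] le_bound_iff_tail_count[of n x "Suc w"] assms
      by (simp add: compositions_def)
    then show False using assms(2) by (auto simp: compositions_def Suc_le_eq) (metis leD)
  qed
  then show ?thesis using assms(1) by (simp add: compositions_def)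
qed

lemma bruhat_le_compositions:
  "bruhat_le n d x \<Longrightarrow> x \<in> compositions n w \<Longrightarrow> d \<in> compositions n w"
  by (rule compositions_tail_count_eq[of n d x w]) (auto simp: bruhat_le_def)

section \<open>Exchanging and sorting parts\<close>

abbreviation swap_adj :: "nat \<Rightarrow> (nat \<Rightarrow> nat) \<Rightarrow> nat \<Rightarrow> nat" where
  "swap_adj i \<equiv> swap_parts i (Suc i)"

lemma swap_parts_apply: "swap_parts i j d l = (if l = i then d j else if l = j then d i else d l)"
  by (simp add: swap_parts_def transpose_def)

lemma swap_parts_involutory [simp]: "swap_parts i j (swap_parts i j d) = d"
  by (auto simp: swap_parts_apply fun_eq_iff)

lemma swap_parts_trivial: "d i = d j \<Longrightarrow> swap_parts i j d = d"
  by (auto simp: swap_parts_apply fun_eq_iff)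

lemma weak_composition_swap_parts:
  "weak_composition n d \<Longrightarrow> i \<in> {1..n} \<Longrightarrow> j \<in> {1..n} \<Longrightarrow> weak_composition n (swap_parts i j d)"
  by (auto simp: weak_composition_def swap_parts_apply)

lemma compositions_swap_parts:
  "d \<in> compositions n w \<Longrightarrow> i \<in> {1..n} \<Longrightarrow> j \<in> {1..n} \<Longrightarrow> swap_parts i j d \<in> compositions n w"
  using weak_composition_swap_parts[of n d i j] by (auto simp: compositions_def swap_parts_apply)

lemma weak_composition_swap_adj_iff:
  "1 \<le> i \<Longrightarrow> i < n \<Longrightarrow> weak_composition n (swap_adj i d) \<longleftrightarrow> weak_composition n d"
  using weak_composition_swap_parts[of n d i "Suc i"] weak_composition_swap_parts[of n "swap_adj i d" i "Suc i"]
  by auto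

lemma tail_count_cong:
  "(\<And>i. t \<le> i \<Longrightarrow> i \<le> n \<Longrightarrow> d i = x i) \<Longrightarrow> tail_count n d m t = tail_count n x m t"
  by (simp add: tail_count_def)

lemma tail_count_swap_adj_Suc:
  "i < n \<Longrightarrow> tail_count n (swap_adj i d) m (Suc i) = of_bool (m \<le> d i) + tail_count n d m (Suc (Suc i))"
  by (simp add: tail_count_split[of "Suc i"] swap_parts_apply)
    (rule tail_count_cong, simp add: swap_parts_apply)

lemma tail_count_swap_adj:
  assumes "i < n" "t \<noteq> Suc i"
  shows "tail_count n (swap_adj i d) m t = tail_count n d m t"
proof (cases "t \<le> i")
  case True
  have "tail_count n (swap_adj i d) m i = tail_count n d m i"
    using assms by (simp add: tail_count_split[of i] tail_count_swap_adj_Suc)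
      (simp add: tail_count_split[of "Suc i"] swap_parts_apply)
  then show ?thesis
    using True assms tail_count_interval[of t i n d m] tail_count_interval[of t i n "swap_adj i d" m]
    by (simp add: swap_parts_apply)
next
  case False
  then show ?thesis using assms by (intro tail_count_cong) (auto simp: swap_parts_apply)
qed

text \<open>Chosen so that \<pi>_i sends the sum of the atoms over a set to the sum over the
  preimage of that set under this map.\<close>

definition sort_adj :: "nat \<Rightarrow> (nat \<Rightarrow> nat) \<Rightarrow> nat \<Rightarrow> nat" where
  "sort_adj i d = (if d i < d (Suc i) then swap_adj i d else d)"

lemma sort_adj_ge: "sort_adj i d (Suc i) \<le> sort_adj i d i"
  by (auto simp: sort_adj_def swap_parts_apply)

lemma tail_count_sort_adj:
  "i < n \<Longrightarrow> t \<noteq> Suc i \<Longrightarrow> tail_count n (sort_adj i d) m t = tail_count n d m t"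
  by (simp add: sort_adj_def tail_count_swap_adj)

lemma tail_count_sort_adj_Suc:
  "i < n \<Longrightarrow> tail_count n (sort_adj i d) m (Suc i)
    = of_bool (m \<le> d i \<and> m \<le> d (Suc i)) + tail_count n d m (Suc (Suc i))"
  by (auto simp: sort_adj_def tail_count_swap_adj_Suc tail_count_split[of "Suc i" n d])

lemma sort_adj_compositions:
  "1 \<le> i \<Longrightarrow> i < n \<Longrightarrow> sort_adj i d \<in> compositions n w \<longleftrightarrow> d \<in> compositions n w"
  using compositions_swap_parts[of d n w i "Suc i"] compositions_swap_parts[of "swap_adj i d" n w i "Suc i"]
  by (auto simp: sort_adj_def)

lemma weak_composition_sort_adj:
  "1 \<le> i \<Longrightarrow> i < n \<Longrightarrow> weak_composition n (sort_adj i d) \<longleftrightarrow> weak_composition n d"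
  by (simp add: sort_adj_def weak_composition_swap_adj_iff)

lemma tail_count_0 [simp]: "tail_count n d 0 t = int (Suc n - t)"
  by (simp add: tail_count_def)

lemma bruhat_le_tail_count:
  "bruhat_le n d x \<Longrightarrow> 1 \<le> t \<Longrightarrow> tail_count n d m t \<le> tail_count n x m t"
  by (cases "m = 0") (auto simp: bruhat_le_def)

lemma bruhat_le_total:
  "bruhat_le n d x \<Longrightarrow> tail_count n d m (Suc 0) = tail_count n x m (Suc 0)"
  by (cases "m = 0") (auto simp: bruhat_le_def)

text \<open>Only starting rows \<open>t\<close> with \<open>i < t\<close> and
  \<open>t \<le> j\<close> separate the two positions, and only thresholds above \<open>a i\<close>
  and up to \<open>a j\<close> distinguish the two parts.\<close>

lemma tail_count_swap_parts:
  assumes "1 \<le> i" "i < j" "j \<le> n" "a i < a j"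
  shows "tail_count n (swap_parts i j a) m t
    = tail_count n a m t - of_bool (i < t \<and> t \<le> j \<and> a i < m \<and> m \<le> a j)"
proof -
  let ?e = "of_bool (a i < m \<and> m \<le> a j) :: int"
  have "tail_count n (swap_parts i j a) m t
    = (\<Sum>l=t..n. of_bool (m \<le> a l) + (if l = i then ?e else 0) - (if l = j then ?e else 0))"
    unfolding tail_count_def using assms by (intro sum.cong refl) (auto simp: swap_parts_apply)
  also have "\<dots> = tail_count n a m t + (if i \<in> {t..n} then ?e else 0) - (if j \<in> {t..n} then ?e else 0)"
    by (simp add: sum_subtractf sum.distrib tail_count_def sum.delta)
  also have "\<dots> = tail_count n a m t - of_bool (i < t \<and> t \<le> j \<and> a i < m \<and> m \<le> a j)"
    using assms by auto
  finally show ?thesis .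
qed

text \<open>Take \<open>j\<close> as the last row where \<open>d\<close> and \<open>a\<close> differ
  and \<open>i\<close> as the last row before \<open>j\<close> whose part of \<open>a\<close> is at
  least \<open>d j\<close> and less than \<open>a j\<close>. The exchange then lowers the counts of
  \<open>a\<close> only at places where \<open>d\<close> has slack.\<close>

lemma bruhat_le_below_swap:
  assumes le: "bruhat_le n d a" and wc: "weak_composition n a" and "d \<noteq> a"
  obtains i j where "1 \<le> i" "i < j" "j \<le> n" "a i < a j" "bruhat_le n d (swap_parts i j a)"
proof -
  define D where "D = {i. d i \<noteq> a i}"
  have wd: "weak_composition n d" using le by (simp add: bruhat_le_def)
  have D: "D \<subseteq> {1..n}" "finite D" "D \<noteq> {}"
  proof -
    show "D \<subseteq> {1..n}" using wc wd unfolding D_def weak_composition_def by force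
    then show "finite D" by (rule finite_subset) simp
    show "D \<noteq> {}" using \<open>d \<noteq> a\<close> by (auto simp: D_def)
  qed
  define j where "j = Max D"
  have jD: "j \<in> D" using D by (simp add: j_def)
  have j: "1 \<le> j" "j \<le> n" "d j \<noteq> a j" using jD D by (auto simp: D_def)
  have above: "d s = a s" if "j < s" for s
  proof (rule ccontr)
    assume "d s \<noteq> a s"
    then have "s \<in> D" by (simp add: D_def)
    then have "s \<le> j" using D by (simp add: j_def)
    then show False using that by simp
  qed
  have tail: "tail_count n d m (Suc j) = tail_count n a m (Suc j)" for m
    by (rule tail_count_cong) (auto simp: above)
  have dj: "d j < a j"
  proof (rule ccontr)
    assume "\<not> d j < a j"
    then have "a j < d j" using j by simp
    then show False
      using bruhat_le_tail_count[OF le j(1), of "d j"] tail[of "d j"] j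
      by (simp add: tail_count_split[of j])
  qed
  \<comment> \<open>Over the rows \<open>t..<j\<close> the counts of \<open>a\<close> are the same
    for all thresholds from \<open>d j\<close> to \<open>a j\<close>, while those of
    \<open>d\<close> can only shrink. The gap of one comes from row \<open>j\<close>, where both
    parts reach \<open>d j\<close> but only \<open>a j\<close> reaches \<open>m\<close>.\<close>
  have strict: "tail_count n d m t + 1 \<le> tail_count n a m t"
    if t: "1 \<le> t" "t \<le> j" and m: "d j < m" "m \<le> a j"
      and no: "\<And>s. t \<le> s \<Longrightarrow> s < j \<Longrightarrow> \<not> (d j \<le> a s \<and> a s < a j)" for m t
  proof -
    let ?S = "\<lambda>x m. (\<Sum>s=t..<j. of_bool (m \<le> x s) :: int)"
    have split: "tail_count n x m' t = ?S x m' + of_bool (m' \<le> x j) + tail_count n x m' (Suc j)" for x m'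
      using tail_count_interval[of t j n x m'] tail_count_split[of j n x m'] t j by simp
    have "?S a m = ?S a (d j)"
    proof (intro sum.cong refl)
      fix s assume "s \<in> {t..<j}"
      then have "d j \<le> a s \<Longrightarrow> a j \<le> a s" using no[of s] by auto
      then show "of_bool (m \<le> a s) = (of_bool (d j \<le> a s) :: int)" using m by auto
    qed
    moreover have "?S d m \<le> ?S d (d j)"
      using m by (intro sum_mono) auto
    moreover have "?S d (d j) \<le> ?S a (d j)"
      using bruhat_le_tail_count[OF le t(1), of "d j"] split[of d "d j"] split[of a "d j"] tail dj by simp
    ultimately show ?thesis
      using split[of d m] split[of a m] tail m by simp
  qed
  define I where "I = {s. 1 \<le> s \<and> s < j \<and> d j \<le> a s \<and> a s < a j}"
  have I: "finite I" "I \<noteq> {}"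
  proof -
    show "finite I" unfolding I_def by simp
    \<comment> \<open>Without such a row the slack would extend down to \<open>t = 1\<close>,
      against the equality of totals.\<close>
    show "I \<noteq> {}"
    proof
      assume "I = {}"
      then have "tail_count n d (a j) 1 + 1 \<le> tail_count n a (a j) 1"
        using j dj by (intro strict) (auto simp: I_def)
      then show False using bruhat_le_total[OF le, of "a j"] by simp
    qed
  qed
  define i where "i = Max I"
  have "i \<in> I" using I by (simp add: i_def)
  then have i: "1 \<le> i" "i < j" "d j \<le> a i" "a i < a j" by (auto simp: I_def)
  have imax: "\<not> (d j \<le> a s \<and> a s < a j)" if "i < s" "s < j" for s
  proof
    assume "d j \<le> a s \<and> a s < a j"
    then have "s \<in> I" using that i by (simp add: I_def)
    then show False using Max_ge[OF I(1), of s] that unfolding i_def by simp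
  qed
  have "bruhat_le n d (swap_parts i j a)"
    unfolding bruhat_le_def
  proof (intro conjI allI impI)
    show "weak_composition n d" by (fact wd)
    fix m :: nat assume "1 \<le> m"
    show "tail_count n d m 1 = tail_count n (swap_parts i j a) m 1"
      using i j bruhat_le_total[OF le, of m] by (simp add: tail_count_swap_parts)
    fix t :: nat assume "1 \<le> t"
    show "tail_count n d m t \<le> tail_count n (swap_parts i j a) m t"
    proof (cases "i < t \<and> t \<le> j \<and> a i < m \<and> m \<le> a j")
      case True
      then have "tail_count n d m t + 1 \<le> tail_count n a m t"
        using i imax by (intro strict) auto
      then show ?thesis using i j by (simp add: tail_count_swap_parts)
    next
      case False
      then show ?thesis
        using i j bruhat_le_tail_count[OF le \<open>1 \<le> t\<close>, of m] by (auto simp: tail_count_swap_parts)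
    qed
  qed
  then show ?thesis using i j that by blast
qed

section \<open>Bruhat steps realized by Kohnert moves\<close>

lemma kohnert_moves_fall:
  assumes "(c, r) \<in> T" "(c, i) \<notin> T" "1 \<le> i" "i < r"
    and "\<And>c'. (c', r) \<in> T \<Longrightarrow> c' \<le> c"
    and "\<And>s c'. i < s \<Longrightarrow> s < r \<Longrightarrow> (c, s) \<notin> T \<Longrightarrow> (c', s) \<in> T \<Longrightarrow> c' \<le> c"
  shows "kohnert_move\<^sup>*\<^sup>* T (insert (c, i) (T - {(c, r)}))"
  using assms
proof (induction r arbitrary: T rule: less_induct)
  case (less r)
  \<comment> \<open>A single move stops at the highest gap \<open>r'\<close>. By the last assumption
    the cell is again rightmost in row \<open>r'\<close>, so the rest of the fall is an instance of
    the induction hypothesis.\<close>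
  define r' where "r' = Max {s. i \<le> s \<and> s < r \<and> (c, s) \<notin> T}"
  have fin: "finite {s. i \<le> s \<and> s < r \<and> (c, s) \<notin> T}" by simp
  have "r' \<in> {s. i \<le> s \<and> s < r \<and> (c, s) \<notin> T}"
    unfolding r'_def by (rule Max_in[OF fin]) (use less.prems in auto)
  then have r': "i \<le> r'" "r' < r" "(c, r') \<notin> T" by auto
  have between: "(c, s) \<in> T" if "r' < s" "s < r" for s
    using Max_ge[OF fin, of s] that r'(1) unfolding r'_def[symmetric] by force
  define T1 where "T1 = insert (c, r') (T - {(c, r)})"
  have move: "kohnert_move T T1"
    unfolding kohnert_move_def T1_def using less.prems r' between
    by (intro exI[of _ c] exI[of _ r] exI[of _ r']) auto
  show ?case
  proof (cases "r' = i")
    case True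
    then show ?thesis using move by (auto simp: T1_def)
  next
    case False
    have "kohnert_move\<^sup>*\<^sup>* T1 (insert (c, i) (T1 - {(c, r')}))"
    proof (rule less.IH)
      show "r' < r" "(c, r') \<in> T1" "1 \<le> i" "i < r'" "(c, i) \<notin> T1"
        using r' False less.prems by (auto simp: T1_def)
      show "c' \<le> c" if "(c', r') \<in> T1" for c'
        using that less.prems(6)[of r' c'] r' False by (auto simp: T1_def)
      show "c' \<le> c" if "i < s" "s < r'" "(c, s) \<notin> T1" "(c', s) \<in> T1" for s c'
        using that less.prems(6)[of s c'] r' by (auto simp: T1_def)
    qed
    moreover have "insert (c, i) (T1 - {(c, r')}) = insert (c, i) (T - {(c, r)})"
      using r' by (auto simp: T1_def)
    ultimately show ?thesis using move by (simp add: converse_rtranclp_into_rtranclp)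
  qed
qed

lemma key_diagram_swap_in_KD:
  assumes "1 \<le> i" "i < j" "j \<le> n" "a i < a j"
  shows "key_diagram n (swap_parts i j a) \<in> KD n a"
proof -
  \<comment> \<open>In \<open>D x\<close> the cells of row \<open>j\<close> in columns beyond
    \<open>x\<close> have already fallen to row \<open>i\<close>. Working from right to left keeps
    the next cell rightmost in row \<open>j\<close>, and a row of a key diagram with a gap in some
    column has no cells further right.\<close>
  define D where "D x = {(c, r) \<in> key_diagram n a. \<not> (r = j \<and> x < c)} \<union> {(c, r). r = i \<and> x < c \<and> c \<le> a j}" for x
  have "kohnert_move\<^sup>*\<^sup>* (key_diagram n a) (D x)" if "a i \<le> x" "x \<le> a j" for x
    using that(2,1)
  proof (induction rule: inc_induct)
    case base
    have "D (a j) = key_diagram n a" by (auto simp: D_def key_diagram_def)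
    then show ?case by simp
  next
    case (step x)
    have "kohnert_move\<^sup>*\<^sup>* (D (Suc x)) (insert (Suc x, i) (D (Suc x) - {(Suc x, j)}))"
      by (rule kohnert_moves_fall) (use assms step in \<open>auto simp: D_def key_diagram_def\<close>)
    also have "insert (Suc x, i) (D (Suc x) - {(Suc x, j)}) = D x"
      using assms step by (auto simp: D_def key_diagram_def)
    finally show ?case using step by simp
  qed
  from this[of "a i"] have "kohnert_move\<^sup>*\<^sup>* (key_diagram n a) (D (a i))" using assms by simp
  moreover have "D (a i) = key_diagram n (swap_parts i j a)"
    using assms by (auto simp: D_def key_diagram_def swap_parts_apply split: if_splits)
  ultimately show ?thesis by (simp add: KD_def)
qed

text \<open>This weighted sum is the measure of both inductions that sort a composition by
  exchanging ascents.\<close>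

lemma weighted_sum_swap_parts_less:
  fixes a :: "nat \<Rightarrow> nat"
  assumes ij: "1 \<le> i" "i < j" "j \<le> n" "a i < a j"
  shows "(\<Sum>l=1..n. l * swap_parts i j a l) < (\<Sum>l=1..n. l * a l)"
proof -
  have two: "(\<Sum>l=1..n. l * x l) = i * x i + (j * x j + (\<Sum>l\<in>{1..n}-{i}-{j}. l * x l))" for x :: "nat \<Rightarrow> nat"
    using ij sum.remove[of "{1..n}" i "\<lambda>l. l * x l"] sum.remove[of "{1..n}-{i}" j "\<lambda>l. l * x l"] by simp
  have rest: "(\<Sum>l\<in>{1..n}-{i}-{j}. l * swap_parts i j a l) = (\<Sum>l\<in>{1..n}-{i}-{j}. l * a l)"
    by (rule sum.cong) (auto simp: swap_parts_apply)
  \<comment> \<open>With these gaps the difference of the two sides is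
    \<open>Suc p * Suc q\<close>.\<close>
  obtain p q where p: "j = i + Suc p" and q: "a j = a i + Suc q"
    using ij by (metis less_imp_Suc_add add_Suc_right)
  have "i * a j + j * a i < i * a i + j * a j"
    unfolding q by (simp add: p algebra_simps)
  then show ?thesis
    using two[of a] two[of "swap_parts i j a"] rest ij by (simp add: swap_parts_apply)
qed

lemma key_diagram_in_KD:
  "weak_composition n a \<Longrightarrow> bruhat_le n d a \<Longrightarrow> key_diagram n d \<in> KD n a"
proof (induction "\<Sum>i=1..n. i * a i" arbitrary: a rule: less_induct)
  case less
  show ?case
  proof (cases "d = a")
    case True
    then show ?thesis by (simp add: KD_def)
  next
    case False
    then obtain i j where ij: "1 \<le> i" "i < j" "j \<le> n" "a i < a j" "bruhat_le n d (swap_parts i j a)"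
      using bruhat_le_below_swap less.prems by metis
    have "(\<Sum>l=1..n. l * swap_parts i j a l) < (\<Sum>l=1..n. l * a l)"
      by (rule weighted_sum_swap_parts_less[OF ij(1-4)])
    then have "key_diagram n d \<in> KD n (swap_parts i j a)"
      using less.hyps ij weak_composition_swap_parts[OF less.prems(1), of i j] by simp
    then show ?thesis
      using key_diagram_swap_in_KD[OF ij(1-4)] by (simp add: KD_def)
  qed
qed

section \<open>Kohnert diagrams as tableaux with a key\<close>

text \<open>Greedy matching of column \<open>m\<close> of the key \<open>b\<close> with the rows of
  \<open>C\<close>: going up the rows, the count starts at the full total and drops at each row of
  \<open>C\<close> unless it would fall below the count of \<open>b\<close>. Rows start at 1, so the
  value at \<open>t = 0\<close> is only a filler.\<close>

primrec lift_count :: "nat \<Rightarrow> (nat \<Rightarrow> nat) \<Rightarrow> nat set \<Rightarrow> nat \<Rightarrow> nat \<Rightarrow> int" where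
  "lift_count n b C m 0 = tail_count n b m (Suc 0)"
| "lift_count n b C m (Suc t) = (if t = 0 then tail_count n b m (Suc 0)
     else max (tail_count n b m (Suc t)) (lift_count n b C m t - of_bool (t \<in> C)))"

lemma lift_count_1 [simp]: "lift_count n b C m (Suc 0) = tail_count n b m (Suc 0)"
  by simp

lemma lift_count_Suc: "1 \<le> t \<Longrightarrow> lift_count n b C m (Suc t)
  = max (tail_count n b m (Suc t)) (lift_count n b C m t - of_bool (t \<in> C))"
  by simp

declare lift_count.simps [simp del]
declare lift_count_1 [simp]

lemma lift_count_ge: "1 \<le> t \<Longrightarrow> tail_count n b m t \<le> lift_count n b C m t"
  by (induction t rule: nat_induct_at_least) (auto simp: lift_count_Suc)

text \<open>The greedy count is the least sequence that stays above the counts of \<open>b\<close>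
  and descends by at most one, at rows of \<open>C\<close> only. All upper bounds on keys are
  obtained by exhibiting such a sequence \<open>E\<close>.\<close>

lemma lift_count_least:
  assumes "1 \<le> t" "t \<le> Suc n"
    and "\<And>t. 1 \<le> t \<Longrightarrow> t \<le> Suc n \<Longrightarrow> tail_count n b m t \<le> E t"
    and "\<And>t. 1 \<le> t \<Longrightarrow> t \<le> n \<Longrightarrow> E t - of_bool (t \<in> C) \<le> E (Suc t)"
  shows "lift_count n b C m t \<le> E t"
  using assms(1,2)
proof (induction t rule: nat_induct_at_least)
  case base
  then show ?case using assms(3)[of 1] by simp
next
  case (Suc t)
  then show ?case using assms(3)[of "Suc t"] assms(4)[of t] by (simp add: lift_count_Suc)
qed

text \<open>\<open>lifts n b d\<close>: a tableau has key \<open>d\<close> if its first column occupies the rows where \<open>d\<close> is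
  positive and its remaining columns have key \<open>b\<close>.\<close>

definition lifts :: "nat \<Rightarrow> (nat \<Rightarrow> nat) \<Rightarrow> (nat \<Rightarrow> nat) \<Rightarrow> bool" where
  "lifts n b d \<longleftrightarrow> weak_composition n b \<and> weak_composition n d \<and>
     (\<forall>m\<ge>1. \<forall>t\<in>{1..Suc n}. tail_count n d (Suc m) t = lift_count n b {r. 0 < d r} m t)"

lemma lifts_tail_count:
  "lifts n b d \<Longrightarrow> 1 \<le> m \<Longrightarrow> 1 \<le> t \<Longrightarrow> t \<le> Suc n \<Longrightarrow>
    tail_count n d (Suc m) t = lift_count n b {r. 0 < d r} m t"
  by (simp add: lifts_def)

lemma lifts_ge:
  "lifts n b d \<Longrightarrow> 1 \<le> m \<Longrightarrow> 1 \<le> t \<Longrightarrow> tail_count n b m t \<le> tail_count n d (Suc m) t"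
  by (cases "t \<le> Suc n") (auto simp: lifts_def lift_count_ge)

lemma lifts_total:
  "lifts n b d \<Longrightarrow> 1 \<le> m \<Longrightarrow> tail_count n d (Suc m) (Suc 0) = tail_count n b m (Suc 0)"
  using lifts_tail_count[of n b d m "Suc 0"] by simp

lemma lifts_unique:
  assumes "lifts n b d" "lifts n b d'" "{r. 0 < d r} = {r. 0 < d' r}"
  shows "d = d'"
proof (rule tail_count_eq_imp_eq[of n])
  show "weak_composition n d" "weak_composition n d'" using assms by (auto simp: lifts_def)
  fix m t :: nat assume "1 \<le> m" "1 \<le> t"
  show "tail_count n d m t = tail_count n d' m t"
  proof (cases "m = 1")
    case True
    have "0 < d i \<longleftrightarrow> 0 < d' i" for i using assms(3) by auto
    then have "Suc 0 \<le> d i \<longleftrightarrow> Suc 0 \<le> d' i" for i by (simp add: Suc_le_eq)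
    then show ?thesis using True by (simp add: tail_count_def)
  next
    case False
    then obtain m' where "m = Suc m'" "1 \<le> m'" using \<open>1 \<le> m\<close> by (metis Suc_le_D One_nat_def not_less_eq_eq le_antisym)
    then show ?thesis
      using lifts_tail_count[OF assms(1)] lifts_tail_count[OF assms(2)] assms(3) \<open>1 \<le> t\<close>
      by (cases "t \<le> Suc n") auto
  qed
qed

lemma mem_initial_segment_iff_le_card:
  assumes "finite S" "\<And>m. m \<in> S \<Longrightarrow> 1 \<le> m" "\<And>m m'. m \<in> S \<Longrightarrow> 1 \<le> m' \<Longrightarrow> m' \<le> m \<Longrightarrow> m' \<in> S"
    and "1 \<le> m"
  shows "m \<in> S \<longleftrightarrow> m \<le> card S"
proof
  assume "m \<in> S"
  then have "{1..m} \<subseteq> S" using assms(3)[OF \<open>m \<in> S\<close>] by auto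
  then show "m \<le> card S" using card_mono[OF assms(1), of "{1..m}"] by simp
next
  assume m: "m \<le> card S"
  show "m \<in> S"
  proof (rule ccontr)
    assume "m \<notin> S"
    have "S \<subseteq> {1..<m}"
    proof
      fix x assume x: "x \<in> S"
      have "\<not> m \<le> x" using assms(3)[OF x assms(4)] \<open>m \<notin> S\<close> by blast
      then show "x \<in> {1..<m}" using assms(2)[OF x] by simp
    qed
    then have "card S \<le> m - 1" using card_mono[of "{1..<m}" S] by simp
    then show False using m assms(4) by simp
  qed
qed

text \<open>In terms of the excess \<open>e\<close> the recursion reads
  \<open>e' = max 0 (e + [m \<le> b t] - [t \<in> C])\<close>, monotone in \<open>e\<close> and
  antitone in \<open>m\<close>. This is what makes the columns of a lift nested.\<close>

lemma lift_excess_antimono: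
  assumes "m \<le> m'" "1 \<le> t" "t \<le> Suc n"
  shows "lift_count n b C m' t - tail_count n b m' t \<le> lift_count n b C m t - tail_count n b m t"
  using assms(2,3)
proof (induction t rule: nat_induct_at_least)
  case (Suc t)
  have "(of_bool (m' \<le> b t) :: int) \<le> of_bool (m \<le> b t)" using assms(1) by auto
  then show ?case using Suc
    by (cases "m \<le> b t"; cases "m' \<le> b t"; cases "t \<in> C")
      (simp_all add: lift_count_Suc tail_count_split[of t n b])
qed simp

text \<open>The hypothesis \<open>fin\<close> says that \<open>C\<close> has room for every column
  of \<open>b\<close>: nothing is left to match after row \<open>n\<close>.\<close>

lemma lift_exists:
  assumes wb: "weak_composition n b" and C: "C \<subseteq> {1..n}"
    and fin: "\<And>m. 1 \<le> m \<Longrightarrow> lift_count n b C m (Suc n) \<le> 0"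
  obtains d where "lifts n b d" "{r. 0 < d r} = C"
proof -
  \<comment> \<open>The displayed quantity is the lift count at \<open>r\<close> minus the count of
    \<open>b\<close> at \<open>Suc r\<close>; for \<open>r \<in> C\<close> its positivity means that
    column \<open>m\<close> uses row \<open>r\<close>. \<open>S r\<close> is an initial segment and
    so is recorded by its size; the extra 1 in \<open>d r\<close> stands for the first
    column.\<close>
  define S where "S r = {m. 1 \<le> m \<and> lift_count n b C m r - tail_count n b m r + of_bool (m \<le> b r) > 0}" for r
  define d where "d r = (if r \<in> C then Suc (card (S r)) else 0)" for r
  have [simp]: "lift_count n b C m (Suc n) = 0" if "1 \<le> m" for m
    using fin[OF that] lift_count_ge[of "Suc n" n b m C] by simp
  have supp: "{r. 0 < d r} = C" by (auto simp: d_def)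
  have bound: "m \<le> Max (b ` {1..n})" if "m \<in> S r" "r \<in> {1..n}" for m r
  proof (rule ccontr)
    assume "\<not> m \<le> Max (b ` {1..n})"
    then have big: "\<not> m \<le> b i" if "i \<in> {1..n}" for i using that by (auto simp: not_le)
    then have z: "tail_count n b m t = 0" if "1 \<le> t" for t
      using that by (simp add: tail_count_def)
    have "lift_count n b C m r \<le> 0"
      by (rule lift_count_least[where E = "\<lambda>_. 0"]) (use that z in auto)
    then show False using that z[of r] big[of r] by (auto simp: S_def)
  qed
  have S: "m \<in> S r \<longleftrightarrow> Suc m \<le> d r" if "r \<in> C" "1 \<le> m" for m r
  proof -
    have r: "r \<in> {1..n}" using that C by auto
    have fin: "finite (S r)"
      using bound r by (intro finite_subset[of "S r" "{..Max (b ` {1..n})}"]) auto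
    have ge: "1 \<le> m" if "m \<in> S r" for m using that by (simp add: S_def)
    have down: "m' \<in> S r" if "m \<in> S r" "1 \<le> m'" "m' \<le> m" for m m'
    proof -
      have "(of_bool (m \<le> b r) :: int) \<le> of_bool (m' \<le> b r)" using that by auto
      moreover have "lift_count n b C m r - tail_count n b m r \<le> lift_count n b C m' r - tail_count n b m' r"
        using lift_excess_antimono[OF that(3)] r by simp
      moreover have "0 < lift_count n b C m r - tail_count n b m r + of_bool (m \<le> b r)"
        using that(1) by (simp only: S_def mem_Collect_eq)
      ultimately have "0 < lift_count n b C m' r - tail_count n b m' r + of_bool (m' \<le> b r)"
        by linarith
      then show ?thesis using that(2) by (simp only: S_def mem_Collect_eq)
    qed
    have "m \<in> S r \<longleftrightarrow> m \<le> card (S r)"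
      by (rule mem_initial_segment_iff_le_card[OF fin ge down that(2)])
    then show ?thesis using that by (simp add: d_def)
  qed
  have wd: "weak_composition n d" using C by (auto simp: weak_composition_def d_def)
  have "tail_count n d (Suc m) t = lift_count n b C m t" if "1 \<le> m" "1 \<le> t" "t \<le> Suc n" for m t
    using that(3,2)
  proof (induction rule: inc_induct)
    case base
    then show ?case using that by simp
  next
    case (step t)
    have t: "t \<le> n" "1 \<le> t" using step by auto
    have q: "0 \<le> lift_count n b C m t - tail_count n b m t" using lift_count_ge[OF t(2)] by simp
    have "of_bool (Suc m \<le> d t) = lift_count n b C m t - lift_count n b C m (Suc t)"
    proof (cases "t \<in> C")
      case True
      have "Suc m \<le> d t \<longleftrightarrow> lift_count n b C m t - tail_count n b m t + of_bool (m \<le> b t) > 0"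
        using S[OF True that(1)] that(1) by (simp add: S_def)
      then show ?thesis using True q t
        by (cases "m \<le> b t") (auto simp: lift_count_Suc tail_count_split[of t n b])
    next
      case False
      then show ?thesis using q t
        by (cases "m \<le> b t") (auto simp: lift_count_Suc tail_count_split[of t n b] d_def)
    qed
    then show ?case using step t by (simp add: tail_count_split[of t n d])
  qed
  then have "lifts n b d" using wb wd supp by (simp add: lifts_def)
  then show ?thesis using supp that by blast
qed

lemma lifts_compositions:
  assumes "lifts n b d"
  shows "b \<in> compositions n w \<longleftrightarrow> d \<in> compositions n (Suc w)"
proof -
  have w: "weak_composition n b" "weak_composition n d" using assms by (auto simp: lifts_def)
  have "x \<in> compositions n w' \<longleftrightarrow> tail_count n x (Suc w') 1 = 0" if "weak_composition n x" for x w'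
  proof -
    have "x \<in> compositions n w' \<longleftrightarrow> \<not> (\<exists>i. Suc w' \<le> x i)"
      using that by (auto simp: compositions_def not_less_eq_eq)
    also have "\<dots> \<longleftrightarrow> \<not> 1 \<le> tail_count n x (Suc w') 1"
      by (subst le_bound_iff_tail_count[OF that]) auto
    also have "\<dots> \<longleftrightarrow> tail_count n x (Suc w') 1 = 0"
      using tail_count_nonneg[of n x "Suc w'" 1] by linarith
    finally show ?thesis .
  qed
  then show ?thesis using w lifts_total[OF assms, of "Suc w"] by simp
qed

section \<open>Tableaux with a given key and their Kohnert moves\<close>

definition cons_column :: "nat set \<Rightarrow> diagram \<Rightarrow> diagram" where
  "cons_column C T = {(c, r). c = 1 \<and> r \<in> C \<or> 1 < c \<and> (c - 1, r) \<in> T}"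

text \<open>The bound \<open>w\<close> on the number of columns makes the recursion structural.
  Empty columns on the right are allowed, so \<open>w\<close> may exceed the actual width.\<close>

primrec tableaux :: "nat \<Rightarrow> nat \<Rightarrow> (nat \<Rightarrow> nat) \<Rightarrow> diagram set" where
  "tableaux n 0 d = (if d = (\<lambda>_. 0) then {{}} else {})"
| "tableaux n (Suc w) d = {cons_column {r. 0 < d r} T | T b. lifts n b d \<and> T \<in> tableaux n w b}"

lemma tableaux_compositions: "T \<in> tableaux n w d \<Longrightarrow> d \<in> compositions n w"
proof (induction w arbitrary: T d)
  case 0
  then show ?case by (auto simp: compositions_def weak_composition_def split: if_splits)
next
  case (Suc w)
  then show ?case by (auto simp: lifts_compositions[symmetric])
qed

lemma tableaux_weak_composition: "T \<in> tableaux n w d \<Longrightarrow> weak_composition n d"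
  using tableaux_compositions by (auto simp: compositions_def)

lemma weak_composition_support: "weak_composition n d \<Longrightarrow> {r. 0 < d r} \<subseteq> {1..n}"
  unfolding weak_composition_def by fastforce

lemma tableaux_cells: "T \<in> tableaux n w d \<Longrightarrow> T \<subseteq> {1..w} \<times> {1..n}"
proof (induction w arbitrary: T d)
  case 0
  then show ?case by (auto split: if_splits)
next
  case (Suc w)
  then obtain b T1 where T1: "T = cons_column {r. 0 < d r} T1" "T1 \<in> tableaux n w b"
    by auto
  have "T1 \<subseteq> {1..w} \<times> {1..n}" using Suc.IH[OF T1(2)] .
  moreover have "{r. 0 < d r} \<subseteq> {1..n}"
    by (rule weak_composition_support[OF tableaux_weak_composition[OF Suc.prems]])
  ultimately show ?case unfolding T1(1) cons_column_def by fastforce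
qed

lemma tableaux_first_column: "T \<in> tableaux n w d \<Longrightarrow> (Suc 0, r) \<in> T \<longleftrightarrow> 0 < d r"
  by (cases w) (auto simp: cons_column_def split: if_splits)

lemma cons_column_inject:
  assumes "cons_column C T = cons_column C' T'" "T \<subseteq> {1..w} \<times> R" "T' \<subseteq> {1..w'} \<times> R'"
  shows "C = C'" "T = T'"
proof -
  have eq: "(c, r) \<in> cons_column C T \<longleftrightarrow> (c, r) \<in> cons_column C' T'" for c r using assms(1) by simp
  show "C = C'" using eq[of 1] by (auto simp: cons_column_def)
  have "(c, r) \<in> T \<longleftrightarrow> (c, r) \<in> T'" for c r
  proof (cases "1 \<le> c")
    case True
    then show ?thesis using eq[of "Suc c" r] by (auto simp: cons_column_def)
  next
    case False
    then show ?thesis using assms(2,3) by auto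
  qed
  then show "T = T'" by auto
qed

text \<open>The diagram determines its first column and the rest, the rest determines
  \<open>b\<close> by induction, and a lift of \<open>b\<close> with prescribed first column is
  unique.\<close>

lemma tableaux_key_unique: "T \<in> tableaux n w d \<Longrightarrow> T \<in> tableaux n w d' \<Longrightarrow> d = d'"
proof (induction w arbitrary: T d d')
  case 0
  then show ?case by (auto split: if_splits)
next
  case (Suc w)
  obtain b T1 where 1: "T = cons_column {r. 0 < d r} T1" "lifts n b d" "T1 \<in> tableaux n w b"
    using Suc.prems(1) by auto
  obtain b' T1' where 2: "T = cons_column {r. 0 < d' r} T1'" "lifts n b' d'" "T1' \<in> tableaux n w b'"
    using Suc.prems(2) by auto
  have "{r. 0 < d r} = {r. 0 < d' r}" "T1 = T1'"
    using cons_column_inject[of "{r. 0 < d r}" T1 "{r. 0 < d' r}" T1'] 1 2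
      tableaux_cells[OF 1(3)] tableaux_cells[OF 2(3)] by metis+
  then show ?case using lifts_unique 1 2 Suc.IH by metis
qed

lemma tail_count_pred: "1 \<le> m \<Longrightarrow> tail_count n (\<lambda>r. a r - 1) m t = tail_count n a (Suc m) t"
proof -
  assume "1 \<le> m"
  then have "m \<le> a r - 1 \<longleftrightarrow> Suc m \<le> a r" for r by auto
  then show ?thesis by (simp add: tail_count_def)
qed

text \<open>In a key diagram every cell is matched with its left neighbour in the same row, so the
  greedy count never exceeds that of \<open>b\<close>.\<close>

lemma lifts_pred:
  assumes "weak_composition n a"
  shows "lifts n (\<lambda>r. a r - 1) a"
proof -
  have "lift_count n (\<lambda>r. a r - 1) {r. 0 < a r} m t = tail_count n (\<lambda>r. a r - 1) m t"
    if "1 \<le> m" "1 \<le> t" "t \<le> Suc n" for m t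
    using that(2,3)
  proof (induction t rule: nat_induct_at_least)
    case (Suc t)
    then show ?case using that(1)
      by (auto simp: lift_count_Suc tail_count_split[of t n "\<lambda>r. a r - Suc 0"])
  qed simp
  then show ?thesis using assms tail_count_pred[of _ n a] by (auto simp: lifts_def weak_composition_def)
qed

lemma key_diagram_cons_column:
  assumes "weak_composition n a"
  shows "key_diagram n a = cons_column {r. 0 < a r} (key_diagram n (\<lambda>r. a r - 1))"
proof -
  have "r \<in> {1..n}" if "0 < a r" for r using assms that unfolding weak_composition_def by fastforce
  then show ?thesis by (auto simp: key_diagram_def cons_column_def)
qed

lemma key_diagram_in_tableaux: "a \<in> compositions n w \<Longrightarrow> key_diagram n a \<in> tableaux n w a"
proof (induction w arbitrary: a)
  case 0
  then have "a = (\<lambda>_. 0)" by (auto simp: compositions_def)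
  then show ?case by (auto simp: key_diagram_def)
next
  case (Suc w)
  have wc: "weak_composition n a" using Suc.prems by (simp add: compositions_def)
  show ?case
    using Suc.IH[of "\<lambda>r. a r - 1"] lifts_pred[OF wc] lifts_compositions[OF lifts_pred[OF wc], of w] Suc.prems
      key_diagram_cons_column[OF wc] by auto
qed

lemma lifts_bruhat_le_pred:
  assumes "lifts n b d"
  shows "bruhat_le n b (\<lambda>r. d r - 1)"
  using lifts_ge[OF assms] lifts_total[OF assms] assms tail_count_pred[of _ n d]
  by (simp add: bruhat_le_def lifts_def)

text \<open>A column put on the left does not change which cell is rightmost in a nonempty row, so
  the move survives, shifted by one column.\<close>

lemma kohnert_move_cons_column:
  assumes "kohnert_move T T'" "\<And>c r. (c, r) \<in> T \<Longrightarrow> 1 \<le> c"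
  shows "kohnert_move (cons_column C T) (cons_column C T')"
proof -
  obtain c r r' where m: "(c, r) \<in> T" "\<And>c'. (c', r) \<in> T \<Longrightarrow> c' \<le> c"
    "1 \<le> r'" "r' < r" "(c, r') \<notin> T" "\<And>s. r' < s \<Longrightarrow> s < r \<Longrightarrow> (c, s) \<in> T"
    "T' = insert (c, r') (T - {(c, r)})"
    using assms(1) unfolding kohnert_move_def by blast
  have c: "1 \<le> c" using assms(2) m(1) by blast
  show ?thesis
    unfolding kohnert_move_def
  proof (rule exI[of _ "Suc c"], rule exI[of _ r], rule exI[of _ r'], intro conjI allI impI)
    show "cons_column C T' = insert (Suc c, r') (cons_column C T - {(Suc c, r)})"
      using c unfolding m(7) cons_column_def by auto
    show "c' \<le> Suc c" if "(c', r) \<in> cons_column C T" for c'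
      using that m(2)[of "c' - 1"] c by (auto simp: cons_column_def)
  qed (use m c in \<open>auto simp: cons_column_def\<close>)
qed

lemma kohnert_moves_cons_column:
  assumes "kohnert_move\<^sup>*\<^sup>* T T'" "\<And>c r. (c, r) \<in> T \<Longrightarrow> 1 \<le> c"
  shows "kohnert_move\<^sup>*\<^sup>* (cons_column C T) (cons_column C T')"
proof -
  have "kohnert_move\<^sup>*\<^sup>* (cons_column C T) (cons_column C T') \<and> (\<forall>(c, r)\<in>T'. 1 \<le> c)"
    using assms(1)
  proof (induction rule: rtranclp_induct)
    case base
    then show ?case using assms(2) by auto
  next
    case (step T1 T2)
    then have "kohnert_move (cons_column C T1) (cons_column C T2)"
      by (intro kohnert_move_cons_column) auto
    moreover have "\<forall>(c, r)\<in>T2. 1 \<le> c" using step by (auto simp: kohnert_move_def)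
    ultimately show ?case using step by (auto intro: rtranclp.rtrancl_into_rtrancl)
  qed
  then show ?thesis by simp
qed

lemma KD_trans: "T \<in> KD n b \<Longrightarrow> key_diagram n b \<in> KD n a \<Longrightarrow> T \<in> KD n a"
  by (simp add: KD_def)

text \<open>By \<open>lifts_bruhat_le_pred\<close> the columns after the first have a key below
  \<open>d\<close> with its first column stripped, so they are reached by moves that leave the first
  column of the key diagram of \<open>d\<close> in place.\<close>

lemma tableaux_subset_KD: "T \<in> tableaux n w d \<Longrightarrow> T \<in> KD n d"
proof (induction w arbitrary: T d)
  case 0
  then have "T = key_diagram n d" by (auto simp: key_diagram_def split: if_splits)
  then show ?case by (simp add: KD_def)
next
  case (Suc w)
  obtain b T1 where T1: "T = cons_column {r. 0 < d r} T1" "lifts n b d" "T1 \<in> tableaux n w b"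
    using Suc.prems by auto
  have wd: "weak_composition n d" using T1(2) by (simp add: lifts_def)
  then have "weak_composition n (\<lambda>r. d r - 1)" by (simp add: weak_composition_def)
  then have "T1 \<in> KD n (\<lambda>r. d r - 1)"
    using Suc.IH[OF T1(3)] key_diagram_in_KD lifts_bruhat_le_pred[OF T1(2)] KD_trans by blast
  then have "kohnert_move\<^sup>*\<^sup>* (cons_column {r. 0 < d r} (key_diagram n (\<lambda>r. d r - 1))) T"
    unfolding KD_def T1(1) by (intro kohnert_moves_cons_column) (auto simp: key_diagram_def)
  then show ?case using key_diagram_cons_column[OF wd] by (simp add: KD_def)
qed

lemma tail_count_1_support: "tail_count n d (Suc 0) t = (\<Sum>i=t..n. of_bool (i \<in> {r. 0 < d r}))"
  by (simp add: tail_count_def Suc_le_eq)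

lemma sum_of_bool_move:
  fixes r r' n t :: nat
  assumes "r \<in> C" "r' \<notin> C" "r' < r" "r \<le> n"
  shows "(\<Sum>i=t..n. of_bool (i \<in> insert r' (C - {r})) :: int)
    = (\<Sum>i=t..n. of_bool (i \<in> C)) - of_bool (r' < t \<and> t \<le> r)"
proof -
  have delta: "(\<Sum>i=t..n. if i = s then 1 else (0 :: int)) = (if s \<in> {t..n} then 1 else 0)" for s
    by (rule sum.delta) simp
  have "(\<Sum>i=t..n. of_bool (i \<in> insert r' (C - {r})) :: int)
    = (\<Sum>i=t..n. of_bool (i \<in> C) + (if i = r' then 1 else 0) - (if i = r then 1 else 0))"
    by (rule sum.cong) (use assms in auto)
  also have "\<dots> = (\<Sum>i=t..n. of_bool (i \<in> C)) + (if r' \<in> {t..n} then 1 else 0) - (if r \<in> {t..n} then 1 else 0)"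
    by (simp only: sum_subtractf sum.distrib delta)
  finally show ?thesis using assms by auto
qed

text \<open>Reduces the comparison of two lifts to their supports and a bound on
  \<open>lift_count\<close>, the form that \<open>lift_count_least\<close> delivers.\<close>

lemma bruhat_le_liftI:
  assumes d': "lifts n b' d'" and d: "lifts n b d"
    and b: "\<And>m. 1 \<le> m \<Longrightarrow> tail_count n b' m 1 = tail_count n b m 1"
    and supp: "\<And>t. 1 \<le> t \<Longrightarrow> tail_count n d' 1 t \<le> tail_count n d 1 t"
      "tail_count n d' 1 1 = tail_count n d 1 1"
    and le: "\<And>m t. 1 \<le> m \<Longrightarrow> 1 \<le> t \<Longrightarrow> t \<le> Suc n \<Longrightarrow>
      lift_count n b' {r. 0 < d' r} m t \<le> tail_count n d (Suc m) t"
  shows "bruhat_le n d' d"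
  unfolding bruhat_le_def
proof (intro conjI allI impI)
  show "weak_composition n d'" using d' by (simp add: lifts_def)
  fix m :: nat assume m: "1 \<le> m"
  show "tail_count n d' m 1 = tail_count n d m 1"
    using m supp(2) lifts_total[OF d'] lifts_total[OF d] b
    by (cases m rule: nat.exhaust; cases "m = 1") auto
  fix t :: nat assume t: "1 \<le> t"
  show "tail_count n d' m t \<le> tail_count n d m t"
  proof (cases "m = 1 \<or> Suc n < t")
    case True
    then show ?thesis using supp(1) t by auto
  next
    case False
    then obtain m' where "m = Suc m'" "1 \<le> m'" using m by (cases m) auto
    then show ?thesis using le[of m' t] lifts_tail_count[OF d', of m' t] t False by simp
  qed
qed

text \<open>If the moved cell is in the first column, \<open>C\<close> changes and \<open>b\<close>
  stays; otherwise \<open>b\<close> goes down by induction and \<open>C\<close> stays. In both cases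
  the counts of \<open>d\<close>, lowered where necessary, form an admissible sequence for
  \<open>lift_count_least\<close>.\<close>

lemma tableaux_kohnert_move:
  "T \<in> tableaux n w d \<Longrightarrow> kohnert_move T T' \<Longrightarrow> \<exists>d'. bruhat_le n d' d \<and> T' \<in> tableaux n w d'"
proof (induction w arbitrary: T T' d)
  case 0
  then show ?case by (auto simp: kohnert_move_def split: if_splits)
next
  case (Suc w)
  obtain b T1 where T1: "T = cons_column {r. 0 < d r} T1" "lifts n b d" "T1 \<in> tableaux n w b"
    using Suc.prems by auto
  define C where "C = {r. 0 < d r}"
  have wc: "weak_composition n b" "weak_composition n d" using T1(2) by (auto simp: lifts_def)
  have Cn: "C \<subseteq> {1..n}" unfolding C_def by (rule weak_composition_support[OF wc(2)])
  obtain c r r' where m: "(c, r) \<in> T" "\<And>c'. (c', r) \<in> T \<Longrightarrow> c' \<le> c"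
    "1 \<le> r'" "r' < r" "(c, r') \<notin> T" "\<And>s. r' < s \<Longrightarrow> s < r \<Longrightarrow> (c, s) \<in> T"
    "T' = insert (c, r') (T - {(c, r)})"
    using Suc.prems(2) unfolding kohnert_move_def by blast
  have TC: "T = cons_column C T1" using T1(1) by (simp add: C_def)
  have T1c: "1 \<le> c'" if "(c', s) \<in> T1" for c' s using tableaux_cells[OF T1(3)] that by auto
  show ?case
  proof (cases "c = 1")
    case True
    define C' where "C' = insert r' (C - {r})"
    have rC: "r \<in> C" "r' \<notin> C" "\<And>s. r' < s \<Longrightarrow> s < r \<Longrightarrow> s \<in> C"
      using m(1,5,6) True by (auto simp: TC cons_column_def)
    have rn: "r \<le> n" "1 \<le> r" using rC(1) Cn by auto
    have T': "T' = cons_column C' T1"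
      using True unfolding m(7) TC cons_column_def C'_def by auto
    \<comment> \<open>The moved cell is rightmost in row \<open>r\<close>, so that row misses the
      first column of \<open>T1\<close>, and this column is the support of \<open>b\<close>.\<close>
    have "(Suc 0, r) \<notin> T1" using m(2)[of 2] True by (auto simp: TC cons_column_def)
    then have br: "b r = 0" using tableaux_first_column[OF T1(3)] by auto
    text \<open>The column move decreases the tail counts of \<open>C\<close> by one on \<open>r' < t \<le> r\<close>; there the
      excess of \<open>d\<close> over \<open>b\<close> can absorb it, as \<open>b\<close> vanishes at \<open>r\<close>.\<close>
    define E where "E m t = (if r' < t \<and> t \<le> r then max (tail_count n b m t) (tail_count n d (Suc m) t - 1)
      else tail_count n d (Suc m) t)" for m t
    have step: "tail_count n d (Suc m) t - of_bool (t \<in> C) \<le> tail_count n d (Suc m) (Suc t)"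
      if "1 \<le> t" "t \<le> n" for m t
      using that by (auto simp: tail_count_split[of t n d] C_def)
    have bound: "lift_count n b C' m t \<le> E m t" if "1 \<le> m" "1 \<le> t" "t \<le> Suc n" for m t
      using that(2,3)
    proof (rule lift_count_least)
      fix t :: nat assume t: "1 \<le> t"
      show "tail_count n b m t \<le> E m t"
        using lifts_ge[OF T1(2) that(1) t] by (auto simp: E_def)
      assume "t \<le> n"
      have b: "tail_count n b m t - 1 \<le> tail_count n b m (Suc t)"
        using \<open>t \<le> n\<close> by (simp add: tail_count_split[of t])
      consider "t < r'" | "t = r'" | "r' < t" "t < r" | "t = r" | "r < t" by linarith
      then show "E m t - of_bool (t \<in> C') \<le> E m (Suc t)"
      proof cases
        case 1
        then show ?thesis using step[OF t \<open>t \<le> n\<close>, of m] m(4) by (auto simp: E_def C'_def)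
      next
        case 2
        then show ?thesis using step[OF t \<open>t \<le> n\<close>, of m] m(4) rC by (auto simp: E_def C'_def)
      next
        case 3
        then show ?thesis using step[OF t \<open>t \<le> n\<close>, of m] rC b by (auto simp: E_def C'_def)
      next
        case 4
        \<comment> \<open>Row \<open>r\<close> has left the column, so \<open>E\<close> may not
          descend there; since \<open>b\<close> has no part in row \<open>r\<close>, its count at
          \<open>r\<close> is already bounded by that of \<open>d\<close> at
          \<open>Suc r\<close>.\<close>
        have "tail_count n b m r = tail_count n b m (Suc r)"
          using br rn that(1) by (simp add: tail_count_split[of r])
        then show ?thesis using 4 step[OF t \<open>t \<le> n\<close>, of m] rC m(4) lifts_ge[OF T1(2) that(1), of "Suc r"]
          by (auto simp: E_def C'_def)
      next
        case 5
        then show ?thesis using step[OF t \<open>t \<le> n\<close>, of m] m(4) by (auto simp: E_def C'_def)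
      qed
    qed
    have E_le: "E m t \<le> tail_count n d (Suc m) t" if "1 \<le> m" "1 \<le> t" for m t
      using lifts_ge[OF T1(2) that] by (auto simp: E_def)
    have "C' \<subseteq> {1..n}" using Cn m(3,4) rn by (auto simp: C'_def)
    moreover have "lift_count n b C' m (Suc n) \<le> 0" if "1 \<le> m" for m
      using bound[OF that, of "Suc n"] E_le[OF that, of "Suc n"] by simp
    ultimately obtain d' where d': "lifts n b d'" "{r. 0 < d' r} = C'"
      using lift_exists[OF wc(1)] by metis
    have one: "tail_count n d' 1 t = tail_count n d 1 t - of_bool (r' < t \<and> t \<le> r)" for t
      using sum_of_bool_move[OF rC(1,2) m(4) rn(1), of t] d'(2)
      by (simp add: tail_count_1_support C'_def) (simp add: C_def)
    have "bruhat_le n d' d"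
    proof (rule bruhat_le_liftI[OF d'(1) T1(2)])
      show "tail_count n d' 1 1 = tail_count n d 1 1" using one[of 1] m(3) by simp
      show "tail_count n d' 1 t \<le> tail_count n d 1 t" for t using one[of t] by simp
      show "lift_count n b {r. 0 < d' r} m t \<le> tail_count n d (Suc m) t"
        if "1 \<le> m" "1 \<le> t" "t \<le> Suc n" for m t
        using bound[OF that] E_le[of m t] that d'(2) by simp
    qed simp
    moreover have "T' \<in> tableaux n (Suc w) d'" using T' d' T1(3) by auto
    ultimately show ?thesis by blast
  next
    case False
    have c: "1 < c" using m(1) False by (auto simp: TC cons_column_def)
    define T1' where "T1' = insert (c - 1, r') (T1 - {(c - 1, r)})"
    have "kohnert_move T1 T1'"
      unfolding kohnert_move_def
    proof (rule exI[of _ "c - 1"], rule exI[of _ r], rule exI[of _ r'], intro conjI allI impI)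
      show "(c - 1, r) \<in> T1" "(c - 1, r') \<notin> T1" using m(1,5) c by (auto simp: TC cons_column_def)
      show "c' \<le> c - 1" if "(c', r) \<in> T1" for c'
        using m(2)[of "Suc c'"] T1c[OF that] that by (simp add: TC cons_column_def)
      show "(c - 1, s) \<in> T1" if "r' < s \<and> s < r" for s
        using m(6)[of s] that c by (simp add: TC cons_column_def)
    qed (use m T1'_def in auto)
    then obtain b' where b': "bruhat_le n b' b" "T1' \<in> tableaux n w b'"
      using Suc.IH[OF T1(3)] by blast
    have T': "T' = cons_column C T1'"
      using c unfolding m(7) TC cons_column_def T1'_def by auto
    have bound: "lift_count n b' C m t \<le> tail_count n d (Suc m) t" if "1 \<le> m" "1 \<le> t" "t \<le> Suc n" for m t
      using that(2,3)
    proof (rule lift_count_least)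
      fix t :: nat assume t: "1 \<le> t"
      show "tail_count n b' m t \<le> tail_count n d (Suc m) t"
        using bruhat_le_tail_count[OF b'(1) t, of m] lifts_ge[OF T1(2) that(1) t] by simp
      assume "t \<le> n"
      then show "tail_count n d (Suc m) t - of_bool (t \<in> C) \<le> tail_count n d (Suc m) (Suc t)"
        by (auto simp: tail_count_split[of t n d] C_def)
    qed
    have "lift_count n b' C m (Suc n) \<le> 0" if "1 \<le> m" for m
      using bound[OF that, of "Suc n"] by simp
    then obtain d' where d': "lifts n b' d'" "{r. 0 < d' r} = C"
      using lift_exists[of n b' C] Cn b'(1) unfolding bruhat_le_def by metis
    have one: "tail_count n d' 1 t = tail_count n d 1 t" for t
      using d'(2) by (simp add: tail_count_1_support) (simp add: C_def)
    have "bruhat_le n d' d"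
    proof (rule bruhat_le_liftI[OF d'(1) T1(2)])
      show "tail_count n b' m 1 = tail_count n b m 1" for m using bruhat_le_total[OF b'(1)] by simp
    qed (use one bound d'(2) in auto)
    moreover have "T' \<in> tableaux n (Suc w) d'" using T' d' b'(2) by auto
    ultimately show ?thesis by blast
  qed
qed

theorem KD_eq_Union_tableaux:
  assumes "a \<in> compositions n w"
  shows "KD n a = (\<Union>d\<in>{d. bruhat_le n d a}. tableaux n w d)"
proof
  have wc: "weak_composition n a" using assms by (simp add: compositions_def)
  show "(\<Union>d\<in>{d. bruhat_le n d a}. tableaux n w d) \<subseteq> KD n a"
    using tableaux_subset_KD key_diagram_in_KD[OF wc] KD_trans by fast
  have "\<exists>d. bruhat_le n d a \<and> T \<in> tableaux n w d" if "kohnert_move\<^sup>*\<^sup>* (key_diagram n a) T" for T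
    using that
  proof (induction rule: rtranclp_induct)
    case base
    then show ?case using key_diagram_in_tableaux[OF assms] bruhat_le_refl[OF wc] by blast
  next
    case (step T T')
    then show ?case using tableaux_kohnert_move bruhat_le_trans by metis
  qed
  then show "KD n a \<subseteq> (\<Union>d\<in>{d. bruhat_le n d a}. tableaux n w d)" by (auto simp: KD_def)
qed

section \<open>Atoms and Demazure operators\<close>

definition atom :: "nat \<Rightarrow> nat \<Rightarrow> (nat \<Rightarrow> nat) \<Rightarrow> mpoly" where
  "atom n w d = (\<Sum>T\<in>tableaux n w d. \<Prod>i=1..n. xvar i ^ wt T i)"

lemma finite_tableaux: "finite (tableaux n w d)"
proof (rule finite_subset)
  show "tableaux n w d \<subseteq> Pow ({1..w} \<times> {1..n})" using tableaux_cells by blast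
qed simp

lemma finite_bruhat_le: "a \<in> compositions n w \<Longrightarrow> finite {d. bruhat_le n d a}"
  by (rule finite_subset[OF _ finite_compositions[of n w]]) (auto intro: bruhat_le_compositions)

lemma sum_Union_tableaux:
  "finite B \<Longrightarrow> (\<Sum>T\<in>(\<Union>b\<in>B. tableaux n w b). f T) = (\<Sum>b\<in>B. \<Sum>T\<in>tableaux n w b. f T)"
proof (rule sum.UNION_disjoint)
  show "\<forall>i\<in>B. \<forall>j\<in>B. i \<noteq> j \<longrightarrow> tableaux n w i \<inter> tableaux n w j = {}"
    using tableaux_key_unique[of _ n w] by (simp add: disjoint_iff) blast
qed (auto simp: finite_tableaux)

lemma key_poly_eq_sum_atoms:
  assumes "a \<in> compositions n w"
  shows "key_poly n a = (\<Sum>d | bruhat_le n d a. atom n w d)"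
  unfolding key_poly_def atom_def KD_eq_Union_tableaux[OF assms]
  by (rule sum_Union_tableaux[OF finite_bruhat_le[OF assms]])

lemma wt_cons_column:
  assumes "T \<subseteq> {1..w} \<times> R"
  shows "wt (cons_column C T) i = of_bool (i \<in> C) + wt T i"
proof -
  have fin: "finite {c. (c, i) \<in> T}"
    by (rule finite_subset[of _ "{1..w}"]) (use assms in auto)
  have "{c. (c, i) \<in> cons_column C T} = (if i \<in> C then {1} else {}) \<union> Suc ` {c. (c, i) \<in> T}"
  proof (intro set_eqI)
    fix c
    have "c - 1 = 0 \<Longrightarrow> (c - 1, i) \<notin> T" using assms by force
    then show "c \<in> {c. (c, i) \<in> cons_column C T} \<longleftrightarrow>
      c \<in> (if i \<in> C then {1} else {}) \<union> Suc ` {c. (c, i) \<in> T}"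
      using assms by (cases c) (auto simp: cons_column_def)
  qed
  moreover have "(if i \<in> C then {1} else {}) \<inter> Suc ` {c. (c, i) \<in> T} = {}"
    using assms by (auto split: if_splits)
  ultimately have "wt (cons_column C T) i = card (if i \<in> C then {1::nat} else {}) + card (Suc ` {c. (c, i) \<in> T})"
    unfolding wt_def using fin by (simp add: card_Un_disjoint)
  then show ?thesis by (simp add: wt_def card_image)
qed

lemma atom_Suc:
  "atom n (Suc w) d = (\<Prod>r | 0 < d r. xvar r) * (\<Sum>b | b \<in> compositions n w \<and> lifts n b d. atom n w b)"
proof (cases "weak_composition n d")
  case False
  then have "tableaux n (Suc w) d = {}" "{b. b \<in> compositions n w \<and> lifts n b d} = {}"
    by (auto simp: lifts_def)
  then show ?thesis unfolding atom_def by (simp only: sum.empty mult_zero_right)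
next
  case True
  define C where "C = {r. 0 < d r}"
  have C: "C \<subseteq> {1..n}" unfolding C_def by (rule weak_composition_support[OF True])
  define B where "B = {b. b \<in> compositions n w \<and> lifts n b d}"
  define mon where "mon T = (\<Prod>i=1..n. xvar i ^ wt T i)" for T
  have B: "finite B" unfolding B_def by (rule finite_subset[OF _ finite_compositions[of n w]]) auto
  have tab: "tableaux n (Suc w) d = cons_column C ` (\<Union>b\<in>B. tableaux n w b)"
    by (auto simp: B_def C_def lifts_compositions dest: tableaux_compositions)
  have cells: "T \<subseteq> {1..w} \<times> {1..n}" if "T \<in> (\<Union>b\<in>B. tableaux n w b)" for T
    using that tableaux_cells by blast
  have inj: "inj_on (cons_column C) (\<Union>b\<in>B. tableaux n w b)"
    by (rule inj_onI) (metis cells cons_column_inject(2))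
  have "mon (cons_column C T) = (\<Prod>r\<in>C. xvar r) * mon T" if "T \<in> (\<Union>b\<in>B. tableaux n w b)" for T
  proof -
    have "mon (cons_column C T) = (\<Prod>i=1..n. xvar i ^ of_bool (i \<in> C)) * mon T"
      unfolding mon_def using wt_cons_column[OF cells[OF that]] by (simp add: power_add prod.distrib)
    also have "(\<Prod>i=1..n. xvar i ^ of_bool (i \<in> C)) = (\<Prod>i=1..n. if i \<in> C then xvar i else 1)"
      by (rule prod.cong) auto
    also have "\<dots> = (\<Prod>r\<in>C. xvar r)"
      using C by (simp add: prod.inter_restrict[symmetric] Int_absorb1)
    finally show ?thesis .
  qed
  then have "atom n (Suc w) d = (\<Sum>T\<in>(\<Union>b\<in>B. tableaux n w b). (\<Prod>r\<in>C. xvar r) * mon T)"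
    unfolding atom_def tab mon_def[symmetric] by (subst sum.reindex[OF inj]) simp
  also have "\<dots> = (\<Prod>r\<in>C. xvar r) * (\<Sum>T\<in>(\<Union>b\<in>B. tableaux n w b). mon T)"
    by (simp add: sum_distrib_left)
  also have "(\<Sum>T\<in>(\<Union>b\<in>B. tableaux n w b). mon T) = (\<Sum>b\<in>B. atom n w b)"
    unfolding atom_def mon_def by (rule sum_Union_tableaux[OF B])
  finally show ?thesis by (simp add: B_def C_def)
qed

section \<open>The lifting relation seen from two adjacent rows\<close>

definition lift_step :: "nat \<Rightarrow> (nat \<Rightarrow> nat) \<Rightarrow> (nat \<Rightarrow> nat) \<Rightarrow> nat \<Rightarrow> nat \<Rightarrow> bool" where
  "lift_step n b d m t \<longleftrightarrow> tail_count n d (Suc m) (Suc t)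
     = max (tail_count n b m (Suc t)) (tail_count n d (Suc m) t - of_bool (0 < d t))"

lemma tail_count_eq_lift_count_iff:
  assumes "1 \<le> u"
  shows "(\<forall>t\<in>{1..u}. tail_count n d (Suc m) t = lift_count n b {r. 0 < d r} m t) \<longleftrightarrow>
    tail_count n d (Suc m) 1 = tail_count n b m 1 \<and> (\<forall>t\<in>{1..<u}. lift_step n b d m t)"
  using assms
proof (induction u rule: nat_induct_at_least)
  case base
  then show ?case by simp
next
  case (Suc u)
  let ?P = "\<lambda>t. tail_count n d (Suc m) t = lift_count n b {r. 0 < d r} m t"
  have sets: "{1..Suc u} = insert (Suc u) {1..u}" "{1..<Suc u} = insert u {1..<u}" using Suc.hyps by auto
  have "?P (Suc u) \<longleftrightarrow> lift_step n b d m u" if "?P u"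
    using that Suc.hyps by (simp add: lift_step_def lift_count_Suc)
  moreover have "\<forall>t\<in>{1..u}. ?P t \<Longrightarrow> ?P u" using Suc.hyps by simp
  ultimately show ?case unfolding sets ball_simps using Suc.IH by blast
qed

text \<open>The recursion unwound into one local condition per row. An exchange of rows
  \<open>i\<close> and \<open>i + 1\<close> affects only the conditions at \<open>t = i\<close> and
  \<open>t = Suc i\<close>.\<close>

lemma lifts_iff_steps:
  "lifts n b d \<longleftrightarrow> weak_composition n b \<and> weak_composition n d \<and>
    (\<forall>m\<ge>1. tail_count n d (Suc m) 1 = tail_count n b m 1 \<and> (\<forall>t\<in>{1..n}. lift_step n b d m t))"
proof -
  have n: "1 \<le> Suc n" by simp
  show ?thesis
    unfolding lifts_def tail_count_eq_lift_count_iff[OF n] atLeastLessThanSuc_atLeastAtMost by (rule refl)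
qed

text \<open>The part of \<open>lifts\<close> that is not affected by exchanging the entries in rows \<open>i\<close> and \<open>i + 1\<close>.\<close>

definition lifts_except :: "nat \<Rightarrow> nat \<Rightarrow> (nat \<Rightarrow> nat) \<Rightarrow> (nat \<Rightarrow> nat) \<Rightarrow> bool" where
  "lifts_except n i b d \<longleftrightarrow> weak_composition n b \<and> weak_composition n d \<and>
    (\<forall>m\<ge>1. tail_count n d (Suc m) 1 = tail_count n b m 1 \<and>
      (\<forall>t\<in>{1..n} - {i, Suc i}. lift_step n b d m t))"

text \<open>For a lift, this is the number of cells of column \<open>m\<close> of \<open>b\<close>
  in rows below \<open>i\<close> that still wait for a partner in the first column.\<close>

definition excess :: "nat \<Rightarrow> nat \<Rightarrow> (nat \<Rightarrow> nat) \<Rightarrow> (nat \<Rightarrow> nat) \<Rightarrow> nat \<Rightarrow> int" where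
  "excess n i b d m = tail_count n d (Suc m) i - tail_count n b m i"

lemma lifts_except_swap:
  assumes "1 \<le> i" "i < n"
  shows "lifts_except n i (swap_adj i b) d \<longleftrightarrow> lifts_except n i b d"
    "lifts_except n i b (swap_adj i d) \<longleftrightarrow> lifts_except n i b d"
    "excess n i (swap_adj i b) d m = excess n i b d m"
    "excess n i b (swap_adj i d) m = excess n i b d m"
proof -
  have wc: "weak_composition n (swap_adj i x) \<longleftrightarrow> weak_composition n x" for x
    by (rule weak_composition_swap_adj_iff[OF assms])
  have eq: "tail_count n (swap_adj i x) m t = tail_count n x m t" if "t \<noteq> Suc i" for x m t
    using tail_count_swap_adj[OF assms(2) that] .
  have d: "swap_adj i x t = x t" if "t \<noteq> i" "t \<noteq> Suc i" for x t using that by (simp add: swap_parts_apply)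
  show "lifts_except n i (swap_adj i b) d \<longleftrightarrow> lifts_except n i b d"
    "lifts_except n i b (swap_adj i d) \<longleftrightarrow> lifts_except n i b d"
    unfolding lifts_except_def lift_step_def wc using assms by (simp_all add: eq d)
  show "excess n i (swap_adj i b) d m = excess n i b d m"
    "excess n i b (swap_adj i d) m = excess n i b d m"
    by (simp_all add: excess_def eq)
qed

text \<open>The steps at \<open>t < i\<close> are among those retained by
  \<open>lifts_except\<close>, so they already identify the counts of \<open>d\<close> at row
  \<open>i\<close> with \<open>lift_count\<close>.\<close>

lemma lifts_except_excess:
  assumes "lifts_except n i b d" "1 \<le> i" "i < n" "1 \<le> m"
  shows "0 \<le> excess n i b d m" "m \<le> m' \<Longrightarrow> excess n i b d m' \<le> excess n i b d m"
proof -
  have eq: "tail_count n d (Suc m) i = lift_count n b {r. 0 < d r} m i" if "1 \<le> m" for m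
    using tail_count_eq_lift_count_iff[of i n d m b] assms that by (auto simp: lifts_except_def)
  show "0 \<le> excess n i b d m"
    using eq[OF assms(4)] lift_count_ge[OF assms(2), of n b m] by (simp add: excess_def)
  show "excess n i b d m' \<le> excess n i b d m" if "m \<le> m'"
    using eq[OF assms(4)] eq[of m'] lift_excess_antimono[OF that, of i n b "{r. 0 < d r}"] assms that
    by (simp add: excess_def)
qed

text \<open>The matching at rows \<open>i\<close> and \<open>i + 1\<close> when both belong to the
  first column: \<open>p\<close> cells wait, \<open>A\<close> and \<open>B\<close> tell whether
  \<open>b\<close> adds one in each row, \<open>X\<close> and \<open>Y\<close> whether the rows are
  used. The second row sees what the first has left.\<close>

definition lift_rule :: "int \<Rightarrow> bool \<Rightarrow> bool \<Rightarrow> bool \<Rightarrow> bool \<Rightarrow> bool" where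
  "lift_rule p A B X Y \<longleftrightarrow> (X \<longleftrightarrow> 0 < p + of_bool A) \<and> (Y \<longleftrightarrow> 0 < p + of_bool A - of_bool X + of_bool B)"

text \<open>Here \<open>q\<close> is the excess after both rows, and \<open>g\<close>,
  \<open>h\<close> tell whether they lie in the first column. The maxima translate into the rule
  that a row is used exactly when it is available and something waits.\<close>

lemma lift_steps_arith:
  fixes p q :: int
  assumes "p = q + of_bool X + of_bool Y - of_bool A - of_bool B" "0 \<le> p" "X \<Longrightarrow> g" "Y \<Longrightarrow> h"
  shows "(q + of_bool Y = max (of_bool B) (q + of_bool X + of_bool Y - of_bool g) \<and>
      q = max 0 (q + of_bool Y - of_bool h)) \<longleftrightarrow>
    (X \<longleftrightarrow> g \<and> 0 < p + of_bool A) \<and> (Y \<longleftrightarrow> h \<and> 0 < p + of_bool A - of_bool X + of_bool B)"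
  using assms by (cases X; cases Y; cases A; cases B; cases g; cases h) (auto simp: max_def)

lemma lifts_iff_except:
  assumes i: "1 \<le> i" "i < n"
  shows "lifts n b d \<longleftrightarrow> lifts_except n i b d \<and> (\<forall>m\<ge>1.
    (Suc m \<le> d i \<longleftrightarrow> 0 < d i \<and> 0 < excess n i b d m + of_bool (m \<le> b i)) \<and>
    (Suc m \<le> d (Suc i) \<longleftrightarrow> 0 < d (Suc i) \<and>
      0 < excess n i b d m + of_bool (m \<le> b i) - of_bool (Suc m \<le> d i) + of_bool (m \<le> b (Suc i))))"
proof -
  have "lift_step n b d m i \<and> lift_step n b d m (Suc i) \<longleftrightarrow>
    (Suc m \<le> d i \<longleftrightarrow> 0 < d i \<and> 0 < excess n i b d m + of_bool (m \<le> b i)) \<and>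
    (Suc m \<le> d (Suc i) \<longleftrightarrow> 0 < d (Suc i) \<and>
      0 < excess n i b d m + of_bool (m \<le> b i) - of_bool (Suc m \<le> d i) + of_bool (m \<le> b (Suc i)))"
    if ex: "lifts_except n i b d" and m: "1 \<le> m" for m
  proof -
    define q where "q = tail_count n d (Suc m) (Suc (Suc i)) - tail_count n b m (Suc (Suc i))"
    define p where "p = excess n i b d m"
    have pq: "p = q + of_bool (Suc m \<le> d i) + of_bool (Suc m \<le> d (Suc i)) - of_bool (m \<le> b i) - of_bool (m \<le> b (Suc i))"
      using i by (simp add: p_def excess_def q_def tail_count_split[of i] tail_count_split[of "Suc i"])
    have p0: "0 \<le> p" unfolding p_def by (rule lifts_except_excess(1)[OF ex i m])
    have shift: "u + x = max (v + y) (w + x) \<longleftrightarrow> u + (x - y) = max v (w + (x - y))" for u v w x y :: int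
      by (auto simp: max_def)
    have 1: "lift_step n b d m i \<longleftrightarrow> q + of_bool (Suc m \<le> d (Suc i))
        = max (of_bool (m \<le> b (Suc i))) (q + of_bool (Suc m \<le> d i) + of_bool (Suc m \<le> d (Suc i)) - of_bool (0 < d i))"
      using i shift[of "of_bool (Suc m \<le> d (Suc i))" "tail_count n d (Suc m) (Suc (Suc i))"
          "of_bool (m \<le> b (Suc i))" "tail_count n b m (Suc (Suc i))"
          "of_bool (Suc m \<le> d i) + of_bool (Suc m \<le> d (Suc i)) - of_bool (0 < d i)"]
      by (simp add: lift_step_def q_def tail_count_split[of i] tail_count_split[of "Suc i"] algebra_simps
          del: of_bool_eq_1_iff)
    have 2: "lift_step n b d m (Suc i) \<longleftrightarrow> q = max 0 (q + of_bool (Suc m \<le> d (Suc i)) - of_bool (0 < d (Suc i)))"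
      using i shift[of 0 "tail_count n d (Suc m) (Suc (Suc i))" 0 "tail_count n b m (Suc (Suc i))"
          "of_bool (Suc m \<le> d (Suc i)) - of_bool (0 < d (Suc i))"]
      by (simp add: lift_step_def q_def tail_count_split[of "Suc i"] algebra_simps)
    show ?thesis unfolding 1 2 p_def[symmetric]
      by (rule lift_steps_arith[OF pq p0]) auto
  qed
  moreover have "lifts n b d \<longleftrightarrow> lifts_except n i b d \<and> (\<forall>m\<ge>1. lift_step n b d m i \<and> lift_step n b d m (Suc i))"
  proof -
    have "{1..n} = insert i (insert (Suc i) ({1..n} - {i, Suc i}))" using i by auto
    then have "(\<forall>t\<in>{1..n}. Q t) \<longleftrightarrow> Q i \<and> Q (Suc i) \<and> (\<forall>t\<in>{1..n} - {i, Suc i}. Q t)" for Q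
      by (metis (no_types, lifting) insert_iff)
    then show ?thesis unfolding lifts_iff_steps lifts_except_def by blast
  qed
  ultimately show ?thesis by blast
qed

lemma lifts_iff_rule:
  assumes "1 \<le> i" "i < n" "0 < d i" "0 < d (Suc i)"
  shows "lifts n b d \<longleftrightarrow> lifts_except n i b d \<and>
    (\<forall>m\<ge>1. lift_rule (excess n i b d m) (m \<le> b i) (m \<le> b (Suc i)) (m < d i) (m < d (Suc i)))"
  using assms by (simp add: lifts_iff_except lift_rule_def Suc_le_eq)

text \<open>With neither row in the first column nothing is matched there, so both local steps hold
  automatically, and \<open>lifts_except\<close> is blind to the exchange.\<close>

lemma lift_fiber_zero_zero:
  assumes "1 \<le> i" "i < n" "d i = 0" "d (Suc i) = 0"
  shows "lifts n (sort_adj i b) d \<longleftrightarrow> lifts n b d"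
  using assms by (auto simp: lifts_iff_except lifts_except_swap sort_adj_def)

text \<open>After sorting \<open>b\<close>, the larger part sits in row \<open>i\<close>, the only
  available row, so it is used when something waits or either part reaches \<open>m\<close>. For the
  exchanged \<open>d\<close> the available row comes second and sees both parts of
  \<open>b\<close>.\<close>

lemma lift_fiber_pos_zero:
  assumes i: "1 \<le> i" "i < n" and d: "0 < d i" "d (Suc i) = 0"
  shows "lifts n (sort_adj i b) d \<longleftrightarrow> lifts n b (swap_adj i d)"
proof -
  have "(m < d i \<longleftrightarrow> 0 < excess n i b d m + of_bool (m \<le> sort_adj i b i)) \<longleftrightarrow>
    (m < d i \<longleftrightarrow> 0 < excess n i b d m + of_bool (m \<le> b i) + of_bool (m \<le> b (Suc i)))"
    if "lifts_except n i b d" "1 \<le> m" for m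
    using lifts_except_excess(1)[OF that(1) i that(2)] by (auto simp: sort_adj_def swap_parts_apply)
  moreover have "lifts n (sort_adj i b) d \<longleftrightarrow> lifts_except n i b d \<and>
    (\<forall>m\<ge>1. m < d i \<longleftrightarrow> 0 < excess n i b d m + of_bool (m \<le> sort_adj i b i))"
    using i d by (auto simp: lifts_iff_except lifts_except_swap sort_adj_def Suc_le_eq)
  moreover have "lifts n b (swap_adj i d) \<longleftrightarrow> lifts_except n i b d \<and>
    (\<forall>m\<ge>1. m < d i \<longleftrightarrow> 0 < excess n i b d m + of_bool (m \<le> b i) + of_bool (m \<le> b (Suc i)))"
    using i d by (simp add: lifts_iff_except lifts_except_swap swap_parts_apply Suc_le_eq)
  ultimately show ?thesis by blast
qed

text \<open>For unsorted \<open>b\<close>, exchanging its parts matters only at thresholds between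
  them. If cells wait at all of these, \<open>b\<close> lifts to \<open>d\<close> as well; if
  nothing waits at one of them, nothing waits at any larger threshold, and the two rows of the lift
  are exchanged.\<close>

lemma lift_fiber_pos_pos:
  assumes i: "1 \<le> i" "i < n" and d: "d (Suc i) \<le> d i" "0 < d (Suc i)"
  shows "lifts n (sort_adj i b) d \<longleftrightarrow> lifts n b d \<or> lifts n b (swap_adj i d)"
proof -
  define p where "p = excess n i b d"
  let ?R = "\<lambda>b d. \<forall>m\<ge>1. lift_rule (p m) (m \<le> b i) (m \<le> b (Suc i)) (m < d i) (m < d (Suc i))"
  let ?sb = "swap_adj i b" and ?sd = "swap_adj i d"
  have s: "?sb i = b (Suc i)" "?sb (Suc i) = b i" "?sd i = d (Suc i)" "?sd (Suc i) = d i"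
    by (auto simp: swap_parts_apply)
  have pos: "0 < d i" using d by simp
  have eqs: "lifts n b d \<longleftrightarrow> lifts_except n i b d \<and> ?R b d"
    "lifts n ?sb d \<longleftrightarrow> lifts_except n i b d \<and> ?R ?sb d"
    "lifts n b ?sd \<longleftrightarrow> lifts_except n i b d \<and> ?R b ?sd"
    using i d pos by (simp_all add: lifts_iff_rule p_def lifts_except_swap s)
  show ?thesis
  proof (cases "lifts_except n i b d")
    case False
    then show ?thesis using eqs by (auto simp: sort_adj_def)
  next
    case True
    have p0: "0 \<le> p m" if "1 \<le> m" for m using lifts_except_excess(1)[OF True i that] by (simp add: p_def)
    have anti: "p m' \<le> p m" if "1 \<le> m" "m \<le> m'" for m m'
      using lifts_except_excess(2)[OF True i that] by (simp add: p_def)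
    have eps: "m < d (Suc i) \<Longrightarrow> m < d i" for m using d by simp
    show ?thesis
    proof (cases "b i < b (Suc i)")
      case False
      \<comment> \<open>At threshold \<open>d (Suc i)\<close> the exchanged \<open>d\<close> leaves
        row \<open>i\<close> idle, so nothing waits and \<open>b i\<close> is too small; then
        \<open>b (Suc i)\<close> is too small as well, and row \<open>i + 1\<close> could not be
        used.\<close>
      have "d i = d (Suc i)" if "?R b ?sd"
      proof (rule ccontr)
        assume "d i \<noteq> d (Suc i)"
        then have "d (Suc i) < d i" using d by simp
        then show False using that[rule_format, of "d (Suc i)"] d p0[of "d (Suc i)"] False
          by (cases "d (Suc i) \<le> b i"; cases "d (Suc i) \<le> b (Suc i)") (auto simp: lift_rule_def s)
      qed
      then have "lifts n b d" if "lifts n b ?sd"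
        using that eqs(3) swap_parts_trivial[of d i "Suc i"] by metis
      then show ?thesis using False by (auto simp: sort_adj_def)
    next
      case lt: True
      have "?R ?sb d \<longleftrightarrow> ?R b d \<or> ?R b ?sd"
      proof
        assume R: "?R ?sb d"
        show "?R b d \<or> ?R b ?sd"
        proof (cases "\<forall>m. b i < m \<and> m \<le> b (Suc i) \<longrightarrow> 0 < p m")
          case True
          have "?R b d"
          proof (intro allI impI)
            fix m :: nat assume "1 \<le> m"
            then show "lift_rule (p m) (m \<le> b i) (m \<le> b (Suc i)) (m < d i) (m < d (Suc i))"
              using R[rule_format, of m] True[rule_format, of m] lt
              by (cases "m \<le> b i"; cases "m \<le> b (Suc i)") (auto simp: lift_rule_def s)
          qed
          then show ?thesis ..
        next
          case False
          then obtain m0 where m0: "b i < m0" "m0 \<le> b (Suc i)" "p m0 \<le> 0" by (auto simp: not_less)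
          have "?R b ?sd"
          proof (intro allI impI)
            fix m :: nat assume m: "1 \<le> m"
            have "p m = 0" if "b (Suc i) < m"
              using that anti[of m0 m] p0[OF m] m0 by simp
            then show "lift_rule (p m) (m \<le> b i) (m \<le> b (Suc i)) (m < ?sd i) (m < ?sd (Suc i))"
              using R[rule_format, of m] p0[OF m] m lt
              by (cases "m \<le> b i"; cases "m \<le> b (Suc i)"; cases "p m = 0") (auto simp: lift_rule_def s)
          qed
          then show ?thesis ..
        qed
      next
        assume R: "?R b d \<or> ?R b ?sd"
        show "?R ?sb d"
        proof (intro allI impI)
          fix m :: nat assume m: "1 \<le> m"
          show "lift_rule (p m) (m \<le> ?sb i) (m \<le> ?sb (Suc i)) (m < d i) (m < d (Suc i))"
            using R
          proof
            assume "?R b d"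
            from this[rule_format, of m] show ?thesis
              using p0[OF m] m lt eps[of m]
              by (cases "m \<le> b i"; cases "m \<le> b (Suc i)"; cases "p m = 0") (auto simp: lift_rule_def s)
          next
            assume "?R b ?sd"
            from this[rule_format, of m] show ?thesis
              using p0[OF m] m lt eps[of m]
              by (cases "m \<le> b i"; cases "m \<le> b (Suc i)"; cases "p m = 0"; cases "p m = 1") (auto simp: lift_rule_def s)
          qed
        qed
      qed
      then show ?thesis using eqs lt by (auto simp: sort_adj_def)
    qed
  qed
qed

section \<open>The Demazure operators on atoms\<close>

definition atom_rule :: "nat \<Rightarrow> nat \<Rightarrow> nat \<Rightarrow> bool" where
  "atom_rule n w i \<longleftrightarrow> (\<forall>d\<in>compositions n w.
     (d (Suc i) < d i \<longrightarrow> demazure i (atom n w d) (atom n w d + atom n w (swap_adj i d))) \<and>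
     (d i = d (Suc i) \<longrightarrow> demazure i (atom n w d) (atom n w d)) \<and>
     (d i < d (Suc i) \<longrightarrow> demazure i (atom n w d) 0))"

text \<open>The fibre of \<open>sort_adj i\<close> over \<open>b\<close> is \<open>b\<close> with
  its exchange, \<open>b\<close> alone, or empty, according to whether \<open>b\<close> has a
  descent, equal parts or an ascent at \<open>i\<close>: the three cases of
  \<open>atom_rule\<close>.\<close>

lemma demazure_sum_atoms:
  assumes rule: "atom_rule n w i" and i: "1 \<le> i" "i < n" and X: "X \<subseteq> compositions n w"
  shows "demazure i (\<Sum>d\<in>X. atom n w d) (\<Sum>d | d \<in> compositions n w \<and> sort_adj i d \<in> X. atom n w d)"
proof -
  define F where "F b = {y \<in> compositions n w. sort_adj i y = b}" for b
  have fin: "finite (F b)" for b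
    unfolding F_def by (rule finite_subset[OF _ finite_compositions[of n w]]) auto
  have "demazure i (atom n w b) (\<Sum>y\<in>F b. atom n w y)" if "b \<in> X" for b
  proof -
    have b: "b \<in> compositions n w" using X that by auto
    have sb: "swap_adj i b \<in> compositions n w" using compositions_swap_parts[OF b] i by simp
    consider "b (Suc i) < b i" | "b i = b (Suc i)" | "b i < b (Suc i)" by linarith
    then show ?thesis
    proof cases
      case 1
      then have "F b = {b, swap_adj i b}"
        using b sb by (auto simp: F_def sort_adj_def swap_parts_apply split: if_splits)
      moreover have "b \<noteq> swap_adj i b" using 1 by (metis less_irrefl swap_parts_apply)
      ultimately show ?thesis using rule b 1 by (simp add: atom_rule_def)
    next
      case 2
      then have "F b = {b}"
        using b by (auto simp: F_def sort_adj_def swap_parts_apply split: if_splits)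
      then show ?thesis using rule b 2 by (simp add: atom_rule_def)
    next
      case 3
      then have "y \<notin> F b" for y using sort_adj_ge[of i y] by (auto simp: F_def)
      then have "F b = {}" by auto
      then show ?thesis using rule b 3 by (simp add: atom_rule_def)
    qed
  qed
  then have "demazure i (\<Sum>d\<in>X. atom n w d) (\<Sum>b\<in>X. \<Sum>y\<in>F b. atom n w y)"
    by (rule demazure_sum)
  also have "(\<Sum>b\<in>X. \<Sum>y\<in>F b. atom n w y) = (\<Sum>y\<in>(\<Union>b\<in>X. F b). atom n w y)"
    using fin X finite_subset[OF X finite_compositions]
    by (intro sum.UNION_disjoint[symmetric]) (auto simp: F_def)
  also have "(\<Union>b\<in>X. F b) = {d. d \<in> compositions n w \<and> sort_adj i d \<in> X}"
    by (auto simp: F_def)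
  finally show ?thesis .
qed

text \<open>The image of the exchanged atom is symmetric, hence fixed by \<pi>_i; subtracting the
  two images of its summands leaves 0.\<close>

lemma demazure_atom_less:
  assumes i: "1 \<le> i" "i < n"
    and gt: "demazure i (atom n w (swap_adj i d)) (atom n w (swap_adj i d) + atom n w d)"
  shows "demazure i (atom n w d) 0"
proof -
  have "demazure i (atom n w (swap_adj i d) + atom n w d) (atom n w (swap_adj i d) + atom n w d)"
    by (rule demazure_of_symmetric[OF demazure_symmetric[OF gt]])
  from demazure_diff[OF this gt] show ?thesis by simp
qed

text \<open>If the first column contains both rows or neither, its monomial is symmetric and \<pi>_i
  acts on the sum \<open>F d\<close> over the keys of the rest. If it contains row \<open>i\<close>
  only, the twisted Leibniz rule applies, and \<pi>_i of \<open>F d\<close> is the sum belonging to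
  the exchanged \<open>d\<close>.\<close>

theorem atom_rule: "1 \<le> i \<Longrightarrow> i < n \<Longrightarrow> atom_rule n w i"
proof (induction w)
  case 0
  have base: "d i = d (Suc i) \<and> demazure i (atom n 0 d) (atom n 0 d)" if "d \<in> compositions n 0" for d
  proof -
    have "d = (\<lambda>_. 0)" using that by (auto simp: compositions_def)
    then have "atom n 0 d = 1" by (simp add: atom_def wt_def)
    then show ?thesis using \<open>d = _\<close> by (simp add: demazure_of_symmetric)
  qed
  show ?case unfolding atom_rule_def
  proof
    fix d assume "d \<in> compositions n 0"
    from base[OF this] show "(d (Suc i) < d i \<longrightarrow> demazure i (atom n 0 d) (atom n 0 d + atom n 0 (swap_adj i d))) \<and>
      (d i = d (Suc i) \<longrightarrow> demazure i (atom n 0 d) (atom n 0 d)) \<and>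
      (d i < d (Suc i) \<longrightarrow> demazure i (atom n 0 d) 0)" by simp
  qed
next
  case (Suc w)
  have i: "1 \<le> i" "i < n" by fact+
  define B where "B d = {b. b \<in> compositions n w \<and> lifts n b d}" for d
  define F where "F d = (\<Sum>b\<in>B d. atom n w b)" for d
  have atom: "atom n (Suc w) d = (\<Prod>r | 0 < d r. xvar r) * F d" for d
    unfolding F_def B_def by (rule atom_Suc)
  have fin: "finite (B d)" for d
    unfolding B_def by (rule finite_subset[OF _ finite_compositions[of n w]]) auto
  have demF: "demazure i (F d) (\<Sum>b | b \<in> compositions n w \<and> lifts n (sort_adj i b) d. atom n w b)" for d
  proof -
    have "{b. b \<in> compositions n w \<and> sort_adj i b \<in> B d} = {b. b \<in> compositions n w \<and> lifts n (sort_adj i b) d}"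
      using i by (auto simp: B_def sort_adj_compositions)
    then show ?thesis
      using demazure_sum_atoms[OF Suc.IH[OF i] i, of "B d"] unfolding F_def by (auto simp: B_def)
  qed
  have sym: "swap_vars i (\<Prod>r\<in>C. xvar r) = (\<Prod>r\<in>C. xvar r)"
    if "i \<in> C \<longleftrightarrow> Suc i \<in> C" for C :: "nat set"
  proof -
    have "bij_betw (transpose i (Suc i)) C C"
      using that by (intro bij_betw_byWitness[where f' = "transpose i (Suc i)"]) (auto simp: transpose_def)
    then show ?thesis by (simp add: swap_vars_prod prod.reindex_bij_betw[where g = xvar])
  qed
  have eq: "demazure i (atom n (Suc w) d) (atom n (Suc w) d)" if "d i = d (Suc i)" for d
  proof -
    have "lifts n (sort_adj i b) d \<longleftrightarrow> lifts n b d" for b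
      using lift_fiber_zero_zero[OF i, of d b] lift_fiber_pos_pos[OF i, of d b] that swap_parts_trivial[of d i "Suc i", OF that]
      by (cases "d i = 0") auto
    then have "demazure i (F d) (F d)" using demF[of d] by (simp add: F_def B_def)
    then show ?thesis unfolding atom by (intro demazure_mult sym) (use that in auto)
  qed
  have gt: "demazure i (atom n (Suc w) d) (atom n (Suc w) d + atom n (Suc w) (swap_adj i d))"
    if lt: "d (Suc i) < d i" "d \<in> compositions n (Suc w)" for d
  proof (cases "d (Suc i) = 0")
    case False
    have supp: "{r. 0 < swap_adj i d r} = {r. 0 < d r}" using False lt by (auto simp: swap_parts_apply)
    have "d \<noteq> swap_adj i d" using lt by (metis less_irrefl swap_parts_apply)
    \<comment> \<open>A common \<open>b\<close> would have two different lifts with the same first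
      column.\<close>
    then have "B d \<inter> B (swap_adj i d) = {}" using lifts_unique supp by (fastforce simp: B_def)
    then have "F d + F (swap_adj i d) = (\<Sum>b\<in>B d \<union> B (swap_adj i d). atom n w b)"
      unfolding F_def by (simp add: sum.union_disjoint fin)
    also have "B d \<union> B (swap_adj i d) = {b. b \<in> compositions n w \<and> lifts n (sort_adj i b) d}"
      using lift_fiber_pos_pos[OF i, of d] False lt by (auto simp: B_def)
    finally have "demazure i (F d) (F d + F (swap_adj i d))" using demF[of d] by simp
    then have "demazure i ((\<Prod>r | 0 < d r. xvar r) * F d) ((\<Prod>r | 0 < d r. xvar r) * (F d + F (swap_adj i d)))"
      by (intro demazure_mult sym) (use False lt in auto)
    then show ?thesis unfolding atom supp by (simp add: distrib_left)
  next
    case True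
    define C where "C = {r. 0 < d r} - {i}"
    have wd: "weak_composition n d" using lt by (simp add: compositions_def)
    have C: "finite C" "i \<notin> C" "Suc i \<notin> C" "{r. 0 < d r} = insert i C" "{r. 0 < swap_adj i d r} = insert (Suc i) C"
      using True lt finite_subset[OF weak_composition_support[OF wd]] by (auto simp: C_def swap_parts_apply)
    have "F (swap_adj i d) = (\<Sum>b | b \<in> compositions n w \<and> lifts n (sort_adj i b) d. atom n w b)"
      using lift_fiber_pos_zero[OF i, of d] True lt by (simp add: F_def B_def)
    then have "demazure i (F d) (F (swap_adj i d))" using demF[of d] by simp
    then have "demazure i ((\<Prod>r\<in>C. xvar r) * (xvar i * F d))
        ((\<Prod>r\<in>C. xvar r) * (xvar i * F d + xvar (Suc i) * F (swap_adj i d)))"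
      using C by (intro demazure_mult demazure_xvar_mult sym) auto
    then show ?thesis unfolding atom C(4,5) using C(1-3)
      by (simp add: distrib_left mult.assoc mult.left_commute)
  qed
  have "demazure i (atom n (Suc w) d) 0" if "d i < d (Suc i)" "d \<in> compositions n (Suc w)" for d
    using gt[of "swap_adj i d"] that i compositions_swap_parts[of d n "Suc w" i "Suc i"]
    by (intro demazure_atom_less[OF i]) (auto simp: swap_parts_apply)
  then show ?case using eq gt by (simp add: atom_rule_def)
qed

section \<open>Multiplication by a sum of variables, on atoms\<close>

text \<open>The bounds \<open>B\<close> need not be the counts of a composition; so Bruhat intervals
  and their unions for a fixed column share one pullback lemma.\<close>

definition region :: "nat \<Rightarrow> (nat \<Rightarrow> int) \<Rightarrow> (nat \<Rightarrow> nat \<Rightarrow> int) \<Rightarrow> (nat \<Rightarrow> nat) set" where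
  "region n T B = {d. weak_composition n d \<and>
     (\<forall>m\<ge>1. tail_count n d m 1 = T m \<and> (\<forall>t\<ge>1. tail_count n d m t \<le> B m t))}"

lemma bruhat_le_region:
  "{d. bruhat_le n d a} = region n (\<lambda>m. tail_count n a m 1) (tail_count n a)"
  by (auto simp: bruhat_le_def region_def)

lemma tail_count_Suc_le: "t \<le> n \<Longrightarrow> tail_count n d m (Suc t) \<le> tail_count n d m t"
  by (simp add: tail_count_split[of t])

lemma tail_count_le_Suc: "tail_count n d m t \<le> tail_count n d m (Suc t) + 1"
  by (cases "t \<le> n") (auto simp: tail_count_split[of t])

text \<open>The count of \<open>d\<close> at row \<open>i + 1\<close> is at most its count at
  \<open>i\<close> and at most one more than at \<open>i + 2\<close>; after sorting it is the count
  at \<open>i + 2\<close> or the count at \<open>i\<close> minus one. Under \<open>le\<close> and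
  \<open>ge\<close> the condition at row \<open>i + 1\<close> thus follows from the neighbouring
  ones on either side.\<close>

lemma region_sort_adj:
  assumes i: "1 \<le> i" "i < n"
    and same: "\<And>m t. 1 \<le> m \<Longrightarrow> t \<noteq> Suc i \<Longrightarrow> B' m t = B m t"
    and le: "\<And>m. 1 \<le> m \<Longrightarrow> min (B m (Suc (Suc i)) + 1) (B m i) \<le> B' m (Suc i)"
    and ge: "\<And>m. 1 \<le> m \<Longrightarrow> max (B m (Suc (Suc i))) (B m i - 1) \<le> B m (Suc i)"
  shows "sort_adj i d \<in> region n T B \<longleftrightarrow> d \<in> region n T B'"
proof -
  have total: "tail_count n (sort_adj i d) m 1 = tail_count n d m 1" for m
    using i by (simp add: tail_count_sort_adj)
  have "(\<forall>t\<ge>1. tail_count n (sort_adj i d) m t \<le> B m t) \<longleftrightarrow> (\<forall>t\<ge>1. tail_count n d m t \<le> B' m t)"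
    if m: "1 \<le> m" for m
  proof
    assume L: "\<forall>t\<ge>1. tail_count n (sort_adj i d) m t \<le> B m t"
    have L': "tail_count n d m t \<le> B m t" if "1 \<le> t" "t \<noteq> Suc i" for t
      using L[rule_format, OF that(1)] that(2) i by (simp add: tail_count_sort_adj)
    show "\<forall>t\<ge>1. tail_count n d m t \<le> B' m t"
    proof (intro allI impI)
      fix t :: nat assume t: "1 \<le> t"
      show "tail_count n d m t \<le> B' m t"
      proof (cases "t = Suc i")
        case True
        have "tail_count n d m (Suc i) \<le> B m (Suc (Suc i)) + 1"
          using tail_count_le_Suc[of n d m "Suc i"] L'[of "Suc (Suc i)"] by simp
        moreover have "tail_count n d m (Suc i) \<le> B m i"
          using tail_count_Suc_le[of i n d m] L'[of i] i by simp
        ultimately show ?thesis using le[OF m] True by simp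
      next
        case False
        then show ?thesis using L'[OF t] same[OF m] by simp
      qed
    qed
  next
    assume R: "\<forall>t\<ge>1. tail_count n d m t \<le> B' m t"
    have R': "tail_count n d m t \<le> B m t" if "1 \<le> t" "t \<noteq> Suc i" for t
      using R[rule_format, OF that(1)] same[OF m that(2)] by simp
    show "\<forall>t\<ge>1. tail_count n (sort_adj i d) m t \<le> B m t"
    proof (intro allI impI)
      fix t :: nat assume t: "1 \<le> t"
      show "tail_count n (sort_adj i d) m t \<le> B m t"
      proof (cases "t = Suc i")
        case True
        have eq: "tail_count n d m i = of_bool (m \<le> d i) + of_bool (m \<le> d (Suc i)) + tail_count n d m (Suc (Suc i))"
          using i by (simp add: tail_count_split[of i] tail_count_split[of "Suc i"])
        have "of_bool (m \<le> d i \<and> m \<le> d (Suc i)) + tail_count n d m (Suc (Suc i)) \<le> B m (Suc i)"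
        proof (cases "m \<le> d i \<and> m \<le> d (Suc i)")
          case True
          then show ?thesis using eq R'[of i] i ge[OF m] by simp
        next
          case False
          then show ?thesis using R'[of "Suc (Suc i)"] ge[OF m] by auto
        qed
        then show ?thesis using i True by (simp add: tail_count_sort_adj_Suc)
      next
        case False
        then show ?thesis using R'[OF t] i by (simp add: tail_count_sort_adj)
      qed
    qed
  qed
  then show ?thesis
    unfolding region_def mem_Collect_eq weak_composition_sort_adj[OF i] total by blast
qed

lemma tail_count_adjacent_rows:
  assumes "1 \<le> i" "i < n"
  shows "tail_count n (swap_adj i a) m (Suc i) = of_bool (m \<le> a i) + tail_count n a m (Suc (Suc i))"
    "tail_count n (swap_adj i a) m i = tail_count n a m i"
    "tail_count n (swap_adj i a) m (Suc (Suc i)) = tail_count n a m (Suc (Suc i))"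
    "tail_count n a m (Suc i) = of_bool (m \<le> a (Suc i)) + tail_count n a m (Suc (Suc i))"
    "tail_count n a m i = of_bool (m \<le> a i) + of_bool (m \<le> a (Suc i)) + tail_count n a m (Suc (Suc i))"
  using assms by (simp_all add: tail_count_swap_adj_Suc tail_count_swap_adj tail_count_split[of i]
      tail_count_split[of "Suc i"] swap_parts_apply)

text \<open>Indexes the atoms of \<open>\<kappa>\<^sub>a \<cdot> s\<^sub>1(x\<^sub>1, \<dots>, x\<^sub>k)\<close> that arise by adding a box in column \<open>c\<close>.\<close>

definition pieri_region :: "nat \<Rightarrow> (nat \<Rightarrow> nat) \<Rightarrow> nat \<Rightarrow> nat \<Rightarrow> (nat \<Rightarrow> nat) set" where
  "pieri_region n a c k = region n (\<lambda>m. tail_count n a m 1 + of_bool (m = c))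
     (\<lambda>m t. tail_count n a m t + of_bool (m = c \<and> t \<le> k))"

lemma pieri_regionD:
  assumes "d \<in> pieri_region n a c k" "1 \<le> m"
  shows "weak_composition n d" "tail_count n d m 1 = tail_count n a m 1 + of_bool (m = c)"
    "1 \<le> t \<Longrightarrow> tail_count n d m t \<le> tail_count n a m t + of_bool (m = c \<and> t \<le> k)"
  using assms by (auto simp: pieri_region_def region_def)

lemma pieri_regionI:
  assumes "weak_composition n d"
    and "\<And>m. 1 \<le> m \<Longrightarrow> tail_count n d m 1 = tail_count n a m 1 + of_bool (m = c)"
    and "\<And>m t. 1 \<le> m \<Longrightarrow> 1 \<le> t \<Longrightarrow> tail_count n d m t \<le> tail_count n a m t + of_bool (m = c \<and> t \<le> k)"
  shows "d \<in> pieri_region n a c k"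
  using assms by (auto simp: pieri_region_def region_def)

lemma pieri_region_column_unique:
  assumes "d \<in> pieri_region n a c k" "d \<in> pieri_region n a c' k'" "1 \<le> c"
  shows "c = c'"
  using pieri_regionD(2)[OF assms(1,3)] pieri_regionD(2)[OF assms(2,3)] by (auto split: if_splits)

lemma pieri_region_0: "1 \<le> c \<Longrightarrow> pieri_region n a c 0 = {}"
proof -
  assume c: "1 \<le> c"
  have "d \<notin> pieri_region n a c 0" for d
    using pieri_regionD(2)[of d n a c 0 c] pieri_regionD(3)[of d n a c 0 c 1] c by auto
  then show ?thesis by auto
qed

lemma pieri_region_compositions:
  assumes "a \<in> compositions n w" "c \<le> Suc w" "d \<in> pieri_region n a c k"
  shows "d \<in> compositions n (Suc w)"
proof -
  have wd: "weak_composition n d" using pieri_regionD(1)[OF assms(3), of 1] by simp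
  have wa: "weak_composition n a" "\<And>i. a i \<le> w" using assms(1) by (auto simp: compositions_def)
  have "\<not> (\<exists>i. Suc (Suc w) \<le> a i)" using wa(2) by (meson Suc_leD not_less_eq_eq)
  then have "\<not> 1 \<le> tail_count n a (Suc (Suc w)) 1"
    using le_bound_iff_tail_count[OF wa(1), of "Suc (Suc w)"] by simp
  then have "\<not> 1 \<le> tail_count n d (Suc (Suc w)) 1"
    using pieri_regionD(2)[OF assms(3), of "Suc (Suc w)"] assms(2) by simp
  then have "\<not> (\<exists>i. Suc (Suc w) \<le> d i)"
    using le_bound_iff_tail_count[OF wd, of "Suc (Suc w)"] by simp
  then show ?thesis using wd by (auto simp: compositions_def not_less_eq_eq)
qed

text \<open>As \<open>i \<noteq> k\<close>, the added box raises the bounds at rows \<open>i\<close>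
  and \<open>i + 1\<close> alike.\<close>

lemma pieri_region_sort_adj:
  assumes i: "1 \<le> i" "i < n" "i \<noteq> k" and a: "a i \<le> a (Suc i)"
  shows "sort_adj i d \<in> pieri_region n (swap_adj i a) c k \<longleftrightarrow> d \<in> pieri_region n a c k"
proof -
  have total: "tail_count n (swap_adj i a) m 1 = tail_count n a m 1" for m
    using i by (simp add: tail_count_swap_adj)
  show ?thesis
    unfolding pieri_region_def total
  proof (rule region_sort_adj[OF i(1,2)])
    fix m :: nat
    note 1 = tail_count_adjacent_rows[OF i(1,2), of a m]
    have e: "(Suc i \<le> k) = (i \<le> k)" "Suc (Suc i) \<le> k \<Longrightarrow> i \<le> k" using i by auto
    show "min (tail_count n (swap_adj i a) m (Suc (Suc i)) + of_bool (m = c \<and> Suc (Suc i) \<le> k) + 1)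
      (tail_count n (swap_adj i a) m i + of_bool (m = c \<and> i \<le> k))
      \<le> tail_count n a m (Suc i) + of_bool (m = c \<and> Suc i \<le> k)"
      unfolding 1 e(1) using e(2) a by (cases "m \<le> a i"; cases "m \<le> a (Suc i)") auto
    show "max (tail_count n (swap_adj i a) m (Suc (Suc i)) + of_bool (m = c \<and> Suc (Suc i) \<le> k))
      (tail_count n (swap_adj i a) m i + of_bool (m = c \<and> i \<le> k) - 1)
      \<le> tail_count n (swap_adj i a) m (Suc i) + of_bool (m = c \<and> Suc i \<le> k)"
      unfolding 1 e(1) using e(2) a by (cases "m \<le> a i"; cases "m \<le> a (Suc i)") auto
  qed (use i in \<open>simp add: tail_count_swap_adj\<close>)
qed

text \<open>Combined with \<open>demazure_sum_atoms\<close>, this gives the classical recursion: at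
  an ascent \<open>i\<close> of \<open>a\<close>, \<pi>_i sends the key polynomial of
  \<open>swap_adj i a\<close> to that of \<open>a\<close>.\<close>

lemma bruhat_le_sort_adj:
  assumes i: "1 \<le> i" "i < n" and a: "a i \<le> a (Suc i)"
  shows "bruhat_le n (sort_adj i d) (swap_adj i a) \<longleftrightarrow> bruhat_le n d a"
proof -
  have total: "tail_count n (swap_adj i a) m 1 = tail_count n a m 1" for m
    using i by (simp add: tail_count_swap_adj)
  have "sort_adj i d \<in> region n (\<lambda>m. tail_count n a m 1) (tail_count n (swap_adj i a))
    \<longleftrightarrow> d \<in> region n (\<lambda>m. tail_count n a m 1) (tail_count n a)"
  proof (rule region_sort_adj[OF i])
    fix m :: nat
    note 1 = tail_count_adjacent_rows[OF i(1,2), of a m]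
    show "min (tail_count n (swap_adj i a) m (Suc (Suc i)) + 1) (tail_count n (swap_adj i a) m i)
      \<le> tail_count n a m (Suc i)"
      unfolding 1 using a by (cases "m \<le> a i"; cases "m \<le> a (Suc i)") auto
    show "max (tail_count n (swap_adj i a) m (Suc (Suc i))) (tail_count n (swap_adj i a) m i - 1)
      \<le> tail_count n (swap_adj i a) m (Suc i)"
      unfolding 1 using a by (cases "m \<le> a i"; cases "m \<le> a (Suc i)") auto
  qed (use i in \<open>simp add: tail_count_swap_adj\<close>)
  then show ?thesis using bruhat_le_region[of n a] bruhat_le_region[of n "swap_adj i a"] total by auto
qed

text \<open>What the region for \<open>k\<close> contains beyond the region for
  \<open>k - 1\<close>; its atoms, over all columns, will make up x_k \<kappa>_a.\<close>

definition pieri_layer :: "nat \<Rightarrow> (nat \<Rightarrow> nat) \<Rightarrow> nat \<Rightarrow> nat \<Rightarrow> (nat \<Rightarrow> nat) set" where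
  "pieri_layer n a c k = {d \<in> pieri_region n a c k. tail_count n d c k = tail_count n a c k + 1}"

lemma pieri_region_Suc:
  assumes "1 \<le> c"
  shows "pieri_region n a c (Suc k) = pieri_region n a c k \<union> pieri_layer n a c (Suc k)"
    "pieri_region n a c k \<inter> pieri_layer n a c (Suc k) = {}"
proof -
  have mono: "d \<in> pieri_region n a c (Suc k)" if d: "d \<in> pieri_region n a c k" for d
  proof (rule pieri_regionI)
    fix m t :: nat assume m: "1 \<le> m" and t: "1 \<le> t"
    show "tail_count n d m 1 = tail_count n a m 1 + of_bool (m = c)"
      using pieri_regionD[OF d m] by auto
    have "(of_bool (m = c \<and> t \<le> k) :: int) \<le> of_bool (m = c \<and> t \<le> Suc k)" by simp
    then show "tail_count n d m t \<le> tail_count n a m t + of_bool (m = c \<and> t \<le> Suc k)"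
      using pieri_regionD(3)[OF d m t] by linarith
  qed (use pieri_regionD(1)[OF d, of 1] in simp)
  have conv: "d \<in> pieri_region n a c k"
    if d: "d \<in> pieri_region n a c (Suc k)" and ne: "tail_count n d c (Suc k) \<noteq> tail_count n a c (Suc k) + 1" for d
  proof (rule pieri_regionI)
    fix m t :: nat assume m: "1 \<le> m" and t: "1 \<le> t"
    show "tail_count n d m 1 = tail_count n a m 1 + of_bool (m = c)"
      using pieri_regionD[OF d m] by auto
    show "tail_count n d m t \<le> tail_count n a m t + of_bool (m = c \<and> t \<le> k)"
      using pieri_regionD(3)[OF d m t] ne by (cases "m = c \<and> t = Suc k") (auto simp: le_Suc_eq)
  qed (use pieri_regionD(1)[OF d, of 1] in simp)
  show "pieri_region n a c (Suc k) = pieri_region n a c k \<union> pieri_layer n a c (Suc k)"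
    using mono conv by (auto simp: pieri_layer_def)
  have "tail_count n d c (Suc k) \<noteq> tail_count n a c (Suc k) + 1" if "d \<in> pieri_region n a c k" for d
    using pieri_regionD(3)[OF that assms, of "Suc k"] by auto
  then show "pieri_region n a c k \<inter> pieri_layer n a c (Suc k) = {}"
    by (auto simp: pieri_layer_def)
qed

text \<open>\<open>b\<close> is \<open>a\<close> with an ascent at \<open>k\<close> removed. On atoms, \<open>x\<^sub>k \<kappa>\<^sub>b\<close> is supported on the layer \<open>k\<close> of \<open>b\<close>
  and \<open>x\<^sub>k\<^sub>+\<^sub>1 \<kappa>\<^sub>a\<close> on the layer \<open>k + 1\<close> of \<open>a\<close>; together they exhaust \<open>\<pi>\<^sub>k (x\<^sub>k \<kappa>\<^sub>b)\<close>.\<close>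

lemma pieri_layer_sort_adj:
  assumes k: "1 \<le> k" "k < n" and a: "a k < a (Suc k)" and c: "1 \<le> c"
  defines "b \<equiv> swap_adj k a"
  shows "sort_adj k d \<in> pieri_layer n b c k \<longleftrightarrow> d \<in> pieri_layer n b c k \<or> d \<in> pieri_layer n a c (Suc k)"
    "pieri_layer n b c k \<inter> pieri_layer n a c (Suc k) = {}"
proof -
  let ?k2 = "Suc (Suc k)"
  define Y where "Y m = tail_count n a m ?k2" for m
  have a1: "tail_count n a m (Suc k) = of_bool (m \<le> a (Suc k)) + Y m" for m
    using k by (simp add: Y_def tail_count_split[of "Suc k"])
  have a0: "tail_count n a m k = of_bool (m \<le> a k) + of_bool (m \<le> a (Suc k)) + Y m" for m
    using k a1[of m] by (simp add: tail_count_split[of k])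
  have b1: "tail_count n b m (Suc k) = of_bool (m \<le> a k) + Y m" for m
    using k by (simp add: b_def Y_def tail_count_swap_adj_Suc)
  have b': "tail_count n b m t = tail_count n a m t" if "t \<noteq> Suc k" for m t
    unfolding b_def by (rule tail_count_swap_adj[OF k(2) that])
  have sb: "tail_count n (swap_adj k d) m (Suc k) = of_bool (m \<le> d k) + tail_count n d m ?k2" for m d
    using k by (simp add: tail_count_swap_adj_Suc)
  have s': "tail_count n (swap_adj k d) m t = tail_count n d m t" if "t \<noteq> Suc k" for m t d
    by (rule tail_count_swap_adj[OF k(2) that])
  have d1: "tail_count n d m (Suc k) = of_bool (m \<le> d (Suc k)) + tail_count n d m ?k2" for d m
    using k by (simp add: tail_count_split[of "Suc k"])
  have d0: "tail_count n d m k = of_bool (m \<le> d k) + of_bool (m \<le> d (Suc k)) + tail_count n d m ?k2" for d m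
    using k d1[of d m] by (simp add: tail_count_split[of k])
  have wc: "weak_composition n (swap_adj k d) \<longleftrightarrow> weak_composition n d" for d
    by (rule weak_composition_swap_adj_iff[OF k])
  text \<open>Membership in both layers differs only in the condition at \<open>t = k + 1\<close>.\<close>
  define R where "R d \<longleftrightarrow> weak_composition n d \<and> tail_count n d c k = tail_count n a c k + 1 \<and>
    (\<forall>m\<ge>1. tail_count n d m 1 = tail_count n a m 1 + of_bool (m = c) \<and>
      (\<forall>t\<ge>1. t \<noteq> Suc k \<longrightarrow> tail_count n d m t \<le> tail_count n a m t + of_bool (m = c \<and> t \<le> k)))" for d
  have R_le: "tail_count n d m t \<le> tail_count n a m t + of_bool (m = c \<and> t \<le> k)"
    if "R d" "1 \<le> m" "1 \<le> t" "t \<noteq> Suc k" for d m t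
    using that unfolding R_def by blast
  have R_eq: "tail_count n d c k = tail_count n a c k + 1" if "R d" for d
    using that unfolding R_def by blast
  have Rs: "R (swap_adj k d) \<longleftrightarrow> R d" for d
    unfolding R_def wc using s' k by (simp cong: conj_cong)
  have layer_b: "d \<in> pieri_layer n b c k \<longleftrightarrow> R d \<and> (\<forall>m\<ge>1. tail_count n d m (Suc k) \<le> of_bool (m \<le> a k) + Y m)" for d
  proof
    assume d: "d \<in> pieri_layer n b c k"
    then have d': "d \<in> pieri_region n b c k" and e: "tail_count n d c k = tail_count n b c k + 1"
      by (auto simp: pieri_layer_def)
    have "R d" unfolding R_def
    proof (intro conjI allI impI)
      show "weak_composition n d" using pieri_regionD(1)[OF d' c] .
      show "tail_count n d c k = tail_count n a c k + 1" using e b'[of k c] by simp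
      fix m :: nat assume m: "1 \<le> m"
      show "tail_count n d m 1 = tail_count n a m 1 + of_bool (m = c)"
        using pieri_regionD(2)[OF d' m] b'[of 1 m] k by simp
      fix t :: nat assume t: "1 \<le> t" "t \<noteq> Suc k"
      show "tail_count n d m t \<le> tail_count n a m t + of_bool (m = c \<and> t \<le> k)"
        using pieri_regionD(3)[OF d' m t(1)] b'[OF t(2), of m] by simp
    qed
    moreover have "tail_count n d m (Suc k) \<le> of_bool (m \<le> a k) + Y m" if "1 \<le> m" for m
      using pieri_regionD(3)[OF d' that, of "Suc k"] b1[of m] by simp
    ultimately show "R d \<and> (\<forall>m\<ge>1. tail_count n d m (Suc k) \<le> of_bool (m \<le> a k) + Y m)" by blast
  next
    assume r: "R d \<and> (\<forall>m\<ge>1. tail_count n d m (Suc k) \<le> of_bool (m \<le> a k) + Y m)"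
    have "d \<in> pieri_region n b c k"
    proof (rule pieri_regionI)
      show "weak_composition n d" using r by (simp add: R_def)
      fix m t :: nat assume m: "1 \<le> m"
      show "tail_count n d m 1 = tail_count n b m 1 + of_bool (m = c)"
        using r m b'[of 1 m] k by (simp add: R_def)
      assume t: "1 \<le> t"
      show "tail_count n d m t \<le> tail_count n b m t + of_bool (m = c \<and> t \<le> k)"
        using r m t b'[of t m] b1[of m] by (cases "t = Suc k") (auto simp: R_def)
    qed
    then show "d \<in> pieri_layer n b c k" using r b'[of k c] by (simp add: pieri_layer_def R_def)
  qed
  \<comment> \<open>From row \<open>k\<close> on, \<open>d\<close> has one part
    \<open>\<ge> c\<close> more than \<open>a\<close>, but from row \<open>k + 2\<close> on it has
    no more than \<open>a\<close>; so one of the two rows reaches \<open>c\<close>.\<close>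
  have at_c: "c \<le> d k \<or> c \<le> d (Suc k)" if "R d" for d
  proof (rule ccontr)
    assume "\<not> ?thesis"
    then have "tail_count n d c k = tail_count n d c ?k2" using d0[of d c] by simp
    moreover have "tail_count n d c ?k2 \<le> Y c"
      using R_le[OF that c, of ?k2] by (simp add: Y_def)
    ultimately show False using R_eq[OF that] a0[of c]
      by (cases "c \<le> a k"; cases "c \<le> a (Suc k)") auto
  qed
  have layer_a: "d \<in> pieri_layer n a c (Suc k) \<longleftrightarrow> R d \<and>
      (\<forall>m\<ge>1. tail_count n d m (Suc k) \<le> of_bool (m \<le> a (Suc k)) + Y m + of_bool (m = c)) \<and>
      tail_count n d c (Suc k) = of_bool (c \<le> a (Suc k)) + Y c + 1" for d
  proof
    assume d: "d \<in> pieri_layer n a c (Suc k)"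
    then have d': "d \<in> pieri_region n a c (Suc k)" and e: "tail_count n d c (Suc k) = tail_count n a c (Suc k) + 1"
      by (auto simp: pieri_layer_def)
    have ubk: "tail_count n d c k \<le> tail_count n a c k + 1"
      using pieri_regionD(3)[OF d' c, of k] k by simp
    have ub2: "tail_count n d c ?k2 \<le> Y c"
      using pieri_regionD(3)[OF d' c, of ?k2] by (simp add: Y_def)
    have "c \<le> d (Suc k)" "\<not> c \<le> a (Suc k)"
      using e ub2 d1[of d c] a1[of c] by (auto simp: of_bool_def split: if_splits)
    then have eqk: "tail_count n d c k = tail_count n a c k + 1"
      using e ubk d0[of d c] d1[of d c] a0[of c] a1[of c] a by auto
    have "R d" unfolding R_def
    proof (intro conjI allI impI)
      show "weak_composition n d" using pieri_regionD(1)[OF d' c] .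
      show "tail_count n d c k = tail_count n a c k + 1" by (fact eqk)
      fix m :: nat assume m: "1 \<le> m"
      show "tail_count n d m 1 = tail_count n a m 1 + of_bool (m = c)"
        using pieri_regionD(2)[OF d' m] by simp
      fix t :: nat assume t: "1 \<le> t" "t \<noteq> Suc k"
      show "tail_count n d m t \<le> tail_count n a m t + of_bool (m = c \<and> t \<le> k)"
        using pieri_regionD(3)[OF d' m t(1)] t by (auto simp: le_Suc_eq)
    qed
    then show "R d \<and> (\<forall>m\<ge>1. tail_count n d m (Suc k) \<le> of_bool (m \<le> a (Suc k)) + Y m + of_bool (m = c)) \<and>
      tail_count n d c (Suc k) = of_bool (c \<le> a (Suc k)) + Y c + 1"
      using e a1 pieri_regionD(3)[OF d', of _ "Suc k"] by simp
  next
    assume r: "R d \<and> (\<forall>m\<ge>1. tail_count n d m (Suc k) \<le> of_bool (m \<le> a (Suc k)) + Y m + of_bool (m = c)) \<and>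
      tail_count n d c (Suc k) = of_bool (c \<le> a (Suc k)) + Y c + 1"
    have "d \<in> pieri_region n a c (Suc k)"
    proof (rule pieri_regionI)
      show "weak_composition n d" using r by (simp add: R_def)
      fix m t :: nat assume m: "1 \<le> m"
      show "tail_count n d m 1 = tail_count n a m 1 + of_bool (m = c)"
        using r m by (simp add: R_def)
      assume t: "1 \<le> t"
      show "tail_count n d m t \<le> tail_count n a m t + of_bool (m = c \<and> t \<le> Suc k)"
        using r m t a1[of m] by (cases "t = Suc k") (auto simp: R_def le_Suc_eq)
    qed
    then show "d \<in> pieri_layer n a c (Suc k)" using r a1[of c] by (simp add: pieri_layer_def)
  qed
  have bounds: "tail_count n d m ?k2 \<le> Y m" "tail_count n d c k = of_bool (c \<le> a k) + of_bool (c \<le> a (Suc k)) + Y c + 1"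
    "m \<noteq> c \<Longrightarrow> tail_count n d m k \<le> of_bool (m \<le> a k) + of_bool (m \<le> a (Suc k)) + Y m"
    if "R d" "1 \<le> m" for d m
    using R_le[OF that, of ?k2] R_le[OF that, of k] R_eq[OF that(1)] k a0[of m] a0[of c]
    by (auto simp: Y_def)
  show "pieri_layer n b c k \<inter> pieri_layer n a c (Suc k) = {}"
  proof -
    have False if "d \<in> pieri_layer n b c k" "d \<in> pieri_layer n a c (Suc k)" for d
    proof -
      have "tail_count n d c (Suc k) \<le> of_bool (c \<le> a k) + Y c"
        "tail_count n d c (Suc k) = of_bool (c \<le> a (Suc k)) + Y c + 1"
        using that c unfolding layer_a layer_b by blast+
      then show False using a by (cases "c \<le> a k"; cases "c \<le> a (Suc k)") auto
    qed
    then show ?thesis by blast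
  qed
  have closed: "sort_adj k d \<in> pieri_layer n b c k" if "d \<in> pieri_layer n b c k" for d
  proof (cases "d k < d (Suc k)")
    case True
    have "tail_count n (swap_adj k d) m (Suc k) \<le> tail_count n d m (Suc k)" for m
      using True sb[of d m] d1[of d m] by auto
    then have "swap_adj k d \<in> pieri_layer n b c k"
      using that unfolding layer_b Rs by (meson order_trans)
    then show ?thesis using True by (simp add: sort_adj_def)
  qed (use that in \<open>simp add: sort_adj_def\<close>)
  have a_to_b: "sort_adj k d \<in> pieri_layer n b c k" if d: "d \<in> pieri_layer n a c (Suc k)" for d
  proof -
    have r: "R d" and e: "tail_count n d c (Suc k) = of_bool (c \<le> a (Suc k)) + Y c + 1"
      using d by (auto simp: layer_a)
    have dc: "c \<le> d (Suc k)" "\<not> c \<le> a (Suc k)" "tail_count n d c ?k2 = Y c"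
      using e bounds(1)[OF r c] d1[of d c] by (auto simp: of_bool_def split: if_splits)
    \<comment> \<open>The count at row \<open>k\<close> exceeds that of \<open>a\<close> by one
      only, and row \<open>k + 1\<close> already accounts for it.\<close>
    have dk: "\<not> c \<le> d k"
      using bounds(2)[OF r c] dc d0[of d c] a by (auto simp: of_bool_def split: if_splits)
    have "of_bool (m \<le> d k) + tail_count n d m ?k2 \<le> of_bool (m \<le> a k) + Y m" if m: "1 \<le> m" for m
    proof (cases "m \<le> d k")
      case True
      then have "m \<noteq> c" "m \<le> d (Suc k)" using dk dc by auto
      then show ?thesis using bounds(3)[OF r m] d0[of d m] True
        by (auto simp: of_bool_def split: if_splits)
    next
      case False
      then show ?thesis using bounds(1)[OF r m] by (auto simp: of_bool_def split: if_splits)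
    qed
    then have "swap_adj k d \<in> pieri_layer n b c k"
      unfolding layer_b Rs sb using r by blast
    then show ?thesis using dc dk by (simp add: sort_adj_def)
  qed
  have b_to: "d \<in> pieri_layer n b c k \<or> d \<in> pieri_layer n a c (Suc k)" if "sort_adj k d \<in> pieri_layer n b c k" for d
  proof (cases "d k < d (Suc k)")
    case False
    then show ?thesis using that by (simp add: sort_adj_def)
  next
    case lt: True
    then have "swap_adj k d \<in> pieri_layer n b c k" using that by (simp add: sort_adj_def)
    then have r: "R d" and ub: "\<And>m. 1 \<le> m \<Longrightarrow> of_bool (m \<le> d k) + tail_count n d m ?k2 \<le> of_bool (m \<le> a k) + Y m"
      by (auto simp: layer_b Rs sb)
    have dc: "c \<le> d (Suc k)" using at_c[OF r] lt by auto
    have ak: "\<not> c \<le> a (Suc k)"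
      using ub[OF c] bounds(2)[OF r c] d0[of d c] dc by (auto simp: of_bool_def split: if_splits)
    \<comment> \<open>If both parts of \<open>d\<close> reach \<open>c\<close>, then
      \<open>d\<close> stays within the bounds of \<open>b\<close>; otherwise the extra part
      \<open>\<ge> c\<close> sits in row \<open>k + 1\<close>, which is the layer
      \<open>k + 1\<close> of \<open>a\<close>.\<close>
    show ?thesis
    proof (cases "c \<le> d k")
      case True
      have "of_bool (m \<le> d (Suc k)) + tail_count n d m ?k2 \<le> of_bool (m \<le> a k) + Y m" if m: "1 \<le> m" for m
      proof (cases "m \<le> d k \<or> \<not> m \<le> d (Suc k)")
        case True
        then show ?thesis using ub[OF m] bounds(1)[OF r m] lt by (auto simp: of_bool_def split: if_splits)
      next
        case False
        then have "m \<noteq> c" "\<not> m \<le> a (Suc k)" using \<open>c \<le> d k\<close> ak by auto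
        then show ?thesis using bounds(3)[OF r m] d0[of d m] False a by (auto simp: of_bool_def split: if_splits)
      qed
      then show ?thesis using r by (simp add: layer_b d1)
    next
      case False
      have "of_bool (m \<le> d (Suc k)) + tail_count n d m ?k2 \<le> of_bool (m \<le> a (Suc k)) + Y m + of_bool (m = c)"
        if m: "1 \<le> m" for m
      proof (cases "m = c \<or> m \<le> a (Suc k) \<or> \<not> m \<le> d (Suc k)")
        case True
        then show ?thesis using bounds(1)[OF r m] by (auto simp: of_bool_def split: if_splits)
      next
        case False
        then show ?thesis using bounds(3)[OF r m] d0[of d m] a by (auto simp: of_bool_def split: if_splits)
      qed
      moreover have "tail_count n d c ?k2 = Y c"
        using False dc bounds(2)[OF r c] d0[of d c] ak a by (auto simp: of_bool_def split: if_splits)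
      ultimately show ?thesis using r dc ak by (simp add: layer_a d1)
    qed
  qed
  show "sort_adj k d \<in> pieri_layer n b c k \<longleftrightarrow> d \<in> pieri_layer n b c k \<or> d \<in> pieri_layer n a c (Suc k)"
    using closed a_to_b b_to by blast
qed

section \<open>The dominant case\<close>

definition monomial :: "nat \<Rightarrow> (nat \<Rightarrow> nat) \<Rightarrow> mpoly" where
  "monomial n a = (\<Prod>i=1..n. xvar i ^ a i)"

lemma swap_vars_power: "swap_vars i (f ^ m) = swap_vars i f ^ m"
  by (induction m) (auto simp: swap_vars_mult)

lemma swap_vars_monomial:
  assumes "1 \<le> i" "i < n" "a i = a (Suc i)"
  shows "swap_vars i (monomial n a) = monomial n a"
proof -
  have "bij_betw (transpose i (Suc i)) {1..n} {1..n}"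
    using assms by (intro bij_betw_byWitness[where f' = "transpose i (Suc i)"]) (auto simp: transpose_def)
  moreover have "a (transpose i (Suc i) l) = a l" for l using assms(3) by (auto simp: transpose_def)
  then have "swap_vars i (monomial n a) = (\<Prod>l=1..n. xvar (transpose i (Suc i) l) ^ a (transpose i (Suc i) l))"
    by (simp add: monomial_def swap_vars_prod swap_vars_power)
  ultimately show ?thesis
    by (simp add: monomial_def prod.reindex_bij_betw[where g = "\<lambda>l. xvar l ^ a l"])
qed

lemma monomial_add_unit:
  assumes "j \<in> {1..n}"
  shows "monomial n (add_composition a (unit_composition j)) = xvar j * monomial n a"
proof -
  have "monomial n (add_composition a (unit_composition j))
    = monomial n a * (\<Prod>i=1..n. if i = j then xvar i else 1)"
    unfolding monomial_def prod.distrib[symmetric]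
    by (rule prod.cong) (auto simp: add_composition_def unit_composition_def)
  also have "(\<Prod>i=1..n. if i = j then xvar i else 1) = xvar j"
    using assms by (simp add: prod.delta)
  finally show ?thesis by (simp add: mult.commute)
qed

definition dominant :: "nat \<Rightarrow> (nat \<Rightarrow> nat) \<Rightarrow> bool" where
  "dominant n a \<longleftrightarrow> (\<forall>i j. 1 \<le> i \<and> i \<le> j \<and> j \<le> n \<longrightarrow> a j \<le> a i)"

lemma dominantI:
  assumes "\<And>i. 1 \<le> i \<Longrightarrow> i < n \<Longrightarrow> a (Suc i) \<le> a i"
  shows "dominant n a"
  unfolding dominant_def
proof (intro allI impI)
  fix i j assume "1 \<le> i \<and> i \<le> j \<and> j \<le> n"
  then have "i \<le> j" and ij: "1 \<le> i" "j \<le> n" by auto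
  from this(1,3) show "a j \<le> a i"
  proof (induction rule: dec_induct)
    case (step m)
    then show ?case using assms[of m] ij by simp
  qed simp
qed

lemma tail_count_total_le:
  assumes "1 \<le> t" "t \<le> Suc n"
  shows "tail_count n d m 1 \<le> int (t - 1) + tail_count n d m t"
proof -
  have "(\<Sum>i=1..<t. of_bool (m \<le> d i) :: int) \<le> (\<Sum>i=1..<t. 1)" by (rule sum_mono) simp
  then show ?thesis using tail_count_interval[OF assms, of d m] assms by simp
qed

text \<open>If some row from \<open>t\<close> on reaches \<open>m\<close>, so do all rows before it.
  Hence the bound of \<open>tail_count_total_le\<close> is attained, and any composition with the
  same total has at least this count.\<close>

lemma dominant_tail_count:
  assumes "dominant n a" "1 \<le> t" "tail_count n a m t \<noteq> 0"
  shows "tail_count n a m 1 = int (t - 1) + tail_count n a m t" "1 \<le> i \<Longrightarrow> i \<le> t \<Longrightarrow> m \<le> a i"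
proof -
  have t: "t \<le> n" using assms(3) by (meson not_le tail_count_empty)
  obtain j where "j \<in> {t..n}" "m \<le> a j" using assms(3) unfolding tail_count_def
    by (metis (no_types, lifting) of_bool_eq_0_iff sum.not_neutral_contains_not_neutral)
  then show all: "m \<le> a i" if "1 \<le> i" "i \<le> t" for i
    using assms(1) that unfolding dominant_def by (meson atLeastAtMost_iff le_trans)
  have "(\<Sum>i=1..<t. of_bool (m \<le> a i) :: int) = (\<Sum>i=1..<t. 1)"
    by (rule sum.cong) (use all in auto)
  then show "tail_count n a m 1 = int (t - 1) + tail_count n a m t"
    using tail_count_interval[OF assms(2), of n a m] t assms(2) by simp
qed

lemma dominant_bruhat_le:
  assumes wc: "weak_composition n a" and a: "dominant n a"
  shows "{d. bruhat_le n d a} = {a}"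
proof -
  have "d = a" if d: "bruhat_le n d a" for d
  proof (rule bruhat_le_antisym[OF d])
    have "tail_count n a m t \<le> tail_count n d m t" if "1 \<le> m" "1 \<le> t" for m t
    proof (cases "tail_count n a m t = 0 \<or> Suc n < t")
      case False
      then show ?thesis
        using dominant_tail_count(1)[OF a that(2), of m] tail_count_total_le[OF that(2), of n d m]
          bruhat_le_total[OF d, of m] by simp
    qed auto
    then show "bruhat_le n a d"
      using wc bruhat_le_total[OF d] by (simp add: bruhat_le_def)
  qed
  then show ?thesis using bruhat_le_refl[OF wc] by auto
qed

lemma wt_key_diagram: "i \<in> {1..n} \<Longrightarrow> wt (key_diagram n a) i = a i"
proof -
  assume "i \<in> {1..n}"
  then have "{c. (c, i) \<in> key_diagram n a} = {1..a i}" by (auto simp: key_diagram_def)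
  then show ?thesis by (simp add: wt_def)
qed

lemma dominant_key_poly:
  assumes a: "dominant n a"
  shows "key_poly n a = monomial n a"
proof -
  have no: "\<not> kohnert_move (key_diagram n a) T" for T
  proof
    assume "kohnert_move (key_diagram n a) T"
    then obtain c r r' where "(c, r) \<in> key_diagram n a" "1 \<le> r'" "r' < r" "(c, r') \<notin> key_diagram n a"
      unfolding kohnert_move_def by blast
    moreover from this have "a r \<le> a r'" using a by (auto simp: dominant_def key_diagram_def)
    ultimately show False by (auto simp: key_diagram_def)
  qed
  have "KD n a = {key_diagram n a}"
    unfolding KD_def by (auto elim: converse_rtranclpE simp: no)
  then show ?thesis by (simp add: key_poly_def monomial_def wt_key_diagram)
qed

lemma dominant_atom:
  assumes "a \<in> compositions n w" "dominant n a"
  shows "atom n w a = monomial n a"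
  using key_poly_eq_sum_atoms[OF assms(1)] dominant_key_poly[OF assms(2)]
    dominant_bruhat_le[OF _ assms(2)] assms(1) by (simp add: compositions_def)

lemma weak_composition_add_unit:
  "weak_composition n a \<Longrightarrow> j \<in> {1..n} \<Longrightarrow> weak_composition n (add_composition a (unit_composition j))"
  by (auto simp: weak_composition_def add_composition_def unit_composition_def)

lemma compositions_add_unit:
  "a \<in> compositions n w \<Longrightarrow> j \<in> {1..n} \<Longrightarrow> add_composition a (unit_composition j) \<in> compositions n (Suc w)"
  using weak_composition_add_unit[of n a j]
  by (auto simp: compositions_def add_composition_def unit_composition_def le_SucI)

lemma compositions_mono: "w \<le> w' \<Longrightarrow> compositions n w \<subseteq> compositions n w'"
  by (auto simp: compositions_def intro: le_trans)

text \<open>If adding the box in row \<open>j + 1\<close> destroys dominance, the parts in rows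
  \<open>j\<close> and \<open>j + 1\<close> agree, and the result is the exchange of
  \<open>a\<close> with a box in row \<open>j\<close>. Comparing the atom rule with the twisted
  Leibniz rule for x_j x^a gives the next atom.\<close>

lemma dominant_add_unit_atom:
  assumes a: "a \<in> compositions n w" "dominant n a" and "1 \<le> j" "j \<le> n"
  shows "atom n (Suc w) (add_composition a (unit_composition j)) = xvar j * monomial n a"
  using assms(3,4)
proof (induction j rule: nat_induct_at_least)
  case base
  have "dominant n (add_composition a (unit_composition 1))"
    using a(2) by (intro dominantI) (auto simp: dominant_def add_composition_def unit_composition_def intro: le_SucI)
  then have "atom n (Suc w) (add_composition a (unit_composition 1))
    = monomial n (add_composition a (unit_composition 1))"
    using base a by (intro dominant_atom compositions_add_unit) auto
  then show ?case using base by (simp add: monomial_add_unit)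
next
  case (Suc j)
  have j: "1 \<le> j" "j < n" using Suc by auto
  have le: "a (Suc j) \<le> a j" using a(2) j by (auto simp: dominant_def)
  show ?case
  proof (cases "a j = a (Suc j)")
    case False
    have "dominant n (add_composition a (unit_composition (Suc j)))"
    proof (rule dominantI)
      fix i assume i: "1 \<le> i" "i < n"
      then have "a (Suc i) \<le> a i" using a(2) by (auto simp: dominant_def)
      then show "add_composition a (unit_composition (Suc j)) (Suc i) \<le> add_composition a (unit_composition (Suc j)) i"
        using False le by (auto simp: add_composition_def unit_composition_def)
    qed
    then have "atom n (Suc w) (add_composition a (unit_composition (Suc j)))
      = monomial n (add_composition a (unit_composition (Suc j)))"
      using j a by (intro dominant_atom compositions_add_unit) auto
    then show ?thesis using j by (simp add: monomial_add_unit)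
  next
    case True
    let ?d = "add_composition a (unit_composition j)"
    have d: "?d \<in> compositions n (Suc w)" using a j by (intro compositions_add_unit) auto
    have sd: "swap_adj j ?d = add_composition a (unit_composition (Suc j))"
      using True by (auto simp: fun_eq_iff swap_parts_apply add_composition_def unit_composition_def)
    have "?d (Suc j) < ?d j" using True by (simp add: add_composition_def unit_composition_def)
    then have "demazure j (atom n (Suc w) ?d) (atom n (Suc w) ?d + atom n (Suc w) (swap_adj j ?d))"
      using atom_rule[OF j, of "Suc w"] d unfolding atom_rule_def by blast
    moreover have "atom n (Suc w) ?d = xvar j * monomial n a" using Suc.IH j by simp
    ultimately have "demazure j (xvar j * monomial n a)
        (xvar j * monomial n a + atom n (Suc w) (add_composition a (unit_composition (Suc j))))"
      unfolding sd by simp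
    moreover have "demazure j (xvar j * monomial n a) (xvar j * monomial n a + xvar (Suc j) * monomial n a)"
      using swap_vars_monomial[OF j True] by (intro demazure_xvar_mult demazure_of_symmetric)
    ultimately show ?thesis using demazure_unique by (metis add_left_cancel)
  qed
qed

lemma tail_count_add_unit:
  assumes "j \<in> {1..n}"
  shows "tail_count n (add_composition a (unit_composition j)) m t
    = tail_count n a m t + of_bool (m = Suc (a j) \<and> t \<le> j)"
proof -
  have "tail_count n (add_composition a (unit_composition j)) m t
    = (\<Sum>i=t..n. of_bool (m \<le> a i) + (if i = j then of_bool (m = Suc (a j)) else (0 :: int)))"
    unfolding tail_count_def
    by (rule sum.cong) (auto simp: add_composition_def unit_composition_def)
  also have "\<dots> = tail_count n a m t + (if j \<in> {t..n} then of_bool (m = Suc (a j)) else 0)"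
    unfolding sum.distrib by (subst sum.delta) (auto simp: tail_count_def)
  finally show ?thesis using assms by auto
qed

text \<open>Attaining the bound at \<open>j\<close> but not exceeding it at \<open>j + 1\<close>
  forces \<open>d j \<ge> c > a j\<close>. If \<open>c - 1\<close> also exceeded \<open>a j\<close>,
  then from row \<open>j\<close> on \<open>a\<close> would have no part that large while
  \<open>d\<close> has one. With \<open>c = Suc (a j)\<close> the totals bound the counts of
  \<open>d\<close> from below by those of the enlarged \<open>a\<close>.\<close>

lemma dominant_pieri_layer:
  assumes wc: "weak_composition n a" and a: "dominant n a" and j: "j \<in> {1..n}" and c: "1 \<le> c"
  shows "pieri_layer n a c j = (if c = Suc (a j) then {add_composition a (unit_composition j)} else {})"
proof -
  let ?e = "add_composition a (unit_composition j)"
  have e: "?e \<in> pieri_layer n a c j" if "c = Suc (a j)"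
    unfolding pieri_layer_def mem_Collect_eq
  proof
    show "?e \<in> pieri_region n a c j"
      using that j weak_composition_add_unit[OF wc j] by (intro pieri_regionI) (auto simp: tail_count_add_unit)
    show "tail_count n ?e c j = tail_count n a c j + 1" using that j by (simp add: tail_count_add_unit)
  qed
  have "c = Suc (a j) \<and> d = ?e" if d: "d \<in> pieri_layer n a c j" for d
  proof -
    have d': "d \<in> pieri_region n a c j" and eq: "tail_count n d c j = tail_count n a c j + 1"
      using d by (auto simp: pieri_layer_def)
    have jn: "1 \<le> j" "j \<le> n" using j by auto
    have "tail_count n d c (Suc j) \<le> tail_count n a c (Suc j)"
      using pieri_regionD(3)[OF d' c, of "Suc j"] by simp
    then have dj: "c \<le> d j" "\<not> c \<le> a j"
      using eq jn by (auto simp: tail_count_split[of j] of_bool_def split: if_splits)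
    have cj: "c = Suc (a j)"
    proof (rule ccontr)
      assume "c \<noteq> Suc (a j)"
      then have m: "1 \<le> c - 1" "\<not> c - 1 \<le> a j" "c - 1 \<noteq> c" "c - 1 \<le> d j" using dj by auto
      have "tail_count n a (c - 1) j = 0"
        using dominant_tail_count(2)[OF a jn(1), of "c - 1" j] m jn by blast
      then have "tail_count n d (c - 1) j \<le> 0"
        using pieri_regionD(3)[OF d' m(1) jn(1)] m(3) by simp
      moreover have "tail_count n d (c - 1) j = 1 + tail_count n d (c - 1) (Suc j)"
        using m(4) jn by (simp add: tail_count_split[of j])
      ultimately show False using tail_count_nonneg[of n d "c - 1" "Suc j"] by linarith
    qed
    have le: "tail_count n ?e m t \<le> tail_count n d m t" if m: "1 \<le> m" and t: "1 \<le> t" for m t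
    proof (cases "Suc n < t")
      case False
      have tot: "tail_count n d m 1 = tail_count n a m 1 + of_bool (m = c)"
        by (rule pieri_regionD(2)[OF d' m])
      show ?thesis
      proof (cases "tail_count n a m t = 0")
        case True
        have "1 \<le> tail_count n d c t" if "t \<le> j"
        proof -
          have "tail_count n d c t = (\<Sum>i=t..<j. of_bool (c \<le> d i)) + tail_count n d c j"
            using that jn by (intro tail_count_interval) auto
          moreover have "0 \<le> (\<Sum>i=t..<j. of_bool (c \<le> d i) :: int)" by (simp add: sum_nonneg)
          moreover have "1 \<le> tail_count n d c j" using eq by simp
          ultimately show ?thesis by linarith
        qed
        then show ?thesis using True cj j by (auto simp: tail_count_add_unit)
      next
        case False
        have "m \<noteq> c \<or> t \<le> j"
          using dominant_tail_count(2)[OF a t False, of j] dj(2) jn by (cases "t \<le> j") auto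
        then show ?thesis
          using dominant_tail_count(1)[OF a t False] tot cj j \<open>\<not> Suc n < t\<close>
            tail_count_total_le[of t n d m] t by (auto simp: tail_count_add_unit)
      qed
    qed simp
    have "d = ?e"
    proof (rule tail_count_eq_imp_eq[of n])
      show "weak_composition n d" by (rule pieri_regionD(1)[OF d' c])
      show "weak_composition n ?e" by (rule weak_composition_add_unit[OF wc j])
      fix m t :: nat assume m: "1 \<le> m" and t: "1 \<le> t"
      show "tail_count n d m t = tail_count n ?e m t"
        using le[OF m t] pieri_regionD(3)[OF d' m t] cj j by (simp add: tail_count_add_unit)
    qed
    then show ?thesis using cj by simp
  qed
  then show ?thesis using e by auto
qed

section \<open>Expanding the product into atoms\<close>

definition pieri_support :: "nat \<Rightarrow> nat \<Rightarrow> (nat \<Rightarrow> nat) \<Rightarrow> nat \<Rightarrow> (nat \<Rightarrow> nat) set" where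
  "pieri_support n w a k = (\<Union>c\<in>{1..w}. pieri_region n a c k)"

definition pieri_border :: "nat \<Rightarrow> nat \<Rightarrow> (nat \<Rightarrow> nat) \<Rightarrow> nat \<Rightarrow> (nat \<Rightarrow> nat) set" where
  "pieri_border n w a k = (\<Union>c\<in>{1..w}. pieri_layer n a c k)"

lemma pieri_support_subset:
  assumes "a \<in> compositions n w"
  shows "pieri_support n (Suc w) a k \<subseteq> compositions n (Suc w)"
  using pieri_region_compositions[OF assms] by (auto simp: pieri_support_def)

lemma pieri_border_subset:
  assumes "a \<in> compositions n w"
  shows "pieri_border n (Suc w) a k \<subseteq> compositions n (Suc w)"
  using pieri_region_compositions[OF assms] by (auto simp: pieri_border_def pieri_layer_def)

lemma pieri_layer_column_unique:
  "d \<in> pieri_layer n a c k \<Longrightarrow> d \<in> pieri_region n a c' k' \<Longrightarrow> 1 \<le> c \<Longrightarrow> c = c'"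
  "d \<in> pieri_layer n a c k \<Longrightarrow> d \<in> pieri_layer n a c' k' \<Longrightarrow> 1 \<le> c \<Longrightarrow> c = c'"
  using pieri_region_column_unique[of d n a c k c' k'] by (auto simp: pieri_layer_def)

text \<open>The layers of row \<open>k + 1\<close> are exactly the new compositions; different
  columns do not interfere because the totals reveal \<open>c\<close>.\<close>

lemma sum_pieri_support_Suc:
  assumes "a \<in> compositions n w"
  shows "sum f (pieri_support n (Suc w) a (Suc k))
    = sum f (pieri_support n (Suc w) a k) + sum f (pieri_border n (Suc w) a (Suc k))"
proof -
  have "pieri_support n (Suc w) a (Suc k) = pieri_support n (Suc w) a k \<union> pieri_border n (Suc w) a (Suc k)"
    using pieri_region_Suc(1)[of _ n a k] by (auto simp: pieri_support_def pieri_border_def)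
  moreover have "pieri_support n (Suc w) a k \<inter> pieri_border n (Suc w) a (Suc k) = {}"
  proof -
    have False if "d \<in> pieri_region n a c k" "d \<in> pieri_layer n a c' (Suc k)" "1 \<le> c" "1 \<le> c'" for d c c'
      using pieri_layer_column_unique(1)[OF that(2,1,4)] pieri_region_Suc(2)[OF that(3), of n a k] that by auto
    then show ?thesis by (fastforce simp: pieri_support_def pieri_border_def)
  qed
  ultimately show ?thesis
    using finite_subset[OF pieri_support_subset[OF assms] finite_compositions]
      finite_subset[OF pieri_border_subset[OF assms] finite_compositions]
    by (simp add: sum.union_disjoint)
qed

lemma schur1_Suc: "schur1 (Suc k) = schur1 k + xvar (Suc k)"
  by (simp add: schur1_def)

lemma pieri_support_0: "pieri_support n w a 0 = {}"
  by (auto simp: pieri_support_def pieri_region_0)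

text \<open>At an ascent \<open>i = k\<close> the argument uses the formula for the exchanged
  composition at \<open>k - 1\<close> and \<open>k\<close>, and the formula for \<open>a\<close>
  itself at \<open>k + 1\<close>; this is why \<open>k\<close> is generalized in the
  induction.\<close>

theorem key_poly_times_schur1:
  assumes "a \<in> compositions n w" "k \<le> n"
  shows "key_poly n a * schur1 k = (\<Sum>d\<in>pieri_support n (Suc w) a k. atom n (Suc w) d)"
  using assms
proof (induction "\<Sum>i=1..n. i * a i" arbitrary: a k rule: less_induct)
  case less
  let ?S = "\<lambda>X. \<Sum>d\<in>X. atom n (Suc w) d"
  have a: "a \<in> compositions n w" "weak_composition n a" using less.prems by (auto simp: compositions_def)
  show ?case
  proof (cases "\<exists>i. 1 \<le> i \<and> i < n \<and> a i < a (Suc i)")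
    case False
    then have dom: "dominant n a" by (intro dominantI) (meson not_less)
    show ?thesis using less.prems(2)
    proof (induction k)
      case 0
      then show ?case by (simp add: pieri_support_0 schur1_def)
    next
      case (Suc k)
      have j: "Suc k \<in> {1..n}" using Suc by auto
      have "a (Suc k) \<le> w" using a by (simp add: compositions_def)
      then have "pieri_border n (Suc w) a (Suc k) = {add_composition a (unit_composition (Suc k))}"
        using dominant_pieri_layer[OF a(2) dom j] by (auto simp: pieri_border_def split: if_splits)
      then show ?case
        using Suc sum_pieri_support_Suc[OF a(1), of "atom n (Suc w)" k] dominant_key_poly[OF dom]
          dominant_add_unit_atom[OF a(1) dom, of "Suc k"]
        by (simp add: schur1_Suc distrib_left mult.commute)
    qed
  next
    case True
    then obtain i where i: "1 \<le> i" "i < n" and asc: "a i < a (Suc i)" by blast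
    define b where "b = swap_adj i a"
    have bc: "b \<in> compositions n w" unfolding b_def using compositions_swap_parts[OF a(1)] i by simp
    have "(\<Sum>l=1..n. l * b l) < (\<Sum>l=1..n. l * a l)"
      unfolding b_def using i asc by (intro weighted_sum_swap_parts_less) auto
    then have IH: "key_poly n b * schur1 k = ?S (pieri_support n (Suc w) b k)" if "k \<le> n" for k
      using less.hyps[of b k] bc that by simp
    have cS: "compositions n w \<subseteq> compositions n (Suc w)" by (rule compositions_mono) simp
    have dem: "demazure i (?S X) (\<Sum>d | d \<in> compositions n (Suc w) \<and> sort_adj i d \<in> X. atom n (Suc w) d)"
      if "X \<subseteq> compositions n (Suc w)" for X
      by (rule demazure_sum_atoms[OF atom_rule[OF i] i that])
    have key: "demazure i (key_poly n b) (key_poly n a)"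
    proof -
      have "{d. d \<in> compositions n (Suc w) \<and> sort_adj i d \<in> {d. bruhat_le n d b}} = {d. bruhat_le n d a}"
        using bruhat_le_sort_adj[OF i, of a] asc bruhat_le_compositions[of n _ a "Suc w"] a cS
        by (auto simp: b_def)
      moreover have ab: "a \<in> compositions n (Suc w)" "b \<in> compositions n (Suc w)" using a bc cS by auto
      then have "{d. bruhat_le n d b} \<subseteq> compositions n (Suc w)" using bruhat_le_compositions by blast
      ultimately show ?thesis
        using dem[of "{d. bruhat_le n d b}"] key_poly_eq_sum_atoms[OF ab(1)] key_poly_eq_sum_atoms[OF ab(2)] by simp
    qed
    have main: "key_poly n a * schur1 k = ?S (pieri_support n (Suc w) a k)" if k: "k \<le> n" "k \<noteq> i" for k
    proof -
      have "demazure i (key_poly n b * schur1 k) (key_poly n a * schur1 k)"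
        using demazure_mult[OF swap_vars_schur1[OF k(2) i(1)] key] by (simp add: mult.commute)
      moreover have "{d. d \<in> compositions n (Suc w) \<and> sort_adj i d \<in> pieri_support n (Suc w) b k} = pieri_support n (Suc w) a k"
        using pieri_region_sort_adj[OF i k(2)[symmetric], of a] asc pieri_support_subset[OF a(1), of k]
        by (auto simp: b_def pieri_support_def)
      then have "demazure i (?S (pieri_support n (Suc w) b k)) (?S (pieri_support n (Suc w) a k))"
        using dem[OF pieri_support_subset[OF bc, of k]] by simp
      ultimately show ?thesis using IH[OF k(1)] demazure_unique by metis
    qed
    show ?thesis
    proof (cases "k = i")
      case False
      then show ?thesis using main less.prems(2) by simp
    next
      case True
      obtain k' where k': "k = Suc k'" using i True by (cases k) auto
      \<comment> \<open>Subtracting two consecutive formulas for \<open>b\<close> isolates the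
        single variable x_k.\<close>
      have "?S (pieri_border n (Suc w) b k) = ?S (pieri_support n (Suc w) b k) - ?S (pieri_support n (Suc w) b k')"
        using sum_pieri_support_Suc[OF bc, of "atom n (Suc w)" k'] k' by simp
      also have "\<dots> = key_poly n b * schur1 k - key_poly n b * schur1 k'"
        using IH[of k] IH[of k'] i True k' by simp
      also have "\<dots> = xvar k * key_poly n b"
        by (simp add: k' schur1_Suc algebra_simps)
      finally have border_b: "?S (pieri_border n (Suc w) b k) = xvar k * key_poly n b" .
      have layer: "sort_adj i d \<in> pieri_layer n b c k \<longleftrightarrow> d \<in> pieri_layer n b c k \<or> d \<in> pieri_layer n a c (Suc k)"
        if "1 \<le> c" for d c
        unfolding b_def True by (rule pieri_layer_sort_adj(1)[OF i asc that])
      have "sort_adj i d \<in> pieri_border n (Suc w) b k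
          \<longleftrightarrow> d \<in> pieri_border n (Suc w) b k \<or> d \<in> pieri_border n (Suc w) a (Suc k)" for d
      proof -
        have "(\<exists>c\<in>{1..Suc w}. sort_adj i d \<in> pieri_layer n b c k)
          \<longleftrightarrow> (\<exists>c\<in>{1..Suc w}. d \<in> pieri_layer n b c k \<or> d \<in> pieri_layer n a c (Suc k))"
          by (rule bex_cong[OF refl layer]) simp
        then show ?thesis unfolding pieri_border_def UN_iff by blast
      qed
      then have "{d. d \<in> compositions n (Suc w) \<and> sort_adj i d \<in> pieri_border n (Suc w) b k}
        = pieri_border n (Suc w) b k \<union> pieri_border n (Suc w) a (Suc k)"
        using pieri_border_subset[OF a(1), of "Suc k"] pieri_border_subset[OF bc, of k] by blast
      moreover have "pieri_border n (Suc w) b k \<inter> pieri_border n (Suc w) a (Suc k) = {}"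
      proof -
        have "False" if d: "d \<in> pieri_layer n b c k" "d \<in> pieri_layer n a c' (Suc k)" "1 \<le> c" "1 \<le> c'" for d c c'
        proof -
          have "tail_count n b m 1 = tail_count n a m 1" for m
            unfolding b_def using i by (simp add: tail_count_swap_adj)
          then have "c = c'"
            using pieri_regionD(2)[of d n b c k c] pieri_regionD(2)[of d n a c' "Suc k" c] d
            by (auto simp: pieri_layer_def split: if_splits)
          then show False using pieri_layer_sort_adj(2)[OF i asc d(3)] d True unfolding b_def by auto
        qed
        then show ?thesis by (fastforce simp: pieri_border_def)
      qed
      ultimately have "demazure i (?S (pieri_border n (Suc w) b k))
        (?S (pieri_border n (Suc w) b k) + ?S (pieri_border n (Suc w) a (Suc k)))"
        using dem[OF pieri_border_subset[OF bc, of k]]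
          finite_subset[OF pieri_border_subset[OF bc] finite_compositions]
          finite_subset[OF pieri_border_subset[OF a(1)] finite_compositions]
        by (simp add: sum.union_disjoint)
      moreover have "demazure i (xvar i * key_poly n b) (xvar i * key_poly n b + xvar (Suc i) * key_poly n a)"
        by (rule demazure_xvar_mult[OF key])
      ultimately have "?S (pieri_border n (Suc w) b k) + ?S (pieri_border n (Suc w) a (Suc k))
          = xvar i * key_poly n b + xvar (Suc i) * key_poly n a"
        unfolding border_b unfolding True by (rule demazure_unique)
      \<comment> \<open>Both sides are \<pi>_i (x_i \<kappa>_b); cancelling x_i \<kappa>_b leaves
        x_(i+1) \<kappa>_a.\<close>
      then have border_a: "?S (pieri_border n (Suc w) a (Suc k)) = xvar (Suc k) * key_poly n a"
        unfolding border_b unfolding True by (rule add_left_imp_eq)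
      have "key_poly n a * schur1 (Suc k) = ?S (pieri_support n (Suc w) a (Suc k))"
        using main[of "Suc k"] i True by simp
      then show ?thesis
        using sum_pieri_support_Suc[OF a(1), of "atom n (Suc w)" k] border_a
        by (simp add: schur1_Suc algebra_simps)
    qed
  qed
qed

section \<open>Addable rows\<close>

text \<open>\<open>drops a c r m t\<close>: passing from \<open>a\<close> to \<open>supp\<^sup>(\<^sup>c\<^sup>,\<^sup>r\<^sup>) + e\<^sub>r\<close> lowers the number of parts \<open>\<ge> m\<close>
  in the rows \<open>\<ge> t\<close>.\<close>

definition drops :: "(nat \<Rightarrow> nat) \<Rightarrow> nat \<Rightarrow> nat \<Rightarrow> nat \<Rightarrow> nat \<Rightarrow> bool" where
  "drops a c r m t \<longleftrightarrow> r < t \<and> m < c \<and> (\<forall>s. r \<le> s \<and> s < t \<longrightarrow> \<not> (m \<le> a s \<and> a s < c))"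

definition row_region :: "nat \<Rightarrow> (nat \<Rightarrow> nat) \<Rightarrow> nat \<Rightarrow> nat \<Rightarrow> (nat \<Rightarrow> nat) set" where
  "row_region n a c r = region n (\<lambda>m. tail_count n a m 1 + of_bool (m = c))
     (\<lambda>m t. tail_count n a m t + of_bool (m = c \<and> t \<le> r) - of_bool (drops a c r m t))"

lemma row_region_subset:
  assumes "r \<le> k"
  shows "row_region n a c r \<subseteq> pieri_region n a c k"
proof
  fix d assume d: "d \<in> row_region n a c r"
  have "tail_count n d m t \<le> tail_count n a m t + of_bool (m = c \<and> t \<le> k)" if "1 \<le> m" "1 \<le> t" for m t
  proof -
    have "tail_count n d m t \<le> tail_count n a m t + of_bool (m = c \<and> t \<le> r) - of_bool (drops a c r m t)"
      using d that by (auto simp: row_region_def region_def)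
    moreover have "(of_bool (m = c \<and> t \<le> r) :: int) \<le> of_bool (m = c \<and> t \<le> k)" using assms by auto
    ultimately show ?thesis by (auto simp: of_bool_def split: if_splits)
  qed
  then show "d \<in> pieri_region n a c k"
    using d by (auto simp: row_region_def pieri_region_def region_def)
qed

text \<open>Let \<open>r0\<close> be the last row from which \<open>d\<close> has more parts
  \<open>\<ge> c\<close> than \<open>a\<close>; the conditions of \<open>row_region\<close> hold for
  it, but it may fail to be addable. Passing to the last row \<open>r\<close> with the largest part
  below \<open>c\<close> among rows \<open>r0\<close> to \<open>k\<close> gives an addable row and
  only weakens the conditions.\<close>

lemma pieri_region_in_row_region:
  assumes d: "d \<in> pieri_region n a c k" and wa: "weak_composition n a" and c: "1 \<le> c" and k: "k \<le> n"
  obtains r where "r \<in> Row n a k c" "d \<in> row_region n a c r"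
proof -
  note bound = pieri_regionD(3)[OF d]
  define X where "X = {t. 1 \<le> t \<and> tail_count n d c t = tail_count n a c t + 1}"
  have Xk: "t \<le> k" if "t \<in> X" for t
    using that bound[OF c, of t] by (auto simp: X_def of_bool_def split: if_splits)
  have "X \<subseteq> {..k}" using Xk by auto
  then have X: "finite X" "1 \<in> X"
    using pieri_regionD(2)[OF d c] finite_subset[of X "{..k}"] by (simp_all add: X_def)
  define r0 where "r0 = Max X"
  have r0X: "r0 \<in> X" unfolding r0_def using X by (intro Max_in) auto
  have r0: "1 \<le> r0" "r0 \<le> k" "r0 \<le> n" "tail_count n d c r0 = tail_count n a c r0 + 1"
    using r0X Xk[OF r0X] k by (auto simp: X_def)
  have above: "tail_count n d c t \<le> tail_count n a c t" if "r0 < t" for t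
  proof -
    have "t \<notin> X" using Max_ge[OF X(1), of t] that by (auto simp: r0_def)
    then have "tail_count n d c t \<noteq> tail_count n a c t + 1" using that by (auto simp: X_def)
    then show ?thesis using bound[OF c, of t] that by (auto simp: of_bool_def split: if_splits)
  qed
  have ar0: "a r0 < c"
  proof (rule ccontr)
    assume "\<not> a r0 < c"
    then show False using above[of "Suc r0"] r0 by (auto simp: tail_count_split[of r0] of_bool_def split: if_splits)
  qed
  \<comment> \<open>In rows \<open>r0\<close> to \<open>t - 1\<close> the counts of \<open>a\<close>
    at thresholds \<open>m\<close> and \<open>c\<close> agree, and \<open>d\<close> has at least one
    more part \<open>\<ge> c\<close> there, hence also one more part \<open>\<ge> m\<close>. Not
    being ahead of \<open>a\<close> at \<open>r0\<close> for threshold \<open>m\<close>,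
    \<open>d\<close> must be behind at \<open>t\<close>.\<close>
  have key0: "tail_count n d m t + 1 \<le> tail_count n a m t" if "drops a c r0 m t" "1 \<le> m" "t \<le> Suc n" for m t
  proof -
    have t: "r0 < t" "m < c" and no: "\<And>s. r0 \<le> s \<Longrightarrow> s < t \<Longrightarrow> \<not> (m \<le> a s \<and> a s < c)"
      using that by (auto simp: drops_def)
    let ?S = "\<lambda>x m. (\<Sum>s=r0..<t. of_bool (m \<le> x s) :: int)"
    have split: "tail_count n x m' r0 = ?S x m' + tail_count n x m' t" for x m'
      using t that by (intro tail_count_interval) auto
    have "?S a m = ?S a c"
    proof (rule sum.cong)
      fix s assume "s \<in> {r0..<t}"
      then have "m \<le> a s \<Longrightarrow> c \<le> a s" using no[of s] by auto
      then show "of_bool (m \<le> a s) = (of_bool (c \<le> a s) :: int)" using t by auto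
    qed simp
    moreover have "?S d c \<le> ?S d m" using t by (intro sum_mono) auto
    moreover have "tail_count n d m r0 \<le> tail_count n a m r0" using bound[OF that(2) r0(1)] t by simp
    ultimately show ?thesis
      using above[OF t(1)] r0(4) split[of d m] split[of a m] split[of d c] split[of a c] by linarith
  qed
  have key: "tail_count n d m t + 1 \<le> tail_count n a m t" if "drops a c r0 m t" "1 \<le> m" for m t
  proof (cases "t \<le> Suc n")
    case False
    then have "drops a c r0 m (Suc n)" using that r0 by (auto simp: drops_def)
    from key0[OF this that(2)] show ?thesis by simp
  qed (use key0 that in blast)
  define J where "J = {s. r0 \<le> s \<and> s \<le> k \<and> a s < c}"
  have J: "finite J" "r0 \<in> J" using r0 ar0 by (auto simp: J_def)
  define M where "M = Max (a ` J)"
  have M: "a s \<le> M" if "s \<in> J" for s using that J by (simp add: M_def)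
  define r where "r = Max {s \<in> J. a s = M}"
  have "M \<in> a ` J" unfolding M_def using J by (intro Max_in) auto
  then have "{s \<in> J. a s = M} \<noteq> {}" by auto
  then have "r \<in> {s \<in> J. a s = M}" unfolding r_def using J by (intro Max_in) auto
  then have r: "r0 \<le> r" "r \<le> k" "a r < c" "a r = M" by (auto simp: J_def)
  have after: "a s < a r" if "s \<in> J" "r < s" for s
  proof -
    have "a s \<noteq> M"
    proof
      assume "a s = M"
      then have "s \<le> r" unfolding r_def using J that by (intro Max_ge) auto
      then show False using that by simp
    qed
    then show ?thesis using M[OF that(1)] r by simp
  qed
  have drops: "drops a c r0 m t" if "drops a c r m t" for m t
    unfolding drops_def
  proof (intro conjI allI impI)
    show "r0 < t" "m < c" using that r by (auto simp: drops_def)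
    fix s assume s: "r0 \<le> s \<and> s < t"
    show "\<not> (m \<le> a s \<and> a s < c)"
    proof (cases "r \<le> s")
      case True
      then show ?thesis using that s by (auto simp: drops_def)
    next
      case False
      have "\<not> m \<le> a r" using that r by (auto simp: drops_def)
      moreover have "a s \<le> a r" if "a s < c" using M[of s] r s False that by (simp add: J_def)
      ultimately show ?thesis by auto
    qed
  qed
  have "r \<in> Row n a k c"
    unfolding Row_def k_addable_def mem_Collect_eq
  proof (intro conjI impI allI)
    show "1 \<le> r" "r \<le> k" "a r < c" using r r0 by auto
    show "a i < a r \<or> c \<le> a i" if "r < i \<and> i \<le> k" for i
      using after[of i] that r by (auto simp: J_def)
    assume lt: "a r < c - 1"
    \<comment> \<open>Otherwise \<open>c - 1\<close> does not occur from row \<open>r0\<close> on,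
      and the slack at threshold \<open>c - 1\<close> would make the empty count beyond row
      \<open>n\<close> negative.\<close>
    show "\<exists>l. k < l \<and> l \<le> n \<and> a l = c - 1"
    proof (rule ccontr)
      assume none: "\<not> ?thesis"
      have "drops a c r0 (c - 1) (Suc n)"
        unfolding drops_def
      proof (intro conjI allI impI)
        show "r0 < Suc n" "c - 1 < c" using r0 c by auto
        fix s assume s: "r0 \<le> s \<and> s < Suc n"
        show "\<not> (c - 1 \<le> a s \<and> a s < c)"
        proof
          assume as: "c - 1 \<le> a s \<and> a s < c"
          then have "s \<le> k" using none s by (metis Suc_leI diff_Suc_1 less_Suc_eq_le not_le le_antisym Suc_pred' c One_nat_def)
          then have "s \<in> J" using s as by (simp add: J_def)
          then show False using M[of s] r lt as by simp
        qed
      qed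
      then show False using key[of "c - 1" "Suc n"] lt by simp
    qed
  qed
  moreover have "d \<in> row_region n a c r"
  proof -
    have "tail_count n d m t \<le> tail_count n a m t + of_bool (m = c \<and> t \<le> r) - of_bool (drops a c r m t)"
      if m: "1 \<le> m" and t: "1 \<le> t" for m t
    proof (cases "m = c")
      case True
      then have "\<not> drops a c r m t" by (simp add: drops_def)
      then show ?thesis using True bound[OF m t] above[of t] r by (cases "t \<le> r") auto
    next
      case False
      then show ?thesis using bound[OF m t] key[OF drops[of m t] m] False by (cases "drops a c r m t") auto
    qed
    then show ?thesis
      unfolding row_region_def region_def mem_Collect_eq
      using pieri_regionD(1)[OF d c] pieri_regionD(2)[OF d] by blast
  qed
  ultimately show ?thesis using that by blast
qed

lemma finite_Row: "finite (Row n a k c)"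
  by (rule finite_subset[of _ "{1..k}"]) (auto simp: Row_def k_addable_def)

lemma pieri_region_eq_Union:
  assumes "weak_composition n a" "1 \<le> c" "k \<le> n"
  shows "pieri_region n a c k = (\<Union>r\<in>Row n a k c. row_region n a c r)"
proof
  show "pieri_region n a c k \<subseteq> (\<Union>r\<in>Row n a k c. row_region n a c r)"
  proof
    fix d assume "d \<in> pieri_region n a c k"
    from pieri_region_in_row_region[OF this assms] show "d \<in> (\<Union>r\<in>Row n a k c. row_region n a c r)"
      by blast
  qed
  have "row_region n a c r \<subseteq> pieri_region n a c k" if "r \<in> Row n a k c" for r
    by (rule row_region_subset) (use that in \<open>simp add: Row_def k_addable_def\<close>)
  then show "(\<Union>r\<in>Row n a k c. row_region n a c r) \<subseteq> pieri_region n a c k" by blast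
qed

section \<open>Cyclic shifts along chains of rows\<close>

lemma swap_chain_append:
  "swap_chain (xs @ r # ys) a = swap_chain (xs @ [r]) (swap_chain (r # ys) a)"
  by (induction xs rule: induct_list012) auto

lemma swap_chain_outside: "l \<notin> set L \<Longrightarrow> swap_chain L a l = a l"
  by (induction L a rule: swap_chain.induct) (auto simp: swap_parts_apply)

lemma swap_chain_hd: "L \<noteq> [] \<Longrightarrow> swap_chain L a (hd L) = a (last L)"
  by (induction L a rule: swap_chain.induct) (auto simp: swap_parts_apply)

lemma weak_composition_swap_chain:
  "set L \<subseteq> {1..n} \<Longrightarrow> weak_composition n a \<Longrightarrow> weak_composition n (swap_chain L a)"
  by (induction L a rule: swap_chain.induct) (auto intro: weak_composition_swap_parts)

text \<open>The change of the counts at \<open>t\<close> under a cyclic shift depends only on the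
  chain row preceding \<open>t\<close>.\<close>

definition last_below :: "nat set \<Rightarrow> nat \<Rightarrow> nat \<Rightarrow> bool" where
  "last_below S t s \<longleftrightarrow> s \<in> S \<and> s < t \<and> (\<forall>s'\<in>S. s' < t \<longrightarrow> s' \<le> s)"

text \<open>Adding the box after the cyclic shift only changes which part is the first one of the chain,
  so each further factor of the shift is an exchange of two parts of the enlarged composition.\<close>

lemma tail_count_swap_chain:
  assumes "sorted_wrt (<) L" "L \<noteq> []" "set L \<subseteq> {1..n}" "\<And>s. s \<in> set L \<Longrightarrow> a s < c" "Suc (a (last L)) = c"
  shows "tail_count n (add_composition (swap_chain L a) (unit_composition (hd L))) m t
    = tail_count n a m t + of_bool (m = c \<and> t \<le> hd L)
      - of_bool (\<exists>s. last_below (set L) t s \<and> a s < m \<and> m < c)"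
  using assms
proof (induction L a rule: swap_chain.induct)
  case (1 i j rs a)
  let ?y = "add_composition (swap_chain (j # rs) a) (unit_composition j)"
  have ij: "i < j" "i \<notin> set (j # rs)" "1 \<le> i" "j \<le> n" using "1.prems" by auto
  have y: "?y i = a i" "?y j = c"
    using ij swap_chain_outside[of i "j # rs" a] swap_chain_hd[of "j # rs" a] "1.prems"
    by (simp_all add: add_composition_def unit_composition_def)
  have "add_composition (swap_chain (i # j # rs) a) (unit_composition i) = swap_parts i j ?y"
    using ij by (auto simp: fun_eq_iff swap_parts_apply add_composition_def unit_composition_def)
  then have "tail_count n (add_composition (swap_chain (i # j # rs) a) (unit_composition i)) m t
    = tail_count n ?y m t - of_bool (i < t \<and> t \<le> j \<and> a i < m \<and> m \<le> c)"
    using tail_count_swap_parts[of i j n ?y m t] ij y "1.prems" by simp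
  also have "tail_count n ?y m t = tail_count n a m t + of_bool (m = c \<and> t \<le> j)
      - of_bool (\<exists>s. last_below (set (j # rs)) t s \<and> a s < m \<and> m < c)"
    using "1.IH" "1.prems" by simp
  also have "(\<exists>s. last_below (set (i # j # rs)) t s \<and> a s < m \<and> m < c) \<longleftrightarrow>
    (i < t \<and> t \<le> j \<and> a i < m \<and> m < c) \<or> (\<exists>s. last_below (set (j # rs)) t s \<and> a s < m \<and> m < c)"
  proof (cases "t \<le> j")
    case True
    then have "last_below (set (i # j # rs)) t s \<longleftrightarrow> s = i \<and> i < t" "\<not> last_below (set (j # rs)) t s" for s
      using "1.prems"(1) by (auto simp: last_below_def)
    then show ?thesis using True by auto
  next
    case False
    then have "last_below (set (i # j # rs)) t s \<longleftrightarrow> last_below (set (j # rs)) t s" for s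
      using "1.prems"(1) ij by (auto simp: last_below_def)
    then show ?thesis using False by auto
  qed
  moreover have "\<not> last_below (set (j # rs)) t s" if "t \<le> j" for s
    using that "1.prems"(1) by (auto simp: last_below_def)
  moreover have "a i < c" using "1.prems" by simp
  ultimately show ?case using ij
    by (cases "t \<le> j"; cases "i < t"; cases "m = c") (auto simp: of_bool_def)
next
  case (2 i a)
  then show ?case by (auto simp: tail_count_add_unit last_below_def)
qed simp

text \<open>The chain lists the successive records among the parts below \<open>c\<close>, starting
  at row \<open>r\<close>. So the last chain row before \<open>t\<close> carries the largest such
  part seen so far, which is the link to \<open>drops\<close>.\<close>

lemma supp_rows_props:
  assumes "a r < c" "1 \<le> r" "r \<le> n"
  shows "sorted_wrt (<) (supp_rows n a c r) \<and> hd (supp_rows n a c r) = r \<and> supp_rows n a c r \<noteq> [] \<and>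
    set (supp_rows n a c r) \<subseteq> {r..n} \<and> (\<forall>s\<in>set (supp_rows n a c r). a s < c) \<and>
    (\<forall>t>r. \<exists>s. last_below (set (supp_rows n a c r)) t s \<and> (\<forall>u. r \<le> u \<and> u < t \<and> u \<le> n \<and> a u < c \<longrightarrow> a u \<le> a s))"
  using assms
proof (induction n a c r rule: supp_rows.induct)
  case (1 n a c r)
  let ?P = "\<lambda>s. r < s \<and> s \<le> n \<and> a r < a s \<and> a s \<le> c - 1"
  show ?case
  proof (cases "\<exists>s. ?P s")
    case False
    then have L: "supp_rows n a c r = [r]" by (subst supp_rows.simps) auto
    have "last_below {r} t r" if "r < t" for t using that by (simp add: last_below_def)
    moreover have "a u \<le> a r" if "r \<le> u" "u \<le> n" "a u < c" for u
      using that False by (cases "u = r") (auto simp: not_less)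
    ultimately show ?thesis using "1.prems" unfolding L by auto
  next
    case True
    define r' where "r' = (LEAST s. ?P s)"
    have r': "?P r'" unfolding r'_def using True by (rule LeastI_ex)
    have least: "\<not> ?P s" if "s < r'" for s using not_less_Least[of s ?P] that by (simp add: r'_def)
    have L: "supp_rows n a c r = r # supp_rows n a c r'"
      using True by (subst supp_rows.simps) (simp add: r'_def)
    define S where "S = supp_rows n a c r'"
    have "a r' < c" using r' "1.prems" by auto
    then have IH: "sorted_wrt (<) S" "set S \<subseteq> {r'..n}" "\<forall>s\<in>set S. a s < c"
      "\<And>t. r' < t \<Longrightarrow> \<exists>s. last_below (set S) t s \<and> (\<forall>u. r' \<le> u \<and> u < t \<and> u \<le> n \<and> a u < c \<longrightarrow> a u \<le> a s)"
      using "1.IH"[OF True] r' "1.prems" unfolding S_def r'_def[symmetric] by auto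
    have "\<exists>s. last_below (set (r # S)) t s \<and> (\<forall>u. r \<le> u \<and> u < t \<and> u \<le> n \<and> a u < c \<longrightarrow> a u \<le> a s)"
      if t: "r < t" for t
    proof (cases "t \<le> r'")
      case True
      have "last_below (set (r # S)) t r" using t True IH(2) by (fastforce simp: last_below_def)
      moreover have "a u \<le> a r" if "r \<le> u" "u < t" "u \<le> n" "a u < c" for u
        using least[of u] that True by (cases "u = r") (auto simp: not_less)
      ultimately show ?thesis by blast
    next
      case False
      then obtain s where s: "last_below (set S) t s" "\<And>u. r' \<le> u \<Longrightarrow> u < t \<Longrightarrow> u \<le> n \<Longrightarrow> a u < c \<Longrightarrow> a u \<le> a s"
        using IH(4)[of t] by (auto simp: not_le)
      have "r \<le> s" using s(1) IH(2) r' by (fastforce simp: last_below_def)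
      then have "last_below (set (r # S)) t s" using s(1) by (auto simp: last_below_def)
      moreover have "a u \<le> a s" if u: "r \<le> u" "u < t" "u \<le> n" "a u < c" for u
      proof (cases "r' \<le> u")
        case True
        then show ?thesis using s(2) u by simp
      next
        case less: False
        then have "a u \<le> a r" using least[of u] u by (cases "u = r") (auto simp: not_less)
        also have "\<dots> \<le> a r'" using r' by simp
        also have "\<dots> \<le> a s" using s(2)[of r'] r' False \<open>a r' < c\<close> by simp
        finally show ?thesis .
      qed
      ultimately show ?thesis by blast
    qed
    then show ?thesis using IH(1-3) r' "1.prems" unfolding L S_def[symmetric]
      by (auto simp: subset_iff)
  qed
qed

lemma RowD:
  assumes "r \<in> Row n a k c"
  shows "1 \<le> r" "r \<le> k" "a r < c" "\<And>i. r < i \<Longrightarrow> i \<le> k \<Longrightarrow> a i < c \<Longrightarrow> a i < a r"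
  using assms by (force simp: Row_def k_addable_def)+

lemma Row_ex_part:
  assumes "r \<in> Row n a k c" "k \<le> n"
  obtains l where "r \<le> l" "l \<le> n" "Suc (a l) = c"
proof (cases "a r < c - 1")
  case True
  then obtain l where "k < l" "l \<le> n" "a l = c - 1" using assms by (auto simp: Row_def k_addable_def)
  then show ?thesis using that[of l] RowD(2)[OF assms(1)] True by simp
next
  case False
  then show ?thesis using that[of r] RowD[OF assms(1)] assms(2) by simp
qed

abbreviation pieri_term :: "nat \<Rightarrow> (nat \<Rightarrow> nat) \<Rightarrow> nat \<Rightarrow> nat set \<Rightarrow> nat \<Rightarrow> nat" where
  "pieri_term n a c R \<equiv> add_composition (drop_composition n a c R) (unit_composition (Min R))"

text \<open>The rows of \<open>R\<close> below \<open>Max R\<close>, followed by the chain of the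
  maximal support composition at \<open>Max R\<close>, form one increasing list \<open>L\<close>.
  The drop composition is thus a single cyclic shift, and it remains to express the chain row
  preceding \<open>t\<close> through \<open>drops\<close>.\<close>

lemma pieri_term_props:
  assumes wa: "weak_composition n a" and k: "k \<le> n" and R: "R \<subseteq> Row n a k c" "R \<noteq> {}"
  shows "weak_composition n (pieri_term n a c R)"
    "1 \<le> m \<Longrightarrow> tail_count n (pieri_term n a c R) m t
      = tail_count n a m t + of_bool (m = c \<and> t \<le> Min R) - of_bool (\<exists>r\<in>R. drops a c r m t)"
proof -
  have fin: "finite R" using R finite_Row finite_subset by blast
  define r0 where "r0 = Max R"
  have r0_ge: "r \<le> r0" if "r \<in> R" for r
    using fin that by (simp add: r0_def)
  have "r0 \<in> R" unfolding r0_def by (rule Max_in[OF fin R(2)])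
  then have r0: "r0 \<in> R" "r0 \<in> Row n a k c" using R(1) by auto
  note r0D = RowD[OF r0(2)]
  define S where "S = supp_rows n a c r0"
  have S: "sorted_wrt (<) S" "hd S = r0" "S \<noteq> []" "set S \<subseteq> {r0..n}" "\<And>s. s \<in> set S \<Longrightarrow> a s < c"
    "\<And>t. r0 < t \<Longrightarrow> \<exists>s. last_below (set S) t s \<and> (\<forall>u. r0 \<le> u \<and> u < t \<and> u \<le> n \<and> a u < c \<longrightarrow> a u \<le> a s)"
  proof -
    have "r0 \<le> n" using r0D(2) k by simp
    note * = supp_rows_props[of a r0 c n, OF r0D(3,1) this, folded S_def]
    show "sorted_wrt (<) S" "hd S = r0" "S \<noteq> []" "set S \<subseteq> {r0..n}" "\<And>s. s \<in> set S \<Longrightarrow> a s < c"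
      using * by blast+
    show "\<exists>s. last_below (set S) t s \<and> (\<forall>u. r0 \<le> u \<and> u < t \<and> u \<le> n \<and> a u < c \<longrightarrow> a u \<le> a s)"
      if "r0 < t" for t using * that by blast
  qed
  obtain S' where S': "S = r0 # S'" using S(2,3) by (cases S) auto
  define Q where "Q = sorted_list_of_set (R - {r0})"
  have Q: "sorted_wrt (<) Q" "set Q = R - {r0}" using fin by (auto simp: Q_def)
  have list: "sorted_list_of_set R = Q @ [r0]"
  proof (rule sorted_distinct_set_unique)
    show "sorted (Q @ [r0])" "distinct (Q @ [r0])"
      using r0_ge Q fin by (auto simp: sorted_append Q_def)
  qed (use fin r0 Q in auto)
  define L where "L = Q @ S"
  have drop: "drop_composition n a c R = swap_chain L a"
    unfolding drop_composition_def supp_def L_def list r0_def[symmetric] S_def[symmetric]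
    using swap_chain_append[of Q r0 S' a] S' by simp
  have setL: "set L = R \<union> set S" using Q(2) S' r0 by (auto simp: L_def)
  have less: "r < r0" if "r \<in> R - {r0}" for r using r0_ge[of r] that by auto
  have Lsorted: "sorted_wrt (<) L"
    unfolding L_def sorted_wrt_append using Q S(1,4) less by fastforce
  have Lne: "L \<noteq> []" using S(3) by (simp add: L_def)
  have Rn: "R \<subseteq> {1..n}" using R RowD(1,2) k by fastforce
  have Ln: "set L \<subseteq> {1..n}" unfolding setL using Rn S(4) r0D(1) by auto
  have Lc: "a s < c" if "s \<in> set L" for s using that R RowD(3) S(5) unfolding setL by blast
  have hdL: "hd L = Min R"
  proof (cases Q)
    case Nil
    then have "R = {r0}" using Q(2) r0 by auto
    then show ?thesis using Nil S(2) by (simp add: L_def)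
  next
    case (Cons x xs)
    have "\<forall>y\<in>R. x \<le> y" using Cons Q less r0 by (metis insertE insert_Diff less_imp_le list.set_intros(1) order_refl set_ConsD sorted_wrt.simps(2))
    moreover have "x \<in> R" using Cons Q(2) by auto
    ultimately have "Min R = x" using fin by (intro Min_eqI) auto
    then show ?thesis using Cons by (simp add: L_def)
  qed
  \<comment> \<open>The record property at \<open>t = Suc n\<close> makes the last part of the chain
    the largest one below \<open>c\<close>, and addability provides a part equal to
    \<open>c - 1\<close>.\<close>
  have lastL: "Suc (a (last L)) = c"
  proof -
    obtain l where l: "r0 \<le> l" "l \<le> n" "Suc (a l) = c" using Row_ex_part[OF r0(2) k] .
    obtain s where s: "last_below (set S) (Suc n) s" "\<forall>u. r0 \<le> u \<and> u < Suc n \<and> u \<le> n \<and> a u < c \<longrightarrow> a u \<le> a s"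
      using S(6)[of "Suc n"] r0D k by auto
    have "last S \<in> set S" using S(3) by simp
    then have "last S \<le> s" using s(1) S(4) by (fastforce simp: last_below_def)
    moreover have "s \<le> last S"
    proof -
      have "s \<in> set (butlast S) \<or> s = last S" using s(1) S(3)
        by (metis Un_iff append_butlast_last_id last_below_def set_append empty_iff insert_iff list.set)
      moreover have "s < last S" if "s \<in> set (butlast S)"
        using that S(1,3) by (metis append_butlast_last_id list.set_intros(1) sorted_wrt_append)
      ultimately show ?thesis by auto
    qed
    ultimately have "s = last S" by simp
    then have "a l \<le> a (last S)" using s(2) l by auto
    moreover have "a (last S) < c" using S(5) \<open>last S \<in> set S\<close> by blast
    ultimately show ?thesis using l S(3) by (simp add: L_def)
  qed
  show "weak_composition n (pieri_term n a c R)"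
  proof -
    have "Min R \<in> {1..n}" using hd_in_set[OF Lne] Ln unfolding hdL by blast
    then show ?thesis
      unfolding drop by (intro weak_composition_add_unit weak_composition_swap_chain[OF Ln wa])
  qed
  assume m: "1 \<le> m"
  have "(\<exists>s. last_below (set L) t s \<and> a s < m \<and> m < c) \<longleftrightarrow> (\<exists>r\<in>R. drops a c r m t)"
  proof (cases "\<exists>r\<in>R. r < t")
    case False
    then have "\<not> last_below (set L) t s" for s
      unfolding setL last_below_def using S(4) r0 by fastforce
    then show ?thesis using False by (auto simp: drops_def)
  next
    case True
    text \<open>Between the rows of the chain, parts below \<open>c\<close> never exceed the last chain entry.\<close>
    have "\<exists>s p. last_below (set L) t s \<and> p \<in> R \<and> p \<le> s \<and> (\<forall>r\<in>R. r < t \<longrightarrow> r \<le> s) \<and>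
        (\<forall>u. p \<le> u \<and> u < t \<and> u \<le> n \<and> a u < c \<longrightarrow> a u \<le> a s)"
    proof (cases "r0 < t")
      case True
      then obtain s where s: "last_below (set S) t s" "\<forall>u. r0 \<le> u \<and> u < t \<and> u \<le> n \<and> a u < c \<longrightarrow> a u \<le> a s"
        using S(6) by blast
      have "r0 \<le> s" using s(1) S(4) by (auto simp: last_below_def)
      then have rs: "\<forall>r\<in>R. r \<le> s" using r0_ge le_trans by blast
      then have "last_below (set L) t s" using s(1) unfolding setL last_below_def by blast
      then show ?thesis using s(2) r0(1) \<open>r0 \<le> s\<close> rs by blast
    next
      case False
      \<comment> \<open>For \<open>t \<le> r0\<close> the preceding chain row belongs to
        \<open>R\<close>, and its addability plays the role of the record property: later parts up
        to row \<open>k\<close> are smaller or at least \<open>c\<close>.\<close>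
      define s where "s = Max {r \<in> R. r < t}"
      have fin': "finite {r \<in> R. r < t}" using fin by simp
      have "s \<in> {r \<in> R. r < t}" unfolding s_def using fin' \<open>\<exists>r\<in>R. r < t\<close> by (intro Max_in) auto
      then have s: "s \<in> R" "s < t" by auto
      have smax: "r \<le> s" if "r \<in> R" "r < t" for r unfolding s_def using that fin' by (intro Max_ge) auto
      have "last_below (set L) t s"
        unfolding setL last_below_def using s smax S(4) False by auto
      moreover have "a u \<le> a s" if "s \<le> u" "u < t" "a u < c" for u
        using RowD(4)[of s n a k c u] s R that False r0D by (cases "u = s") (auto simp: not_less)
      ultimately show ?thesis using s smax by blast
    qed
    then obtain s p where s: "last_below (set L) t s" "p \<in> R" "p \<le> s" "\<forall>r\<in>R. r < t \<longrightarrow> r \<le> s"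
      "\<forall>u. p \<le> u \<and> u < t \<and> u \<le> n \<and> a u < c \<longrightarrow> a u \<le> a s" by blast
    have sL: "s \<in> set L" "s < t" using s(1) by (auto simp: last_below_def)
    have "last_below (set L) t s' \<longleftrightarrow> s' = s" for s'
      using s(1) by (auto simp: last_below_def intro: le_antisym)
    then have "(\<exists>s. last_below (set L) t s \<and> a s < m \<and> m < c) \<longleftrightarrow> a s < m \<and> m < c" by auto
    also have "\<dots> \<longleftrightarrow> (\<exists>r\<in>R. drops a c r m t)"
    proof
      assume am: "a s < m \<and> m < c"
      have "drops a c p m t"
        unfolding drops_def
      proof (intro conjI allI impI)
        show "p < t" "m < c" using s(3) sL am by auto
        fix u assume u: "p \<le> u \<and> u < t"
        show "\<not> (m \<le> a u \<and> a u < c)"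
        proof (cases "u \<le> n")
          case True
          then show ?thesis using s(5) u am by fastforce
        next
          case False
          then have "a u = 0" using wa by (simp add: weak_composition_def)
          then show ?thesis using m by simp
        qed
      qed
      then show "\<exists>r\<in>R. drops a c r m t" using s(2) by blast
    next
      assume "\<exists>r\<in>R. drops a c r m t"
      then obtain r where r: "r \<in> R" "drops a c r m t" by blast
      then have "r \<le> s" using s(4) by (auto simp: drops_def)
      then show "a s < m \<and> m < c" using r(2) sL Lc[OF sL(1)] by (auto simp: drops_def)
    qed
    finally show ?thesis .
  qed
  then show "tail_count n (pieri_term n a c R) m t
      = tail_count n a m t + of_bool (m = c \<and> t \<le> Min R) - of_bool (\<exists>r\<in>R. drops a c r m t)"
    unfolding drop using tail_count_swap_chain[of L n a c m t, OF Lsorted Lne Ln Lc lastL] by (simp add: hdL)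
qed

lemma pieri_term_total:
  assumes "weak_composition n a" "k \<le> n" "R \<subseteq> Row n a k c" "R \<noteq> {}" "1 \<le> m"
  shows "tail_count n (pieri_term n a c R) m 1 = tail_count n a m 1 + of_bool (m = c)"
proof -
  have "finite R" using assms(3) finite_Row finite_subset by blast
  then have "Min R \<in> R" using assms(4) by simp
  then have "1 \<le> Min R" using RowD(1) assms(3) by blast
  moreover have "\<not> drops a c r m 1" if "r \<in> R" for r
    using RowD(1)[of r n a k c] assms(3) that by (auto simp: drops_def)
  ultimately show ?thesis using pieri_term_props(2)[OF assms(1-4,5), of 1] by simp
qed

text \<open>Intersecting means taking the minimum of the bounds. At \<open>m = c\<close> there are
  no drops and the smallest bonus is that of \<open>Min R\<close>; at other thresholds there is no
  bonus, and the bound is lowered as soon as one row of \<open>R\<close> drops.\<close>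

lemma bruhat_le_pieri_term:
  assumes wa: "weak_composition n a" and k: "k \<le> n" and R: "R \<subseteq> Row n a k c" "R \<noteq> {}"
  shows "{d. bruhat_le n d (pieri_term n a c R)} = (\<Inter>r\<in>R. row_region n a c r)"
proof (rule set_eqI)
  fix d
  have fin: "finite R" using R finite_Row finite_subset by blast
  have MinR: "Min R \<in> R" using fin R(2) by simp
  let ?e = "\<lambda>m t r. of_bool (m = c \<and> t \<le> r) - of_bool (drops a c r m t) :: int"
  let ?E = "\<lambda>m t. of_bool (m = c \<and> t \<le> Min R) - of_bool (\<exists>r\<in>R. drops a c r m t) :: int"
  have iff: "tail_count n d m t \<le> tail_count n (pieri_term n a c R) m t \<longleftrightarrow>
    (\<forall>r\<in>R. tail_count n d m t \<le> tail_count n a m t + of_bool (m = c \<and> t \<le> r) - of_bool (drops a c r m t))"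
    if m: "1 \<le> m" for m t
  proof -
    have "?E m t \<le> ?e m t r" if "r \<in> R" for r
    proof -
      have "Min R \<le> r" using fin that by simp
      then have "(of_bool (m = c \<and> t \<le> Min R) :: int) \<le> of_bool (m = c \<and> t \<le> r)" by auto
      moreover have "(of_bool (drops a c r m t) :: int) \<le> of_bool (\<exists>r\<in>R. drops a c r m t)" using that by auto
      ultimately show ?thesis by linarith
    qed
    moreover have "\<exists>r\<in>R. ?e m t r = ?E m t"
    proof (cases "\<exists>r\<in>R. drops a c r m t")
      case True
      then obtain r where "r \<in> R" "drops a c r m t" by blast
      moreover from this have "m \<noteq> c" by (simp add: drops_def)
      ultimately show ?thesis using True by auto
    next
      case False
      then have "\<not> drops a c (Min R) m t" using MinR by blast
      then show ?thesis using False MinR by (intro bexI[of _ "Min R"]) simp_all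
    qed
    ultimately show ?thesis
      unfolding pieri_term_props(2)[OF wa k R m] diff_conv_add_uminus add.assoc
      by (smt (verit, ccfv_threshold))
  qed
  show "d \<in> {d. bruhat_le n d (pieri_term n a c R)} \<longleftrightarrow> d \<in> (\<Inter>r\<in>R. row_region n a c r)"
  proof
    assume "d \<in> {d. bruhat_le n d (pieri_term n a c R)}"
    then have d: "bruhat_le n d (pieri_term n a c R)" by simp
    show "d \<in> (\<Inter>r\<in>R. row_region n a c r)"
      unfolding INT_iff row_region_def region_def mem_Collect_eq
    proof (intro ballI conjI allI impI)
      show "weak_composition n d" using d by (simp add: bruhat_le_def)
      fix r m :: nat assume r: "r \<in> R" and m: "1 \<le> m"
      show "tail_count n d m 1 = tail_count n a m 1 + of_bool (m = c)"
        using bruhat_le_total[OF d, of m] pieri_term_total[OF wa k R m] by simp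
      fix t :: nat assume "1 \<le> t"
      then show "tail_count n d m t \<le> tail_count n a m t + of_bool (m = c \<and> t \<le> r) - of_bool (drops a c r m t)"
        using bruhat_le_tail_count[OF d] iff[OF m] r by blast
    qed
  next
    assume "d \<in> (\<Inter>r\<in>R. row_region n a c r)"
    then have d: "\<And>r. r \<in> R \<Longrightarrow> d \<in> row_region n a c r" by blast
    show "d \<in> {d. bruhat_le n d (pieri_term n a c R)}"
      unfolding mem_Collect_eq bruhat_le_def
    proof (intro conjI allI impI)
      show "weak_composition n d" using d[OF MinR] by (simp add: row_region_def region_def)
      fix m :: nat assume m: "1 \<le> m"
      show "tail_count n d m 1 = tail_count n (pieri_term n a c R) m 1"
        using d[OF MinR] m pieri_term_total[OF wa k R m] by (simp add: row_region_def region_def)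
      fix t :: nat assume t: "1 \<le> t"
      show "tail_count n d m t \<le> tail_count n (pieri_term n a c R) m t"
        unfolding iff[OF m]
      proof
        fix r assume "r \<in> R"
        from d[OF this] m t
        show "tail_count n d m t \<le> tail_count n a m t + of_bool (m = c \<and> t \<le> r) - of_bool (drops a c r m t)"
          unfolding row_region_def region_def by blast
      qed
    qed
  qed
qed

section \<open>Distinctness of the terms\<close>

lemma drops_determines_subset:
  assumes k: "k \<le> n" and R: "R \<subseteq> Row n a k c" "R' \<subseteq> Row n a k c" "R \<noteq> {}" "R' \<noteq> {}"
    and Min: "Min R = Min R'"
    and eq: "\<And>m t. 1 \<le> m \<Longrightarrow> 1 \<le> t \<Longrightarrow> (\<exists>r\<in>R. drops a c r m t) \<longleftrightarrow> (\<exists>r\<in>R'. drops a c r m t)"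
  shows "R \<subseteq> R'"
proof
  fix r assume r: "r \<in> R"
  have fin: "finite R" "finite R'" using R finite_Row finite_subset by blast+
  have MR: "Min R \<in> R" using fin(1) R(3) by simp
  have MR': "Min R \<in> R'" unfolding Min using fin(2) R(4) by simp
  have rRow: "r \<in> Row n a k c" using R r by blast
  show "r \<in> R'"
  proof (cases "r = Min R")
    case True
    then show ?thesis using MR' by simp
  next
    case False
    have "Min R \<le> r" using fin(1) r by (rule Min_le)
    then have "a r < a (Min R)"
      using False RowD(4)[of "Min R" n a k c r] MR R(1) RowD(2,3)[OF rRow] by auto
    moreover have "a (Min R) < c" using RowD(3) MR R by blast
    ultimately have mc: "Suc (a r) < c" by simp
    \<comment> \<open>The drop is tested immediately above row \<open>r\<close> and its part. Were
      it caused in \<open>R'\<close> by another row, it would already be visible at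
      \<open>t = r\<close>, hence come from a lower row of \<open>R\<close> with a part at most
      \<open>a r\<close>; but addability of that row demands a larger part there.\<close>
    have "drops a c r (Suc (a r)) (Suc r)"
      unfolding drops_def using mc by (auto simp: less_Suc_eq_le)
    then obtain r' where r': "r' \<in> R'" "drops a c r' (Suc (a r)) (Suc r)"
      using eq[of "Suc (a r)" "Suc r"] r by auto
    show ?thesis
    proof (rule ccontr)
      assume "r \<notin> R'"
      then have "r' \<noteq> r" using r' by auto
      then have "drops a c r' (Suc (a r)) r" using r'(2) by (auto simp: drops_def)
      then obtain r'' where r'': "r'' \<in> R" "drops a c r'' (Suc (a r)) r"
        using eq[of "Suc (a r)" r] r'(1) RowD(1)[OF rRow] by auto
      then have "r'' < r" "\<not> (Suc (a r) \<le> a r'' \<and> a r'' < c)" by (auto simp: drops_def)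
      moreover have "r'' \<in> Row n a k c" using r'' R by blast
      ultimately show False
        using RowD(3)[of r''] RowD(4)[of r'' n a k c r] RowD(2,3)[OF rRow] by auto
    qed
  qed
qed

text \<open>The column is where the totals grow, \<open>Min R\<close> is where the bonus at
  \<open>m = c\<close> ends, and the drops recover the rest of \<open>R\<close>.\<close>

lemma pieri_term_inj:
  assumes wa: "weak_composition n a" and k: "k \<le> n"
    and R: "R \<subseteq> Row n a k c" "R \<noteq> {}" and R': "R' \<subseteq> Row n a k c'" "R' \<noteq> {}"
    and eq: "pieri_term n a c R = pieri_term n a c' R'"
  shows "c = c' \<and> R = R'"
proof
  have c: "1 \<le> c" "1 \<le> c'" using R R' RowD(3) by fastforce+
  show cc: "c = c'"
    using pieri_term_total[OF wa k R c(1)] pieri_term_total[OF wa k R' c(1)] eq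
    by (auto split: if_splits)
  have t: "of_bool (m = c \<and> t \<le> Min R) - of_bool (\<exists>r\<in>R. drops a c r m t)
    = (of_bool (m = c \<and> t \<le> Min R') - of_bool (\<exists>r\<in>R'. drops a c r m t) :: int)" if "1 \<le> m" for m t
    using pieri_term_props(2)[OF wa k R that, of t] pieri_term_props(2)[OF wa k R' that, of t] eq cc by simp
  have le: "t \<le> Min R \<longleftrightarrow> t \<le> Min R'" for t
    using t[OF c(1), of t] by (auto simp: drops_def of_bool_def split: if_splits)
  have Min: "Min R = Min R'" using le[of "Min R"] le[of "Min R'"] by simp
  have "(\<exists>r\<in>R. drops a c r m t) \<longleftrightarrow> (\<exists>r\<in>R'. drops a c r m t)" if "1 \<le> m" for m t
  proof -
    have "(of_bool (\<exists>r\<in>R. drops a c r m t) :: int) = of_bool (\<exists>r\<in>R'. drops a c r m t)"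
      using t[OF that, of t] Min by simp
    then show ?thesis by (simp only: of_bool_eq_iff)
  qed
  then show "R = R'"
    using drops_determines_subset[OF k R(1) R'(1)[folded cc] R(2) R'(2) Min]
      drops_determines_subset[OF k R'(1)[folded cc] R(1) R'(2) R(2) Min[symmetric]] by blast
qed

definition weight_vector :: "nat \<Rightarrow> diagram \<Rightarrow> nat \<Rightarrow>\<^sub>0 nat" where
  "weight_vector n T = (\<Sum>i=1..n. Poly_Mapping.single i (wt T i))"

lemma xvar_power: "xvar i ^ m = Poly_Mapping.single (Poly_Mapping.single i m) 1"
proof (induction m)
  case (Suc m)
  then show ?case by (simp add: xvar_def mult_single flip: single_add)
qed simp

lemma prod_single: "(\<Prod>i\<in>A. Poly_Mapping.single (f i) (1::int)) = Poly_Mapping.single (\<Sum>i\<in>A. f i) 1"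
  by (induction A rule: infinite_finite_induct) (auto simp: mult_single)

lemma key_poly_weights: "key_poly n a = (\<Sum>T\<in>KD n a. Poly_Mapping.single (weight_vector n T) 1)"
  by (simp add: key_poly_def xvar_power prod_single weight_vector_def)

lemma lookup_key_poly:
  "Poly_Mapping.lookup (key_poly n a) e = (\<Sum>T\<in>KD n a. of_bool (weight_vector n T = e))"
  by (auto simp: key_poly_weights lookup_sum lookup_single when_def of_bool_def intro!: sum.cong)

lemma lookup_key_poly_nonneg: "0 \<le> Poly_Mapping.lookup (key_poly n a) e"
  by (simp add: lookup_key_poly sum_nonneg)

lemma lookup_key_poly_pos:
  "0 < Poly_Mapping.lookup (key_poly n a) (weight_vector n (key_diagram n a))"
proof -
  have "(\<Sum>T\<in>{key_diagram n a}. of_bool (weight_vector n T = weight_vector n (key_diagram n a)))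
    \<le> Poly_Mapping.lookup (key_poly n a) (weight_vector n (key_diagram n a))"
    unfolding lookup_key_poly by (rule sum_mono2[OF finite_KD]) (auto simp: KD_def)
  then show ?thesis by simp
qed

lemma lookup_weight_vector: "i \<in> {1..n} \<Longrightarrow> Poly_Mapping.lookup (weight_vector n T) i = wt T i"
  by (simp add: weight_vector_def lookup_sum lookup_single when_def)

text \<open>Every move carries a cell to a lower row, so the weight in the rows from
  \<open>t\<close> on can only shrink.\<close>

lemma kohnert_moves_weight_le:
  assumes "kohnert_move\<^sup>*\<^sup>* (key_diagram n a) T"
  shows "finite T \<and> T \<subseteq> UNIV \<times> {1..n} \<and> (\<forall>t. (\<Sum>i=t..n. wt T i) \<le> (\<Sum>i=t..n. wt (key_diagram n a) i))"
  using assms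
proof (induction rule: rtranclp_induct)
  case base
  have "key_diagram n a \<subseteq> (\<Union>r\<in>{1..n}. {1..a r} \<times> {r})" by (auto simp: key_diagram_def)
  then have "finite (key_diagram n a)" by (rule finite_subset) simp
  then show ?case by (auto simp: key_diagram_def)
next
  case (step T T')
  obtain c r r' where m: "(c, r) \<in> T" "1 \<le> r'" "r' < r" "(c, r') \<notin> T" "T' = insert (c, r') (T - {(c, r)})"
    using step.hyps(2) unfolding kohnert_move_def by blast
  have T: "finite T" "T \<subseteq> UNIV \<times> {1..n}" using step.IH by auto
  have rn: "r \<le> n" using m(1) T(2) by auto
  have fin: "finite {c. (c, i) \<in> T}" for i
    using finite_imageI[OF T(1), of fst] by (rule finite_subset[rotated]) force
  have "int (wt T' i) = int (wt T i) + of_bool (i = r') - of_bool (i = r)" for i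
  proof -
    consider "i = r'" | "i = r" | "i \<noteq> r" "i \<noteq> r'" by blast
    then show ?thesis
    proof cases
      case 1
      then have "{c. (c, i) \<in> T'} = insert c {c. (c, i) \<in> T}" using m by auto
      then show ?thesis using 1 m fin[of i] by (simp add: wt_def)
    next
      case 2
      then have "{c. (c, i) \<in> T'} = {c. (c, i) \<in> T} - {c}" using m by auto
      moreover have "0 < card {c. (c, i) \<in> T}" using 2 m(1) fin[of i] by (auto simp: card_gt_0_iff)
      ultimately show ?thesis using 2 m fin[of i] by (simp add: wt_def)
    next
      case 3
      then have "{c. (c, i) \<in> T'} = {c. (c, i) \<in> T}" using m by auto
      then show ?thesis using 3 by (simp add: wt_def)
    qed
  qed
  then have "(\<Sum>i=t..n. int (wt T' i)) = (\<Sum>i=t..n. int (wt T i)) + (\<Sum>i=t..n. if i = r' then 1 else 0) - (\<Sum>i=t..n. if i = r then 1 else 0)" for t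
    by (simp add: sum.distrib sum_subtractf of_bool_def)
  then have "int (\<Sum>i=t..n. wt T' i) \<le> int (\<Sum>i=t..n. wt T i)" for t
    using m(3) rn by (simp add: sum.delta)
  then have "(\<Sum>i=t..n. wt T' i) \<le> (\<Sum>i=t..n. wt T i)" for t by (simp only: of_nat_le_iff)
  then show ?case using step.IH T m rn by (auto intro: order_trans)
qed

lemma lookup_key_poly_imp_le:
  assumes "0 < Poly_Mapping.lookup (key_poly n b) (weight_vector n (key_diagram n a))" and t: "1 \<le> t"
  shows "(\<Sum>i=t..n. a i) \<le> (\<Sum>i=t..n. b i)"
proof -
  obtain T where T: "T \<in> KD n b" "weight_vector n T = weight_vector n (key_diagram n a)"
  proof -
    have "(\<Sum>T\<in>KD n b. of_bool (weight_vector n T = weight_vector n (key_diagram n a)) :: int) \<noteq> 0"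
      using assms(1) unfolding lookup_key_poly by simp
    then obtain T where "T \<in> KD n b" "(of_bool (weight_vector n T = weight_vector n (key_diagram n a)) :: int) \<noteq> 0"
      by (rule sum.not_neutral_contains_not_neutral)
    then show ?thesis using that by simp
  qed
  have "wt T i = a i" if "i \<in> {1..n}" for i
    using lookup_weight_vector[OF that, of T] lookup_weight_vector[OF that, of "key_diagram n a"] T(2)
      wt_key_diagram[OF that] by simp
  then have "(\<Sum>i=t..n. a i) = (\<Sum>i=t..n. wt T i)" using t by (intro sum.cong) auto
  also have "\<dots> \<le> (\<Sum>i=t..n. wt (key_diagram n b) i)"
    using kohnert_moves_weight_le[of n b T] T(1) by (simp add: KD_def)
  also have "\<dots> = (\<Sum>i=t..n. b i)" using t by (intro sum.cong) (auto simp: wt_key_diagram)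
  finally show ?thesis .
qed

text \<open>Nonnegative coefficients, one of them positive, exclude opposite signs. Then the weight
  of each key diagram occurs in the other polynomial, and domination of tail sums in both directions
  gives equality.\<close>

lemma key_poly_inj_up_to_sign:
  assumes wc: "weak_composition n a" "weak_composition n b"
    and eq: "(-1) ^ p * key_poly n a = (-1) ^ q * key_poly n b"
  shows "a = b"
proof -
  let ?wa = "weight_vector n (key_diagram n a)" and ?wb = "weight_vector n (key_diagram n b)"
  have "key_poly n a = key_poly n b \<or> - key_poly n a = key_poly n b \<or> key_poly n a = - key_poly n b"
    using eq by (cases "even p"; cases "even q") auto
  then have "key_poly n a = key_poly n b \<or> key_poly n a = - key_poly n b"
    by (metis minus_minus)
  moreover have "key_poly n a \<noteq> - key_poly n b"
  proof
    assume "key_poly n a = - key_poly n b"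
    then have "Poly_Mapping.lookup (key_poly n a) ?wa = - Poly_Mapping.lookup (key_poly n b) ?wa" by simp
    then show False using lookup_key_poly_pos[of n a] lookup_key_poly_nonneg[of n b ?wa] by simp
  qed
  ultimately have key: "key_poly n a = key_poly n b" by blast
  have sums: "(\<Sum>i=t..n. a i) = (\<Sum>i=t..n. b i)" if "1 \<le> t" for t
    using lookup_key_poly_imp_le[of n b a t] lookup_key_poly_imp_le[of n a b t]
      lookup_key_poly_pos[of n a] lookup_key_poly_pos[of n b] key that by simp
  show "a = b"
  proof
    fix i
    show "a i = b i"
    proof (cases "i \<in> {1..n}")
      case True
      then show ?thesis using sums[of i] sums[of "Suc i"] by (simp add: sum.atLeast_Suc_atMost[of i])
    next
      case False
      then show ?thesis using wc by (simp add: weak_composition_def)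
    qed
  qed
qed

section \<open>Inclusion-exclusion over sets of addable rows\<close>

lemma Row_column_bounds:
  assumes "r \<in> Row n a k c" "k \<le> n" "a \<in> compositions n w"
  shows "1 \<le> c" "c \<le> Suc w"
proof -
  show "1 \<le> c" using RowD(3)[OF assms(1)] by simp
  obtain l where "Suc (a l) = c" using Row_ex_part[OF assms(1,2)] by metis
  moreover have "a l \<le> w" using assms(3) by (simp add: compositions_def)
  ultimately show "c \<le> Suc w" by simp
qed

lemma pieri_index_eq_Sigma:
  assumes "k \<le> n" "a \<in> compositions n w"
  shows "pieri_index n a k = (SIGMA c:{1..Suc w}. {R. R \<subseteq> Row n a k c \<and> R \<noteq> {}})"
  using Row_column_bounds[OF _ assms] unfolding pieri_index_def k_addable_column_def by fastforce

text \<open>Inclusion-exclusion for the additive function that sends a finite set of compositions to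
  the sum of its atoms.\<close>

lemma sum_atoms_pieri_region:
  assumes a: "a \<in> compositions n w" and k: "k \<le> n" and c: "c \<in> {1..Suc w}"
  shows "(\<Sum>d\<in>pieri_region n a c k. atom n (Suc w) d)
    = (\<Sum>R | R \<subseteq> Row n a k c \<and> R \<noteq> {}. (-1) ^ (card R - 1) * key_poly n (pieri_term n a c R))"
proof -
  have wa: "weak_composition n a" using a by (simp add: compositions_def)
  have sub: "row_region n a c r \<subseteq> compositions n (Suc w)" if "r \<in> Row n a k c" for r
    using row_region_subset[OF RowD(2)[OF that], of n a c] pieri_region_compositions[OF a, of c _ k] c by auto
  have fin: "finite (row_region n a c r)" if "r \<in> Row n a k c" for r
    by (rule finite_subset[OF sub[OF that] finite_compositions])
  interpret Incl_Excl finite "\<lambda>X. \<Sum>d\<in>X. atom n (Suc w) d"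
    by unfold_locales (auto simp: sum.union_disjoint disjnt_def)
  have "(\<Sum>d\<in>pieri_region n a c k. atom n (Suc w) d)
    = (\<Sum>R | R \<subseteq> Row n a k c \<and> R \<noteq> {}. (-1) ^ (card R + 1) * (\<Sum>d\<in>(\<Inter>r\<in>R. row_region n a c r). atom n (Suc w) d))"
    using pieri_region_eq_Union[OF wa _ k, of c] c fin
    by (subst restricted_indexed[symmetric, OF finite_Row]) auto
  also have "\<dots> = (\<Sum>R | R \<subseteq> Row n a k c \<and> R \<noteq> {}. (-1) ^ (card R - 1) * key_poly n (pieri_term n a c R))"
  proof (rule sum.cong[OF refl])
    fix R assume "R \<in> {R. R \<subseteq> Row n a k c \<and> R \<noteq> {}}"
    then have R: "R \<subseteq> Row n a k c" "R \<noteq> {}" by auto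
    have "0 < card R" using R finite_Row finite_subset by (metis card_gt_0_iff)
    then have "card R + 1 = card R - 1 + 2" by simp
    then have sign: "(-1 :: mpoly) ^ (card R + 1) = (-1) ^ (card R - 1)" by (simp only: power_add) simp
    \<comment> \<open>The term lies in its own Bruhat interval, hence in some
      \<open>row_region\<close>, where all parts are at most \<open>Suc w\<close>.\<close>
    have "bruhat_le n (pieri_term n a c R) (pieri_term n a c R)"
      by (rule bruhat_le_refl[OF pieri_term_props(1)[OF wa k R]])
    then have "pieri_term n a c R \<in> compositions n (Suc w)"
      using bruhat_le_pieri_term[OF wa k R] sub R by blast
    then show "(-1) ^ (card R + 1) * (\<Sum>d\<in>(\<Inter>r\<in>R. row_region n a c r). atom n (Suc w) d)
      = (-1) ^ (card R - 1) * key_poly n (pieri_term n a c R)"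
      unfolding sign by (simp only: key_poly_eq_sum_atoms bruhat_le_pieri_term[OF wa k R])
  qed
  finally show ?thesis .
qed

theorem theorem3p3p6:
  fixes n k :: nat and a :: "nat \<Rightarrow> nat"
  assumes "weak_composition n a" and "1 \<le> k" and "k \<le> n"
  shows "key_poly n a * schur1 k =
           (\<Sum>(c, R)\<in>pieri_index n a k. (-1) ^ (card R - 1) *
              key_poly n (add_composition (drop_composition n a c R) (unit_composition (Min R))))
       \<and> inj_on (\<lambda>(c, R). (-1) ^ (card R - 1) *
              key_poly n (add_composition (drop_composition n a c R) (unit_composition (Min R))))
           (pieri_index n a k)
       \<and> inj_on (\<lambda>(c, R).
              key_poly n (add_composition (drop_composition n a c R) (unit_composition (Min R))))
           (pieri_index n a k)"
proof -
  have inj: "(c, R) = (c', R')"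
    if "(c, R) \<in> pieri_index n a k" "(c', R') \<in> pieri_index n a k"
      "(-1) ^ p * key_poly n (pieri_term n a c R) = (-1) ^ q * key_poly n (pieri_term n a c' R')"
    for c R c' R' p q
  proof -
    have R: "R \<subseteq> Row n a k c" "R \<noteq> {}" "R' \<subseteq> Row n a k c'" "R' \<noteq> {}"
      using that(1,2) by (auto simp: pieri_index_def)
    have "pieri_term n a c R = pieri_term n a c' R'"
      by (rule key_poly_inj_up_to_sign[OF pieri_term_props(1)[OF assms(1,3) R(1,2)]
          pieri_term_props(1)[OF assms(1,3) R(3,4)] that(3)])
    then show ?thesis using pieri_term_inj[OF assms(1,3) R] by simp
  qed
  define w where "w = Max (a ` {..n})"
  have "a i \<le> w" for i
  proof (cases "i \<le> n")
    case False
    then show ?thesis using assms(1) by (simp add: weak_composition_def)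
  qed (simp add: w_def)
  then have a: "a \<in> compositions n w" using assms(1) by (simp add: compositions_def)
  have "key_poly n a * schur1 k = (\<Sum>d\<in>pieri_support n (Suc w) a k. atom n (Suc w) d)"
    by (rule key_poly_times_schur1[OF a assms(3)])
  also have "\<dots> = (\<Sum>c=1..Suc w. \<Sum>d\<in>pieri_region n a c k. atom n (Suc w) d)"
    unfolding pieri_support_def
  proof (rule sum.UNION_disjoint)
    show "\<forall>c\<in>{1..Suc w}. finite (pieri_region n a c k)"
      using pieri_region_compositions[OF a] finite_subset[OF _ finite_compositions[of n "Suc w"]]
      by (metis atLeastAtMost_iff subsetI)
    show "\<forall>c\<in>{1..Suc w}. \<forall>c'\<in>{1..Suc w}. c \<noteq> c' \<longrightarrow> pieri_region n a c k \<inter> pieri_region n a c' k = {}"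
      using pieri_region_column_unique[of _ n a _ k _ k] by fastforce
  qed simp
  also have "\<dots> = (\<Sum>c=1..Suc w. \<Sum>R | R \<subseteq> Row n a k c \<and> R \<noteq> {}.
      (-1) ^ (card R - 1) * key_poly n (pieri_term n a c R))"
    by (rule sum.cong[OF refl sum_atoms_pieri_region[OF a assms(3)]])
  also have "\<dots> = (\<Sum>(c, R)\<in>pieri_index n a k. (-1) ^ (card R - 1) * key_poly n (pieri_term n a c R))"
    unfolding pieri_index_eq_Sigma[OF assms(3) a]
    by (rule sum.Sigma) (auto simp: finite_Row)
  finally have expansion: "key_poly n a * schur1 k
    = (\<Sum>(c, R)\<in>pieri_index n a k. (-1) ^ (card R - 1) * key_poly n (pieri_term n a c R))" .
  \<comment> \<open>With the exponent left free, \<open>card R - 1\<close> yields distinct signed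
    terms and 0 yields distinct key polynomials.\<close>
  have "inj_on (\<lambda>(c, R). (-1) ^ p R * key_poly n (pieri_term n a c R)) (pieri_index n a k)" for p
  proof (rule inj_onI)
    fix x y assume xy: "x \<in> pieri_index n a k" "y \<in> pieri_index n a k"
      "(case x of (c, R) \<Rightarrow> (-1) ^ p R * key_poly n (pieri_term n a c R))
        = (case y of (c, R) \<Rightarrow> (-1) ^ p R * key_poly n (pieri_term n a c R))"
    obtain c R c' R' where "x = (c, R)" "y = (c', R')" by (metis surj_pair)
    then show "x = y" using inj[of c R c' R' "p R" "p R'"] xy by simp
  qed
  from expansion this[of "\<lambda>R. card R - 1"] this[of "\<lambda>_. 0"] show ?thesis by simp
qed

end
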